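(* Let $\mathcal F=(F,<,+,\cdot,0,1,\ldots)$ be a definably complete expansion of an ordered field which enjoys the definable choice property, admits a good $(0+)$-pseudo-filter $\mathfrak D$, and has a good extended rank function $\operatorname{eRank}$. Let $X$ be a locally closed definable set and let $E$ be a definable equivalence relation on $X$ which is closed in $X\times X$. For $i=1,2$ let $p_i:E\to X$ be the restriction to $E$ of the canonical projection $X\times X\to X$ onto the $i$-th factor. The following are equivalent: (1) There exists a definable quotient of $X$ by $E$. (2) There exists a definable closed subset $K$ of $X$ (closed in $X$) such that the restriction $p_1|_{p_2^{-1}(K)}:p_2^{-1}(K)\to X$ is definably proper and surjective.
   Context: Let $\mathcal F=(F,<,\ldots)$ be an expansion of a dense linear order without endpoints. "Definable" means definable in $\mathcal F$ with parameters; a definable map is a map between definable sets whose graph is definable. $F$ carries the order topology, $F^n$ the product topology, and subsets of $F^n$ the relative topology. A definable subset of $F^n$ is called locally closed if it is so in $F^n$. $\mathcal F$ is definably complete if every definable subset of $F$ has both a supremum and an infimum in $F\cup\{\pm\infty\}$. A definable subset of $F^n$ is definably compact if it is closed and bounded in $F^n$. Definable choice property: (1) for every coordinate projection $\pi:F^{m+n}\to F^m$ and definable sets $X\subseteq F^m$, $Y\subseteq F^{m+n}$ with $\pi(Y)=X$, there is a definable map $\varphi:X\to Y$ with $\pi(\varphi(x))=x$ for all $x\in X$; (2) for every definable equivalence relation $E$ on a definable set $X$ (i.e. $E\subseteq X\times X$ is definable and is an equivalence relation) there is a definable subset $S\subseteq X$ meeting each equivalence class of $E$ in exactly one point. Good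 $(0+)$-pseudo-filter: let $\mathfrak D$ be a nonempty family of definable subsets of $(0,\infty)$ whose closure in $F$ contains $0$. For a definable set $D\subseteq(0,\infty)$ with $0$ in its closure and a definable map $f:D\to F^n$, the limit set $\operatorname{Lim}(f)$ is the set of $p\in F^n$ such that $f^{-1}(B)\cap I\neq\emptyset$ for every open box $B\subseteq F^n$ containing $p$ and every open interval $I$ containing $0$. $\mathfrak D$ is a good $(0+)$-pseudo-filter if: (a) each $D\in\mathfrak D$ is bounded in $F$ and $\operatorname{cl}_F(D)=D\cup\{0\}$; (b) for each $D\in\mathfrak D$ and definable $D_1,D_2$ with $D=D_1\cup D_2$, either $D_1$ or $D_2$ contains an element of $\mathfrak D$; (c) for $D\in\mathfrak D$ and a definable map $\gamma:D\to F^n$, there is $D'\in\mathfrak D$ with $D'\subseteq D$ such that $\gamma|_{D'}$ is continuous; furthermore, if $\operatorname{Lim}(\gamma)\ne\emptyset$, $D'$ can be taken so that $\operatorname{Lim}(\gamma|_{D'})$ is a singleton. Good extended rank function: for each $n\ge 0$, let $\operatorname{Def}(F^n)$ be the set of definable subsets of $F^n$. $\mathcal F$ has a good extended rank function if for each $n$ there is a map $\operatorname{eRank}_n:\operatorname{Def}(F^n)\to\mathcal E_n\cup\{-\infty\}$ such that: (a) $\mathcal E_n$ is a linearly ordered set with a smallest element and $-\infty$ is smaller than any element of $\mathcal E_n$; (b) $\operatorname{eRank}_n(X)=-\infty$ iff $X=\emptyset$; (c) there is no infinite strictly decreasing sequence in $\mathcal E_n$; (d) $\operatorname{eRank}_n(A\cup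 B)=\max\{\operatorname{eRank}_n(A),\operatorname{eRank}_n(B)\}$; (e) if $X\subseteq Y$ are in $\operatorname{Def}(F^n)$ and $\operatorname{eRank}_n(X)=\operatorname{eRank}_n(Y)$, there is a definable subset $U$ of $X$ that is open in $Y$ with $\operatorname{eRank}_n(X\setminus U)<\operatorname{eRank}_n(Y)$; (f) a nonempty $X\in\operatorname{Def}(F^n)$ is discrete whenever $\operatorname{eRank}_n(X)$ is the smallest element of $\mathcal E_n$. A definable continuous map $f:X\to Y$ is definably proper if $f^{-1}(K)$ is definably compact for every definably compact subset $K$ of $Y$. A definable continuous map $f:X\to Y$ is definably identifying if it is surjective and, for every definable subset $K$ of $Y$, $K$ is closed in $Y$ whenever $f^{-1}(K)$ is closed in $X$. A definable quotient of $X$ by $E$ is a definably identifying map $f:X\to Y$ (to some definable set $Y$) such that $f(x)=f(x')$ if and only if $(x,x')\in E$. *)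

theory Defs
  imports
    "HOL-Analysis.Analysis"
    "HOL-Library.Lub_Glb"
    "HOL-Library.Extended"
    "HOL-Library.Option_ord"
begin

section \<open>Expansions of an ordered field and their definable sets\<close>

text \<open>
  The ordered field \<open>F\<close> is a type of sort \<open>{linordered_field, linorder_topology}\<close>; the second
  class says that its topology is the order topology. The record holds the remaining part of the
  structure. Symbols carry no arity: a symbol applied to a list of length \<open>k\<close> acts as a \<open>k\<close>-ary
  symbol, so that any family of functions and relations on \<open>F\<close> can be named.
\<close>

record ('a, 'f, 'r) expansion =
  fun_interp :: "'f \<Rightarrow> 'a list \<Rightarrow> 'a"
  rel_interp :: "'r \<Rightarrow> 'a list \<Rightarrow> bool"

text \<open>
  First-order formulas in the language \<open>(<, +, \<cdot>, \<dots>)\<close> with parameters from \<open>F\<close> (\<open>0\<close> and \<open>1\<close>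
  are parameters). Variables are de Bruijn indices: \<open>Ex\<close> binds variable 0 and shifts the others.
\<close>

datatype ('a, 'f) trm =
    Var nat
  | Param 'a
  | Plus "('a, 'f) trm" "('a, 'f) trm"
  | Times "('a, 'f) trm" "('a, 'f) trm"
  | Fun 'f "('a, 'f) trm list"

datatype ('a, 'f, 'r) fm =
    Equal "('a, 'f) trm" "('a, 'f) trm"
  | Less "('a, 'f) trm" "('a, 'f) trm"
  | Rel 'r "('a, 'f) trm list"
  | Neg "('a, 'f, 'r) fm"
  | Conj "('a, 'f, 'r) fm" "('a, 'f, 'r) fm"
  | Ex "('a, 'f, 'r) fm"

primrec trm_val ::
  "('a::linordered_field, 'f, 'r) expansion \<Rightarrow> (nat \<Rightarrow> 'a) \<Rightarrow> ('a, 'f) trm \<Rightarrow> 'a" where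
  "trm_val M e (Var i) = e i"
| "trm_val M e (Param a) = a"
| "trm_val M e (Plus s t) = trm_val M e s + trm_val M e t"
| "trm_val M e (Times s t) = trm_val M e s * trm_val M e t"
| "trm_val M e (Fun f ts) = fun_interp M f (map (trm_val M e) ts)"

primrec sat ::
  "('a::linordered_field, 'f, 'r) expansion \<Rightarrow> (nat \<Rightarrow> 'a) \<Rightarrow> ('a, 'f, 'r) fm \<Rightarrow> bool" where
  "sat M e (Equal s t) \<longleftrightarrow> trm_val M e s = trm_val M e t"
| "sat M e (Less s t) \<longleftrightarrow> trm_val M e s < trm_val M e t"
| "sat M e (Rel r ts) \<longleftrightarrow> rel_interp M r (map (trm_val M e) ts)"
| "sat M e (Neg \<phi>) \<longleftrightarrow> \<not> sat M e \<phi>"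
| "sat M e (Conj \<phi> \<psi>) \<longleftrightarrow> sat M e \<phi> \<and> sat M e \<psi>"
| "sat M e (Ex \<phi>) \<longleftrightarrow> (\<exists>a. sat M (case_nat a e) \<phi>)"

text \<open>The space \<open>F\<^sup>n\<close>, its product topology, and the identification of \<open>F\<close> with \<open>F\<^sup>1\<close>.\<close>

definition Fn :: "nat \<Rightarrow> (nat \<Rightarrow> 'a) set" where
  "Fn n = ({..<n} \<rightarrow>\<^sub>E UNIV)"

definition Fn_top :: "nat \<Rightarrow> (nat \<Rightarrow> 'a::topological_space) topology" where
  "Fn_top n = product_topology (\<lambda>_. euclidean) {..<n}"

abbreviation top_on :: "nat \<Rightarrow> (nat \<Rightarrow> 'a::topological_space) set \<Rightarrow> (nat \<Rightarrow> 'a) topology" where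
  "top_on n X \<equiv> subtopology (Fn_top n) X"

definition vec1 :: "'a \<Rightarrow> nat \<Rightarrow> 'a" where
  "vec1 a = (\<lambda>i\<in>{..<1}. a)"

definition concat_vec :: "nat \<Rightarrow> nat \<Rightarrow> (nat \<Rightarrow> 'a) \<Rightarrow> (nat \<Rightarrow> 'a) \<Rightarrow> nat \<Rightarrow> 'a" where
  "concat_vec m n x y = (\<lambda>i\<in>{..<m + n}. if i < m then x i else y (i - m))"

text \<open>A set of pairs in \<open>F\<^sup>m \<times> F\<^sup>n\<close>, viewed as a subset of \<open>F\<^sup>m\<^sup>+\<^sup>n\<close>.\<close>

definition flat :: "nat \<Rightarrow> nat \<Rightarrow> ((nat \<Rightarrow> 'a) \<times> (nat \<Rightarrow> 'a)) set \<Rightarrow> (nat \<Rightarrow> 'a) set" where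
  "flat m n R = (\<lambda>(x, y). concat_vec m n x y) ` R"

definition proj1 :: "nat \<Rightarrow> (nat \<Rightarrow> 'a) \<Rightarrow> nat \<Rightarrow> 'a" where
  "proj1 n z = (\<lambda>i\<in>{..<n}. z i)"

definition proj2 :: "nat \<Rightarrow> (nat \<Rightarrow> 'a) \<Rightarrow> nat \<Rightarrow> 'a" where
  "proj2 n z = (\<lambda>i\<in>{..<n}. z (n + i))"

text \<open>
  A variable of \<open>\<phi>\<close> with index \<open>\<ge> n\<close> takes the fixed value \<open>undefined\<close> of \<open>F\<close> on \<open>F\<^sup>n\<close>, so it only
  acts as a further parameter.
\<close>

definition definable ::
  "('a::linordered_field, 'f, 'r) expansion \<Rightarrow> nat \<Rightarrow> (nat \<Rightarrow> 'a) set \<Rightarrow> bool" where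
  "definable M n X \<longleftrightarrow> (\<exists>\<phi>. X = {x \<in> Fn n. sat M x \<phi>})"

definition definable1 :: "('a::linordered_field, 'f, 'r) expansion \<Rightarrow> 'a set \<Rightarrow> bool" where
  "definable1 M A \<longleftrightarrow> definable M 1 (vec1 ` A)"

definition definable_map ::
  "('a::linordered_field, 'f, 'r) expansion \<Rightarrow> nat \<Rightarrow> nat \<Rightarrow> (nat \<Rightarrow> 'a) set \<Rightarrow> (nat \<Rightarrow> 'a) set \<Rightarrow>
    ((nat \<Rightarrow> 'a) \<Rightarrow> nat \<Rightarrow> 'a) \<Rightarrow> bool" where
  "definable_map M m n X Y f \<longleftrightarrow>
     definable M m X \<and> definable M n Y \<and> f ` X \<subseteq> Y \<and>
     definable M (m + n) (flat m n {(x, f x) | x. x \<in> X})"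

definition definable_map1 ::
  "('a::linordered_field, 'f, 'r) expansion \<Rightarrow> nat \<Rightarrow> 'a set \<Rightarrow> ('a \<Rightarrow> nat \<Rightarrow> 'a) \<Rightarrow> bool" where
  "definable_map1 M n D \<gamma> \<longleftrightarrow> definable_map M 1 n (vec1 ` D) (Fn n) (\<lambda>x. \<gamma> (x 0))"

definition definable_equiv ::
  "('a::linordered_field, 'f, 'r) expansion \<Rightarrow> nat \<Rightarrow> (nat \<Rightarrow> 'a) set \<Rightarrow>
    ((nat \<Rightarrow> 'a) \<times> (nat \<Rightarrow> 'a)) set \<Rightarrow> bool" where
  "definable_equiv M n X E \<longleftrightarrow> equiv X E \<and> definable M (n + n) (flat n n E)"

section \<open>Hypotheses on the structure\<close>

definition definably_complete ::
  "('a::linordered_field, 'f, 'r) expansion \<Rightarrow> bool" where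
  "definably_complete M \<longleftrightarrow>
     (\<forall>A. definable1 M A \<longrightarrow>
        (\<exists>s :: 'a extended. isLub UNIV (Fin ` A) s) \<and> (\<exists>s :: 'a extended. isGlb UNIV (Fin ` A) s))"

text \<open>A coordinate projection \<open>F\<^sup>k \<rightarrow> F\<^sup>m\<close> selects coordinates \<open>\<sigma> 0 < \<dots> < \<sigma> (m - 1)\<close>.\<close>

definition coord_proj :: "nat \<Rightarrow> (nat \<Rightarrow> nat) \<Rightarrow> (nat \<Rightarrow> 'a) \<Rightarrow> nat \<Rightarrow> 'a" where
  "coord_proj m \<sigma> x = (\<lambda>i\<in>{..<m}. x (\<sigma> i))"

definition definable_choice ::
  "('a::linordered_field, 'f, 'r) expansion \<Rightarrow> bool" where
  "definable_choice M \<longleftrightarrow>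
     (\<forall>m n \<sigma> X Y.
        strict_mono_on {..<m} \<sigma> \<and> \<sigma> ` {..<m} \<subseteq> {..<m + n} \<and>
        definable M m X \<and> definable M (m + n) Y \<and> coord_proj m \<sigma> ` Y = X \<longrightarrow>
        (\<exists>\<phi>. definable_map M m (m + n) X Y \<phi> \<and> (\<forall>x\<in>X. coord_proj m \<sigma> (\<phi> x) = x))) \<and>
     (\<forall>n X E.
        definable M n X \<and> definable_equiv M n X E \<longrightarrow>
        (\<exists>S. definable M n S \<and> S \<subseteq> X \<and> (\<forall>C \<in> X // E. \<exists>!s. s \<in> S \<inter> C)))"

definition open_interval :: "'a::linorder extended \<Rightarrow> 'a extended \<Rightarrow> 'a set" where
  "open_interval a b = {x. a < Fin x \<and> Fin x < b}"

definition open_box :: "nat \<Rightarrow> (nat \<Rightarrow> 'a::linorder extended) \<Rightarrow> (nat \<Rightarrow> 'a extended) \<Rightarrow> (nat \<Rightarrow> 'a) set" where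
  "open_box n a b = (\<Pi>\<^sub>E i\<in>{..<n}. open_interval (a i) (b i))"

definition lim_set :: "nat \<Rightarrow> 'a::linordered_field set \<Rightarrow> ('a \<Rightarrow> nat \<Rightarrow> 'a) \<Rightarrow> (nat \<Rightarrow> 'a) set" where
  "lim_set n D \<gamma> =
     {p \<in> Fn n. \<forall>a b c d.
        p \<in> open_box n a b \<and>
        0 \<in> open_interval c d \<longrightarrow>
        {t \<in> D. \<gamma> t \<in> open_box n a b} \<inter> open_interval c d \<noteq> {}}"

definition good_pseudo_filter ::
  "('a::{linordered_field, linorder_topology}, 'f, 'r) expansion \<Rightarrow> 'a set set \<Rightarrow> bool" where
  "good_pseudo_filter M \<DD> \<longleftrightarrow>
     \<DD> \<noteq> {} \<and>
     (\<forall>D\<in>\<DD>. definable1 M D \<and> D \<subseteq> {0<..} \<and> 0 \<in> closure D) \<and>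
     (\<forall>D\<in>\<DD>. (\<exists>a b. D \<subseteq> {a..b}) \<and> closure D = D \<union> {0}) \<and>
     (\<forall>D\<in>\<DD>. \<forall>D1 D2. definable1 M D1 \<and> definable1 M D2 \<and> D = D1 \<union> D2 \<longrightarrow>
        (\<exists>D'\<in>\<DD>. D' \<subseteq> D1) \<or> (\<exists>D'\<in>\<DD>. D' \<subseteq> D2)) \<and>
     (\<forall>D\<in>\<DD>. \<forall>n \<gamma>. definable_map1 M n D \<gamma> \<longrightarrow>
        (\<exists>D'\<in>\<DD>. D' \<subseteq> D \<and> continuous_map (top_of_set D') (Fn_top n) \<gamma> \<and>
           (lim_set n D \<gamma> \<noteq> {} \<longrightarrow> is_singleton (lim_set n D' \<gamma>))))"

text \<open>
  \<open>\<E> n\<close> is a subset of one linear order \<open>'e\<close> common to all \<open>n\<close>. This is no restriction, since any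
  family of linear orders embeds into its ordered sum. The value \<open>-\<infinity>\<close> is \<open>None\<close>, which lies
  below all \<open>Some e\<close>. The values of \<open>eRank n\<close> on sets that are not definable are irrelevant.

  In the fifth clause \<open>X\<close> has to be nonempty: for \<open>X = Y = {}\<close> it would ask for a rank below \<open>-\<infinity>\<close>.
\<close>

definition good_extended_rank ::
  "('a::{linordered_field, linorder_topology}, 'f, 'r) expansion \<Rightarrow> (nat \<Rightarrow> 'e::linorder set) \<Rightarrow>
    (nat \<Rightarrow> (nat \<Rightarrow> 'a) set \<Rightarrow> 'e option) \<Rightarrow> bool" where
  "good_extended_rank M \<E> eRank \<longleftrightarrow>
     (\<forall>n.
        (\<forall>X. definable M n X \<longrightarrow> eRank n X \<in> insert None (Some ` \<E> n)) \<and>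
        (\<exists>e0\<in>\<E> n. \<forall>e\<in>\<E> n. e0 \<le> e) \<and>
        (\<forall>X. definable M n X \<longrightarrow> (eRank n X = None \<longleftrightarrow> X = {})) \<and>
        \<not> (\<exists>s :: nat \<Rightarrow> 'e. \<forall>i. s i \<in> \<E> n \<and> s (Suc i) < s i) \<and>
        (\<forall>A B. definable M n A \<and> definable M n B \<longrightarrow>
           eRank n (A \<union> B) = max (eRank n A) (eRank n B)) \<and>
        (\<forall>X Y. definable M n X \<and> definable M n Y \<and> X \<subseteq> Y \<and> X \<noteq> {} \<and> eRank n X = eRank n Y \<longrightarrow>
           (\<exists>U. definable M n U \<and> U \<subseteq> X \<and> openin (top_on n Y) U \<and>
              eRank n (X - U) < eRank n Y)) \<and>
        (\<forall>X e0. definable M n X \<and> X \<noteq> {} \<and> e0 \<in> \<E> n \<and> (\<forall>e\<in>\<E> n. e0 \<le> e) \<and>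
           eRank n X = Some e0 \<longrightarrow> top_on n X = discrete_topology X))"

section \<open>Proper maps and quotients\<close>

definition locally_closed_in :: "'b topology \<Rightarrow> 'b set \<Rightarrow> bool" where
  "locally_closed_in T X \<longleftrightarrow> (\<exists>U C. openin T U \<and> closedin T C \<and> X = U \<inter> C)"

definition definably_compact ::
  "('a::{linordered_field, linorder_topology}, 'f, 'r) expansion \<Rightarrow> nat \<Rightarrow> (nat \<Rightarrow> 'a) set \<Rightarrow> bool"
  where
  "definably_compact M n K \<longleftrightarrow>
     definable M n K \<and> closedin (Fn_top n) K \<and> (\<exists>a b. \<forall>x\<in>K. \<forall>i<n. a \<le> x i \<and> x i \<le> b)"

definition definable_continuous_map ::
  "('a::{linordered_field, linorder_topology}, 'f, 'r) expansion \<Rightarrow> nat \<Rightarrow> nat \<Rightarrow>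
    (nat \<Rightarrow> 'a) set \<Rightarrow> (nat \<Rightarrow> 'a) set \<Rightarrow> ((nat \<Rightarrow> 'a) \<Rightarrow> nat \<Rightarrow> 'a) \<Rightarrow> bool" where
  "definable_continuous_map M m n X Y f \<longleftrightarrow>
     definable_map M m n X Y f \<and> continuous_map (top_on m X) (top_on n Y) f"

definition definably_proper ::
  "('a::{linordered_field, linorder_topology}, 'f, 'r) expansion \<Rightarrow> nat \<Rightarrow> nat \<Rightarrow>
    (nat \<Rightarrow> 'a) set \<Rightarrow> (nat \<Rightarrow> 'a) set \<Rightarrow> ((nat \<Rightarrow> 'a) \<Rightarrow> nat \<Rightarrow> 'a) \<Rightarrow> bool" where
  "definably_proper M m n X Y f \<longleftrightarrow>
     definable_continuous_map M m n X Y f \<and>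
     (\<forall>K. definably_compact M n K \<and> K \<subseteq> Y \<longrightarrow> definably_compact M m {x \<in> X. f x \<in> K})"

definition definably_identifying ::
  "('a::{linordered_field, linorder_topology}, 'f, 'r) expansion \<Rightarrow> nat \<Rightarrow> nat \<Rightarrow>
    (nat \<Rightarrow> 'a) set \<Rightarrow> (nat \<Rightarrow> 'a) set \<Rightarrow> ((nat \<Rightarrow> 'a) \<Rightarrow> nat \<Rightarrow> 'a) \<Rightarrow> bool" where
  "definably_identifying M m n X Y f \<longleftrightarrow>
     definable_continuous_map M m n X Y f \<and> f ` X = Y \<and>
     (\<forall>K. definable M n K \<and> K \<subseteq> Y \<and> closedin (top_on m X) {x \<in> X. f x \<in> K} \<longrightarrow>
        closedin (top_on n Y) K)"

definition definable_quotient ::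
  "('a::{linordered_field, linorder_topology}, 'f, 'r) expansion \<Rightarrow> nat \<Rightarrow> nat \<Rightarrow>
    (nat \<Rightarrow> 'a) set \<Rightarrow> ((nat \<Rightarrow> 'a) \<times> (nat \<Rightarrow> 'a)) set \<Rightarrow> (nat \<Rightarrow> 'a) set \<Rightarrow>
    ((nat \<Rightarrow> 'a) \<Rightarrow> nat \<Rightarrow> 'a) \<Rightarrow> bool" where
  "definable_quotient M m n X E Y f \<longleftrightarrow>
     definably_identifying M m n X Y f \<and> (\<forall>x\<in>X. \<forall>x'\<in>X. f x = f x' \<longleftrightarrow> (x, x') \<in> E)"

end

theory Submission
  imports Defs
begin

text \<open>
  All topology is done with the \<open>\<ell>\<^sup>1\<close>-metric of \<open>F\<^sup>n\<close>, which has values in \<open>F\<close>; compactness enters only through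
  the fact that a decreasing definable family of nonempty subsets of a definably compact set has a limit
  point. Fix an exhaustion function \<open>h\<close> of the locally closed set \<open>X\<close>: continuous, definable, with definably
  compact sublevel sets.

  From (1) to (2), let \<open>K\<close> be the closure in \<open>X\<close> of the points at which \<open>h\<close> is within \<open>1\<close> of its infimum on
  their class. If \<open>h\<close> were unbounded on the part of \<open>K\<close> related to some definably compact set, definable
  choice and the pseudo-filter would give a definable curve in the quotient which converges to a point
  outside its image, although the preimage of the image is closed because \<open>h\<close> tends to infinity along
  the curve. This contradicts that the quotient map is identifying.

  From (2) to (1), one compactifies \<open>K\<close> by a point, and it suffices to treat a closed equivalence relation
  on a definably compact \<open>X\<close>. Let \<open>S\<close> be a definable set of representatives. A definable \<open>U \<subseteq> S\<close> is open in
  the closure of \<open>S\<close> and has a complement \<open>A\<close> there of smaller rank. By induction \<open>A\<close> has a quotient; it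
  extends to the saturation of \<open>A\<close>, then by Tietze and the distance to that saturation to the closure of
  \<open>S\<close>, and finally to \<open>X\<close>.
\<close>

section \<open>A calculus of definable predicates, scalars and vectors\<close>

text \<open>\<open>F\<close> may be non-archimedean and of uncountable cofinality, so sequences
  cannot serve as the tool for limits. Every limit argument runs on a definable family
  \<open>P s\<close> that shrinks with the scale \<open>s > 0\<close>, and whatever must survive the
  limit is written into \<open>P\<close>.

  On a definably compact set the obstacle is that a definable set \<open>S\<close> of
  representatives is rarely closed, and that its closure may meet a class more than once. Two
  related points of the open part \<open>U\<close> coincide, so this happens only for classes that
  meet the remainder \<open>A\<close>. Once the points related to \<open>A\<close> are identified
  correctly, the new map only has to be injective elsewhere.

  A closed relation that is locally definably compact transports continuity. This one device serves
  three times: from \<open>A\<close> to the points related to it, from the closure of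
  \<open>S\<close> to the whole set, and from \<open>K\<close> to \<open>X\<close>. Properness is
  what makes it work for \<open>K\<close>, and also what allows the point at infinity to form a
  class of its own: points related to a region where \<open>h\<close> is bounded cannot escape to
  infinity.\<close>

definition dpred :: "('a::linordered_field, 'f, 'r) expansion \<Rightarrow> ((nat \<Rightarrow> 'a) \<Rightarrow> bool) \<Rightarrow> bool" where
  "dpred M P \<longleftrightarrow> (\<exists>\<phi>. \<forall>e. sat M e \<phi> \<longleftrightarrow> P e)"

text \<open>A scalar is given by its graph, with the value at index 0 and the arguments shifted,
  because infima, inverses and chosen points are not values of terms.\<close>

definition dscal :: "('a::linordered_field, 'f, 'r) expansion \<Rightarrow> ((nat \<Rightarrow> 'a) \<Rightarrow> 'a) \<Rightarrow> bool" where
  "dscal M t \<longleftrightarrow> dpred M (\<lambda>e. e 0 = t (\<lambda>i. e (Suc i)))"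

definition dvect ::
  "('a::linordered_field, 'f, 'r) expansion \<Rightarrow> nat \<Rightarrow> ((nat \<Rightarrow> 'a) \<Rightarrow> nat \<Rightarrow> 'a) \<Rightarrow> bool" where
  "dvect M n x \<longleftrightarrow> (\<forall>e. x e \<in> Fn n) \<and> (\<forall>i<n. dscal M (\<lambda>e. x e i))"

section \<open>Substitution of terms into formulas\<close>

text \<open>
  Predicates, scalars and vectors are functions of the environment. A quantifier rule puts the bound
  scalar at index \<open>0\<close>, or the bound vector at the indices below \<open>n\<close>, and shifts the other variables, so that
  definability is proved by resolution with the rules below.
\<close>

lemma trm_lift: "\<exists>t'. \<forall>a e. trm_val M (case_nat a e) t' = trm_val M e t"
proof (induction t)
  case (Var i)
  show ?case by (rule exI[of _ "Var (Suc i)"]) simp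
next
  case (Param a)
  show ?case by (rule exI[of _ "Param a"]) simp
next
  case (Plus s t)
  then obtain s' t' where "\<forall>a e. trm_val M (case_nat a e) s' = trm_val M e s"
    "\<forall>a e. trm_val M (case_nat a e) t' = trm_val M e t" by blast
  then show ?case by (intro exI[of _ "Plus s' t'"]) simp
next
  case (Times s t)
  then obtain s' t' where "\<forall>a e. trm_val M (case_nat a e) s' = trm_val M e s"
    "\<forall>a e. trm_val M (case_nat a e) t' = trm_val M e t" by blast
  then show ?case by (intro exI[of _ "Times s' t'"]) simp
next
  case (Fun f ts)
  then obtain g where "\<And>t. t \<in> set ts \<Longrightarrow> \<forall>a e. trm_val M (case_nat a e) (g t) = trm_val M e t"
    by metis
  then show ?case by (intro exI[of _ "Fun f (map g ts)"]) (auto intro!: arg_cong[of _ _ "fun_interp M f"])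
qed

lemma trm_subst: "\<exists>t'. \<forall>e. trm_val M e t' = trm_val M (\<lambda>i. trm_val M e (ts i)) t"
proof (induction t)
  case (Var i)
  show ?case by (rule exI[of _ "ts i"]) simp
next
  case (Param a)
  show ?case by (rule exI[of _ "Param a"]) simp
next
  case (Plus s t)
  then obtain s' t' where "\<forall>e. trm_val M e s' = trm_val M (\<lambda>i. trm_val M e (ts i)) s"
    "\<forall>e. trm_val M e t' = trm_val M (\<lambda>i. trm_val M e (ts i)) t" by blast
  then show ?case by (intro exI[of _ "Plus s' t'"]) simp
next
  case (Times s t)
  then obtain s' t' where "\<forall>e. trm_val M e s' = trm_val M (\<lambda>i. trm_val M e (ts i)) s"
    "\<forall>e. trm_val M e t' = trm_val M (\<lambda>i. trm_val M e (ts i)) t" by blast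
  then show ?case by (intro exI[of _ "Times s' t'"]) simp
next
  case (Fun f us)
  then obtain g where "\<And>t. t \<in> set us \<Longrightarrow> \<forall>e. trm_val M e (g t) = trm_val M (\<lambda>i. trm_val M e (ts i)) t"
    by metis
  then show ?case by (intro exI[of _ "Fun f (map g us)"]) (auto intro!: arg_cong[of _ _ "fun_interp M f"])
qed

text \<open>The substitution acts on all variables at once and has to be general in the induction:
  passing under \<open>Ex\<close> replaces it by \<open>Var 0\<close> followed by the lifted
  terms.\<close>

lemma fm_subst: "\<exists>\<psi>. \<forall>e. sat M e \<psi> \<longleftrightarrow> sat M (\<lambda>i. trm_val M e (ts i)) \<phi>"
proof (induction \<phi> arbitrary: ts)
  case (Equal s t)
  obtain s' t' where "\<forall>e. trm_val M e s' = trm_val M (\<lambda>i. trm_val M e (ts i)) s"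
    "\<forall>e. trm_val M e t' = trm_val M (\<lambda>i. trm_val M e (ts i)) t" using trm_subst by metis
  then show ?case by (intro exI[of _ "Equal s' t'"]) simp
next
  case (Less s t)
  obtain s' t' where "\<forall>e. trm_val M e s' = trm_val M (\<lambda>i. trm_val M e (ts i)) s"
    "\<forall>e. trm_val M e t' = trm_val M (\<lambda>i. trm_val M e (ts i)) t" using trm_subst by metis
  then show ?case by (intro exI[of _ "Less s' t'"]) simp
next
  case (Rel r us)
  have "\<forall>t. \<exists>t'. \<forall>e. trm_val M e t' = trm_val M (\<lambda>i. trm_val M e (ts i)) t"
    by (intro allI trm_subst)
  from choice[OF this] obtain g where "\<And>t e. trm_val M e (g t) = trm_val M (\<lambda>i. trm_val M e (ts i)) t"
    by blast
  then show ?case by (intro exI[of _ "Rel r (map g us)"]) (simp add: comp_def)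
next
  case (Neg \<phi>)
  from Neg[of ts] obtain \<psi> where "\<forall>e. sat M e \<psi> \<longleftrightarrow> sat M (\<lambda>i. trm_val M e (ts i)) \<phi>" by blast
  then show ?case by (intro exI[of _ "Neg \<psi>"]) simp
next
  case (Conj \<phi>1 \<phi>2)
  from Conj(1)[of ts] Conj(2)[of ts] obtain \<psi>1 \<psi>2 where "\<forall>e. sat M e \<psi>1 \<longleftrightarrow> sat M (\<lambda>i. trm_val M e (ts i)) \<phi>1"
    "\<forall>e. sat M e \<psi>2 \<longleftrightarrow> sat M (\<lambda>i. trm_val M e (ts i)) \<phi>2" by blast
  then show ?case by (intro exI[of _ "Conj \<psi>1 \<psi>2"]) simp
next
  case (Ex \<phi>)
  have "\<forall>t. \<exists>t'. \<forall>a e. trm_val M (case_nat a e) t' = trm_val M e t"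
    by (intro allI trm_lift)
  from choice[OF this] obtain l where l: "\<And>t a e. trm_val M (case_nat a e) (l t) = trm_val M e t"
    by blast
  define us where "us = case_nat (Var 0) (\<lambda>i. l (ts i))"
  obtain \<psi> where \<psi>: "\<forall>e. sat M e \<psi> \<longleftrightarrow> sat M (\<lambda>i. trm_val M e (us i)) \<phi>"
    using Ex[of us] by blast
  have "(\<lambda>i. trm_val M (case_nat a e) (us i)) = case_nat a (\<lambda>i. trm_val M e (ts i))" for a e
    by (rule ext) (simp add: us_def l split: nat.split)
  then show ?case using \<psi> by (intro exI[of _ "Ex \<psi>"]) simp
qed

section \<open>Connectives and quantifiers\<close>

lemma dpred_const: "dpred M (\<lambda>_. c)"
  unfolding dpred_def
  by (cases c) (auto intro: exI[of _ "Equal (Param 0) (Param 0)"] exI[of _ "Neg (Equal (Param 0) (Param 0))"])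

lemma dpred_not: "dpred M P \<Longrightarrow> dpred M (\<lambda>e. \<not> P e)"
  unfolding dpred_def by (metis sat.simps(4))

lemma dpred_conj: "dpred M P \<Longrightarrow> dpred M Q \<Longrightarrow> dpred M (\<lambda>e. P e \<and> Q e)"
  unfolding dpred_def by (metis sat.simps(5))

lemma dpred_disj: "dpred M P \<Longrightarrow> dpred M Q \<Longrightarrow> dpred M (\<lambda>e. P e \<or> Q e)"
  using dpred_not[OF dpred_conj[OF dpred_not[of M P] dpred_not[of M Q]]] by (simp only: de_Morgan_conj not_not)

lemma dpred_imp: "dpred M P \<Longrightarrow> dpred M Q \<Longrightarrow> dpred M (\<lambda>e. P e \<longrightarrow> Q e)"
  unfolding imp_conv_disj by (intro dpred_disj dpred_not)

lemma dpred_ex: "dpred M (\<lambda>e. P (e 0) (\<lambda>i. e (Suc i))) \<Longrightarrow> dpred M (\<lambda>e. \<exists>a. P a e)"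
proof -
  assume "dpred M (\<lambda>e. P (e 0) (\<lambda>i. e (Suc i)))"
  then obtain \<phi> where "\<forall>e. sat M e \<phi> \<longleftrightarrow> P (e 0) (\<lambda>i. e (Suc i))"
    unfolding dpred_def by blast
  then have "\<forall>e. sat M e (Ex \<phi>) \<longleftrightarrow> (\<exists>a. P a e)" by simp
  then show ?thesis unfolding dpred_def by blast
qed

lemma dpred_all: "dpred M (\<lambda>e. P (e 0) (\<lambda>i. e (Suc i))) \<Longrightarrow> dpred M (\<lambda>e. \<forall>a. P a e)"
  using dpred_not[OF dpred_ex[where P = "\<lambda>a e. \<not> P a e", OF dpred_not]] by simp

lemma dpred_ball_fin: "(\<And>i. i < n \<Longrightarrow> dpred M (P i)) \<Longrightarrow> dpred M (\<lambda>e. \<forall>i<(n::nat). P i e)"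
proof (induction n)
  case 0
  then show ?case using dpred_const[of M True] by simp
next
  case (Suc n)
  then have "dpred M (\<lambda>e. P n e \<and> (\<forall>i<n. P i e))" by (intro dpred_conj) auto
  then show ?case by (simp add: All_less_Suc)
qed

lemma dpred_subst:
  assumes "dpred M P"
  shows "dpred M (\<lambda>e. P (\<lambda>i. trm_val M e (ts i)))"
  using assms fm_subst[of M ts] unfolding dpred_def by metis

lemma dpred_rename: "dpred M P \<Longrightarrow> dpred M (\<lambda>e. P (\<lambda>i. e (g i)))"
  using dpred_subst[of M P "\<lambda>i. Var (g i)"] by simp

section \<open>Definable scalars and the field operations\<close>

lemma dscal_trm: "dscal M (\<lambda>e. trm_val M e t)"
proof -
  obtain t' where "\<forall>e. trm_val M e t' = trm_val M (\<lambda>i. trm_val M e (Var (Suc i))) t"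
    using trm_subst[of M "\<lambda>i. Var (Suc i)" t] by blast
  then have "\<forall>e. sat M e (Equal (Var 0) t') \<longleftrightarrow> e 0 = trm_val M (\<lambda>i. e (Suc i)) t" by simp
  then show ?thesis unfolding dscal_def dpred_def by blast
qed

lemma dscal_var: "dscal M (\<lambda>e. e k)"
  using dscal_trm[of M "Var k"] by simp

lemma dscal_const: "dscal M (\<lambda>_. a)"
  using dscal_trm[of M "Param a"] by simp

lemma dscal_rename:
  assumes "dscal M t" shows "dscal M (\<lambda>e. t (\<lambda>i. e (g i)))"
  using dpred_rename[OF assms[unfolded dscal_def], of "case_nat 0 (\<lambda>i. Suc (g i))"]
  by (simp add: dscal_def)

text \<open>A definable scalar need not be a term and cannot be substituted into a formula; its
  value is introduced by an existential quantifier instead.\<close>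

lemma dpred_bind_scal:
  assumes "dscal M t" and "dpred M (\<lambda>e. P (e 0) (\<lambda>i. e (Suc i)))"
  shows "dpred M (\<lambda>e. P (t e) e)"
proof -
  have "dpred M (\<lambda>e. \<exists>a. a = t e \<and> P a e)"
    by (rule dpred_ex, rule dpred_conj[OF assms(1)[unfolded dscal_def] assms(2)])
  then show ?thesis by simp
qed

lemma dpred_scal2:
  assumes "dscal M s" "dscal M t" "dpred M (\<lambda>e. P (e 0) (e 1))"
  shows "dpred M (\<lambda>e. P (s e) (t e))"
proof -
  \<comment> \<open>By truncated subtraction, \<open>1 - i\<close> exchanges the indices 0 and
    1.\<close>
  have "dpred M (\<lambda>e. P (e 1) (e 0))"
    using dpred_rename[OF assms(3), of "\<lambda>i. 1 - i"] by simp
  then have "dpred M (\<lambda>e. P (e 0) (t (\<lambda>i. e (Suc i))))"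
    using dpred_bind_scal[OF dscal_rename[OF assms(2), of Suc], where P = "\<lambda>b e. P (e 0) b"] by simp
  then show ?thesis
    by (rule dpred_bind_scal[OF assms(1), where P = "\<lambda>a e. P a (t e)"])
qed

lemma dpred_eq: "dscal M s \<Longrightarrow> dscal M t \<Longrightarrow> dpred M (\<lambda>e. s e = t e)"
  by (rule dpred_scal2[where P = "(=)"]) (auto simp: dpred_def intro: exI[of _ "Equal (Var 0) (Var 1)"])

lemma dpred_less: "dscal M s \<Longrightarrow> dscal M t \<Longrightarrow> dpred M (\<lambda>e. s e < t e)"
  by (rule dpred_scal2[where P = "(<)"]) (auto simp: dpred_def intro: exI[of _ "Less (Var 0) (Var 1)"])

lemma dpred_le: "dscal M s \<Longrightarrow> dscal M t \<Longrightarrow> dpred M (\<lambda>e. s e \<le> t e)"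
  using dpred_not[OF dpred_less[of M t s]] by (simp add: not_less)

lemma dscal_op:
  assumes "dscal M s" "dscal M t" "dpred M (\<lambda>e. e 2 = f (e 0) (e 1))"
  shows "dscal M (\<lambda>e. f (s e) (t e))"
proof -
  have "dpred M (\<lambda>e. e 2 = f (e 1) (e 0))"
    using dpred_rename[OF assms(3), of "\<lambda>i. if i = 2 then 2 else 1 - i"] by simp
  then have "dpred M (\<lambda>e. e 1 = f (e 0) (t (\<lambda>i. e (Suc (Suc i)))))"
    using dpred_bind_scal[OF dscal_rename[OF assms(2), of "\<lambda>i. Suc (Suc i)"],
        where P = "\<lambda>b e. e 1 = f (e 0) b"] by (simp add: numeral_2_eq_2)
  then show ?thesis unfolding dscal_def
    using dpred_bind_scal[OF dscal_rename[OF assms(1), of Suc],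
        where P = "\<lambda>a e. e 0 = f a (t (\<lambda>i. e (Suc i)))"] by simp
qed

lemma dscal_add: "dscal M s \<Longrightarrow> dscal M t \<Longrightarrow> dscal M (\<lambda>e. s e + t e)"
  by (rule dscal_op[where f = "(+)"]) (auto simp: dpred_def intro: exI[of _ "Equal (Var 2) (Plus (Var 0) (Var 1))"])

lemma dscal_mult: "dscal M s \<Longrightarrow> dscal M t \<Longrightarrow> dscal M (\<lambda>e. s e * t e)"
  by (rule dscal_op[where f = times]) (auto simp: dpred_def intro: exI[of _ "Equal (Var 2) (Times (Var 0) (Var 1))"])

lemma dscal_uminus: "dscal M s \<Longrightarrow> dscal M (\<lambda>e. - s e)"
  using dscal_mult[OF dscal_const[of M "-1"]] by simp

lemma dscal_diff: "dscal M s \<Longrightarrow> dscal M t \<Longrightarrow> dscal M (\<lambda>e. s e - t e)"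
  using dscal_add[OF _ dscal_uminus, of M s t] by simp

lemma dscal_if:
  assumes "dpred M P" "dscal M s" "dscal M t"
  shows "dscal M (\<lambda>e. if P e then s e else t e)"
proof -
  have "dpred M (\<lambda>e. (P (\<lambda>i. e (Suc i)) \<and> e 0 = s (\<lambda>i. e (Suc i))) \<or>
     (\<not> P (\<lambda>i. e (Suc i)) \<and> e 0 = t (\<lambda>i. e (Suc i))))"
    by (intro dpred_disj dpred_conj dpred_not dpred_rename[OF assms(1)]
        assms(2)[unfolded dscal_def] assms(3)[unfolded dscal_def])
  then show ?thesis unfolding dscal_def by (rule back_subst[of "dpred M"]) auto
qed

lemma dscal_abs: "dscal M s \<Longrightarrow> dscal M (\<lambda>e. \<bar>s e\<bar>)"
  unfolding abs_if by (intro dscal_if dpred_less dscal_const dscal_uminus)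

lemma dscal_inverse:
  assumes "dscal M s" shows "dscal M (\<lambda>e. inverse (s e))"
proof -
  \<comment> \<open>The first alternative is the convention \<open>inverse 0 = 0\<close>.\<close>
  have "dpred M (\<lambda>e. (s (\<lambda>i. e (Suc i)) = 0 \<and> e 0 = 0) \<or> e 0 * s (\<lambda>i. e (Suc i)) = 1)"
    by (intro dpred_disj dpred_conj dpred_eq dscal_mult dscal_rename[OF assms] dscal_const dscal_var)
  then show ?thesis unfolding dscal_def
    by (rule back_subst[of "dpred M"]) (auto simp: fun_eq_iff inverse_unique mult.commute
        intro: right_inverse)
qed

lemma dscal_divide: "dscal M s \<Longrightarrow> dscal M t \<Longrightarrow> dscal M (\<lambda>e. s e / t e)"
  unfolding divide_inverse by (intro dscal_mult dscal_inverse)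

lemma dscal_sum: "(\<And>i. i < n \<Longrightarrow> dscal M (t i)) \<Longrightarrow> dscal M (\<lambda>e. \<Sum>i<(n::nat). t i e)"
  by (induction n) (auto intro!: dscal_const dscal_add)

section \<open>Vectors and quantifiers over \<open>F^n\<close>\<close>

lemma Fn_restrict: "restrict x {..<n} \<in> Fn n"
  by (simp add: Fn_def)

lemma restrict_Fn: "x \<in> Fn n \<Longrightarrow> restrict x {..<n} = x"
  by (simp add: Fn_def PiE_restrict)

lemma Fn_eqI: "x \<in> Fn n \<Longrightarrow> y \<in> Fn n \<Longrightarrow> (\<And>i. i < n \<Longrightarrow> x i = y i) \<Longrightarrow> x = y"
  unfolding Fn_def by (rule PiE_ext) auto

lemma dvect_const: "v \<in> Fn n \<Longrightarrow> dvect M n (\<lambda>_. v)"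
  by (simp add: dvect_def dscal_const)

lemma dvectI: "(\<And>i. i < n \<Longrightarrow> dscal M (t i)) \<Longrightarrow> dvect M n (\<lambda>e. \<lambda>i\<in>{..<n}. t i e)"
  by (simp add: dvect_def Fn_restrict)

lemma dvect_var: "dvect M n (\<lambda>e. \<lambda>i\<in>{..<n}. e (g i))"
  by (rule dvectI) (rule dscal_var)

lemma dscal_nth: "dscal M (\<lambda>e. (\<lambda>i\<in>{..<n}. e (g i)) j)"
  by (cases "j < n") (auto simp: dscal_var dscal_const)

lemma dvect_nth: "dvect M n x \<Longrightarrow> i < n \<Longrightarrow> dscal M (\<lambda>e. x e i)"
  by (simp add: dvect_def)

lemma dvect_Fn: "dvect M n x \<Longrightarrow> x e \<in> Fn n"
  by (simp add: dvect_def)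

lemma dvect_rename: "dvect M n x \<Longrightarrow> dvect M n (\<lambda>e. x (\<lambda>i. e (g i)))"
  unfolding dvect_def using dscal_rename[where t = "\<lambda>e. x e _"] by blast

text \<open>A block of \<open>n\<close> quantifiers, written as one quantifier over functions
  \<open>v\<close> of which only the first \<open>n\<close> values are read.\<close>

lemma dpred_ex_prefix:
  "dpred M Q \<Longrightarrow> dpred M (\<lambda>e. \<exists>v. Q (\<lambda>i. if i < n then v i else e (i - n)))"
proof (induction n arbitrary: Q)
  case 0
  then show ?case by simp
next
  case (Suc n)
  have "dpred M (\<lambda>e. \<exists>a. Q (case_nat a e))"
  proof (rule dpred_ex)
    have "case_nat (e 0) (\<lambda>i. e (Suc i)) = e" for e :: "nat \<Rightarrow> 'a"
      by (rule ext) (simp split: nat.split)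
    with Suc.prems show "dpred M (\<lambda>e. Q (case_nat (e 0) (\<lambda>i. e (Suc i))))" by simp
  qed
  note Suc.IH[OF this]
  moreover have "(\<exists>v a. Q (case_nat a (\<lambda>i. if i < n then v i else e (i - n)))) \<longleftrightarrow>
     (\<exists>v. Q (\<lambda>i. if i < Suc n then v i else e (i - Suc n)))" for e
  proof
    assume "\<exists>v a. Q (case_nat a (\<lambda>i. if i < n then v i else e (i - n)))"
    then obtain v a where *: "Q (case_nat a (\<lambda>i. if i < n then v i else e (i - n)))" by blast
    have "case_nat a (\<lambda>i. if i < n then v i else e (i - n)) =
      (\<lambda>i. if i < Suc n then case_nat a v i else e (i - Suc n))"
      by (rule ext) (simp split: nat.split)
    with * show "\<exists>v. Q (\<lambda>i. if i < Suc n then v i else e (i - Suc n))" by metis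
  next
    assume "\<exists>v. Q (\<lambda>i. if i < Suc n then v i else e (i - Suc n))"
    then obtain v where *: "Q (\<lambda>i. if i < Suc n then v i else e (i - Suc n))" by blast
    have "(\<lambda>i. if i < Suc n then v i else e (i - Suc n)) =
      case_nat (v 0) (\<lambda>i. if i < n then v (Suc i) else e (i - n))"
      by (rule ext) (simp split: nat.split)
    with * have "Q (case_nat (v 0) (\<lambda>i. if i < n then v (Suc i) else e (i - n)))" by simp
    then show "\<exists>v a. Q (case_nat a (\<lambda>i. if i < n then v i else e (i - n)))"
      by (intro exI[of _ "\<lambda>i. v (Suc i)"] exI[of _ "v 0"])
  qed
  ultimately show ?case by simp
qed

lemma dpred_bex_Fn:
  assumes "dpred M (\<lambda>e. P (\<lambda>i\<in>{..<n}. e i) (\<lambda>i. e (n + i)))"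
  shows "dpred M (\<lambda>e. \<exists>x\<in>Fn n. P x e)"
proof -
  have "(\<exists>v. P (\<lambda>i\<in>{..<n}. if i < n then v i else e (i - n)) e) \<longleftrightarrow> (\<exists>x\<in>Fn n. P x e)" for e
  proof
    assume "\<exists>v. P (\<lambda>i\<in>{..<n}. if i < n then v i else e (i - n)) e"
    then show "\<exists>x\<in>Fn n. P x e" using Fn_restrict by blast
  next
    assume "\<exists>x\<in>Fn n. P x e"
    then obtain x where x: "x \<in> Fn n" "P x e" by blast
    have "(\<lambda>i\<in>{..<n}. if i < n then x i else e (i - n)) = x"
      by (rule Fn_eqI[OF Fn_restrict x(1)]) simp
    with x show "\<exists>v. P (\<lambda>i\<in>{..<n}. if i < n then v i else e (i - n)) e" by metis
  qed
  then show ?thesis using dpred_ex_prefix[OF assms, of n] by simp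
qed

lemma dpred_bind_vect:
  assumes "dvect M n x" "dpred M (\<lambda>e. P (\<lambda>i\<in>{..<n}. e i) (\<lambda>i. e (n + i)))"
  shows "dpred M (\<lambda>e. P (x e) e)"
proof -
  have "dpred M (\<lambda>e. \<exists>v\<in>Fn n. (\<forall>i<n. v i = x e i) \<and> P v e)"
  proof (rule dpred_bex_Fn, rule dpred_conj[OF dpred_ball_fin assms(2)])
    fix i assume i: "i < n"
    show "dpred M (\<lambda>e. (\<lambda>i\<in>{..<n}. e i) i = x (\<lambda>i. e (n + i)) i)"
      by (intro dpred_eq dscal_nth dvect_nth[OF dvect_rename[OF assms(1)] i])
  qed
  moreover have "(\<exists>v\<in>Fn n. (\<forall>i<n. v i = x e i) \<and> P v e) \<longleftrightarrow> P (x e) e" for e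
    using Fn_eqI[OF _ dvect_Fn[OF assms(1)]] dvect_Fn[OF assms(1)] by metis
  ultimately show ?thesis by simp
qed

lemma definable_subset: "definable M n X \<Longrightarrow> X \<subseteq> Fn n"
  by (auto simp: definable_def)

text \<open>On \<open>F^n\<close> a formula sees \<open>undefined\<close> at every index from
  \<open>n\<close> on. Substituting this parameter for those variables gives a predicate on all
  environments that depends on the first \<open>n\<close> entries only.\<close>

lemma definable_iff: "definable M n X \<longleftrightarrow> X \<subseteq> Fn n \<and> dpred M (\<lambda>e. (\<lambda>i\<in>{..<n}. e i) \<in> X)"
proof
  assume "definable M n X"
  then obtain \<phi> where X: "X = {x \<in> Fn n. sat M x \<phi>}" unfolding definable_def by blast
  have "dpred M (\<lambda>e. sat M (\<lambda>i. trm_val M e (if i < n then Var i else Param undefined)) \<phi>)"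
    by (rule dpred_subst) (auto simp: dpred_def)
  moreover have "(\<lambda>i. trm_val M e (if i < n then Var i else Param undefined)) = (\<lambda>i\<in>{..<n}. e i)" for e
    by (rule ext) simp
  ultimately show "X \<subseteq> Fn n \<and> dpred M (\<lambda>e. (\<lambda>i\<in>{..<n}. e i) \<in> X)"
    by (simp add: X Fn_restrict subset_iff)
next
  assume a: "X \<subseteq> Fn n \<and> dpred M (\<lambda>e. (\<lambda>i\<in>{..<n}. e i) \<in> X)"
  then obtain \<phi> where "\<forall>e. sat M e \<phi> \<longleftrightarrow> (\<lambda>i\<in>{..<n}. e i) \<in> X" unfolding dpred_def by blast
  then have "X = {x \<in> Fn n. sat M x \<phi>}" using a by (auto simp: restrict_Fn)
  then show "definable M n X" unfolding definable_def by blast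
qed

lemma definableI: "dpred M (\<lambda>e. P (\<lambda>i\<in>{..<n}. e i)) \<Longrightarrow> definable M n {x \<in> Fn n. P x}"
  by (simp add: definable_iff Fn_restrict)

lemma dpred_mem: "definable M n X \<Longrightarrow> dvect M n x \<Longrightarrow> dpred M (\<lambda>e. x e \<in> X)"
  by (rule dpred_bind_vect[where P = "\<lambda>x e. x \<in> X"]) (auto simp: definable_iff)

lemma definable_Fn: "definable M n (Fn n)"
  using definableI[OF dpred_const[of M True]] by simp

lemma dpred_bex:
  assumes "definable M n X" "dpred M (\<lambda>e. P (\<lambda>i\<in>{..<n}. e i) (\<lambda>i. e (n + i)))"
  shows "dpred M (\<lambda>e. \<exists>x\<in>X. P x e)"
proof -
  have "dpred M (\<lambda>e. \<exists>x\<in>Fn n. x \<in> X \<and> P x e)"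
    by (intro dpred_bex_Fn dpred_conj dpred_mem[OF assms(1)] dvect_var assms(2))
  moreover have "(\<exists>x\<in>Fn n. x \<in> X \<and> P x e) \<longleftrightarrow> (\<exists>x\<in>X. P x e)" for e
    using definable_subset[OF assms(1)] by blast
  ultimately show ?thesis by simp
qed

lemma dpred_ball:
  assumes "definable M n X" "dpred M (\<lambda>e. P (\<lambda>i\<in>{..<n}. e i) (\<lambda>i. e (n + i)))"
  shows "dpred M (\<lambda>e. \<forall>x\<in>X. P x e)"
  using dpred_not[OF dpred_bex[where P = "\<lambda>x e. \<not> P x e", OF assms(1) dpred_not[OF assms(2)]]] by simp

lemma dpred_vect_eq:
  assumes "dvect M n x" "dvect M n y"
  shows "dpred M (\<lambda>e. x e = y e)"
proof -
  have "dpred M (\<lambda>e. \<forall>i<n. x e i = y e i)"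
    by (intro dpred_ball_fin dpred_eq dvect_nth[OF assms(1)] dvect_nth[OF assms(2)])
  moreover have "(\<forall>i<n. x e i = y e i) \<longleftrightarrow> x e = y e" for e
    using Fn_eqI[OF dvect_Fn[OF assms(1)] dvect_Fn[OF assms(2)]] by metis
  ultimately show ?thesis by simp
qed

lemma concat_vec_Fn: "concat_vec m n x y \<in> Fn (m + n)"
  by (simp add: concat_vec_def Fn_restrict)

lemma concat_vec_inject:
  assumes "x \<in> Fn m" "x' \<in> Fn m" "y \<in> Fn n" "y' \<in> Fn n"
    and eq: "concat_vec m n x y = concat_vec m n x' y'"
  shows "x = x'" "y = y'"
proof -
  show "x = x'"
  proof (rule Fn_eqI[OF assms(1,2)])
    fix i assume "i < m" then show "x i = x' i"
      using fun_cong[OF eq, of i] by (simp add: concat_vec_def)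
  qed
  show "y = y'"
  proof (rule Fn_eqI[OF assms(3,4)])
    fix i assume "i < n" then show "y i = y' i"
      using fun_cong[OF eq, of "m + i"] by (simp add: concat_vec_def)
  qed
qed

lemma dvect_concat:
  assumes "dvect M m x" "dvect M n y"
  shows "dvect M (m + n) (\<lambda>e. concat_vec m n (x e) (y e))"
  unfolding concat_vec_def
proof (rule dvectI)
  fix i assume "i < m + n"
  then show "dscal M (\<lambda>e. if i < m then x e i else y e (i - m))"
    using dvect_nth[OF assms(1)] dvect_nth[OF assms(2)] by (cases "i < m") auto
qed

lemma flat_mem:
  assumes "R \<subseteq> Fn m \<times> Fn n" "x \<in> Fn m" "y \<in> Fn n"
  shows "concat_vec m n x y \<in> flat m n R \<longleftrightarrow> (x, y) \<in> R"
proof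
  assume "concat_vec m n x y \<in> flat m n R"
  then obtain x' y' where *: "(x', y') \<in> R" "concat_vec m n x y = concat_vec m n x' y'"
    by (auto simp: flat_def)
  with assms(1) have "x' \<in> Fn m" "y' \<in> Fn n" by auto
  with * assms(2,3) concat_vec_inject show "(x, y) \<in> R" by metis
qed (force simp: flat_def)

lemma dpred_pair:
  assumes "definable M (m + n) (flat m n R)" "R \<subseteq> Fn m \<times> Fn n" "dvect M m x" "dvect M n y"
  shows "dpred M (\<lambda>e. (x e, y e) \<in> R)"
  using dpred_mem[OF assms(1) dvect_concat[OF assms(3,4)]]
  by (simp add: flat_mem[OF assms(2) dvect_Fn[OF assms(3)] dvect_Fn[OF assms(4)]])

lemma definable_flatI:
  assumes "dpred M (\<lambda>e. ((\<lambda>i\<in>{..<m}. e i), (\<lambda>i\<in>{..<n}. e (m + i))) \<in> R)" "R \<subseteq> Fn m \<times> Fn n"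
  shows "definable M (m + n) (flat m n R)"
proof -
  have "definable M (m + n) {z \<in> Fn (m + n). \<exists>x\<in>Fn m. \<exists>y\<in>Fn n. (x, y) \<in> R \<and> z = concat_vec m n x y}"
  proof (rule definableI, rule dpred_bex_Fn, rule dpred_bex_Fn, rule dpred_conj)
    \<comment> \<open>The quantifier over \<open>y\<close> is the inner one, so \<open>y\<close>
      occupies the indices below \<open>n\<close> and \<open>x\<close> the next \<open>m\<close>;
      the renaming exchanges the two blocks.\<close>
    show "dpred M (\<lambda>e. (\<lambda>i\<in>{..<m}. e (n + i), restrict e {..<n}) \<in> R)"
      using dpred_rename[OF assms(1), of "\<lambda>i. if i < m then n + i else i - m"]
      by (rule back_subst[of "dpred M"]) (auto simp: fun_eq_iff restrict_def intro!: arg_cong2[where f="\<lambda>x y. (x,y) \<in> R"])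
  qed (rule dpred_vect_eq[where n = "m + n"], rule dvect_var, intro dvect_concat dvect_var)
  moreover have "{z \<in> Fn (m + n). \<exists>x\<in>Fn m. \<exists>y\<in>Fn n. (x, y) \<in> R \<and> z = concat_vec m n x y} = flat m n R"
    using assms(2) concat_vec_Fn[of m n] unfolding flat_def by fastforce
  ultimately show ?thesis by simp
qed

lemma definable_Collect:
  assumes X: "definable M n X" and P: "dpred M (\<lambda>e. P (\<lambda>i\<in>{..<n}. e i))"
  shows "definable M n {x \<in> X. P x}"
proof -
  have "definable M n {x \<in> Fn n. x \<in> X \<and> P x}"
    by (intro definableI dpred_conj dpred_mem[OF X] dvect_var P)
  moreover have "{x \<in> Fn n. x \<in> X \<and> P x} = {x \<in> X. P x}" using definable_subset[OF X] by blast
  ultimately show ?thesis by simp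
qed

lemma definable_Diff:
  assumes "definable M n X" "definable M n Y" shows "definable M n (X - Y)"
  unfolding set_diff_eq
  by (intro definable_Collect[OF assms(1)] dpred_not dpred_mem[OF assms(2)] dvect_var)

lemma definable_flat_restrict:
  assumes E: "definable M (m + n) (flat m n E)" "E \<subseteq> Fn m \<times> Fn n"
    and A: "definable M m A" and B: "definable M n B"
  shows "definable M (m + n) (flat m n (E \<inter> A \<times> B))"
proof (rule definable_flatI)
  have "dpred M (\<lambda>e. ((\<lambda>i\<in>{..<m}. e i), (\<lambda>i\<in>{..<n}. e (m + i))) \<in> E \<and>
      (\<lambda>i\<in>{..<m}. e i) \<in> A \<and> (\<lambda>i\<in>{..<n}. e (m + i)) \<in> B)"
    by (intro dpred_conj dpred_pair[OF E] dpred_mem[OF A] dpred_mem[OF B] dvect_var)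
  then show "dpred M (\<lambda>e. ((\<lambda>i\<in>{..<m}. e i), (\<lambda>i\<in>{..<n}. e (m + i))) \<in> E \<inter> A \<times> B)" by simp
qed (use E(2) in blast)

section \<open>The \<open>\<ell>\<^sup>1\<close>-metric and the topology of \<open>F\<^sup>n\<close>\<close>

text \<open>The \<open>l1\<close>-distance is a finite sum, hence definable by
  \<open>dscal_sum\<close>, and it is additive under concatenation of vectors.\<close>

definition dn :: "nat \<Rightarrow> (nat \<Rightarrow> 'a::linordered_field) \<Rightarrow> (nat \<Rightarrow> 'a) \<Rightarrow> 'a" where
  "dn n x y = (\<Sum>i<n. \<bar>x i - y i\<bar>)"

lemma dn_self [simp]: "dn n x x = 0"
  by (simp add: dn_def)

lemma dn_nonneg [simp]: "0 \<le> dn n x y"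
  by (simp add: dn_def sum_nonneg)

lemma dn_sym: "dn n x y = dn n y x"
  by (simp add: dn_def abs_minus_commute)

lemma dn_tri: "dn n x z \<le> dn n x y + dn n y z"
  unfolding dn_def sum.distrib[symmetric]
  by (rule sum_mono) (smt (verit, ccfv_threshold) abs_triangle_ineq diff_add_cancel add_diff_eq)

lemma dn_coord: "i < n \<Longrightarrow> \<bar>x i - y i\<bar> \<le> dn n x y"
  unfolding dn_def by (rule member_le_sum) auto

lemma dn_eq_0: "x \<in> Fn n \<Longrightarrow> y \<in> Fn n \<Longrightarrow> dn n x y \<le> 0 \<Longrightarrow> x = y"
  by (rule Fn_eqI) (auto dest!: dn_coord[of _ n x y])

text \<open>Dividing by \<open>Suc n\<close> instead of \<open>n\<close> covers \<open>n = 0\<close>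
  and leaves room for the strict inequality.\<close>

lemma dn_bound:
  assumes "\<And>i. i < n \<Longrightarrow> \<bar>x i - y i\<bar> < s / of_nat (Suc n)" and "0 < s"
  shows "dn n x y < s"
proof -
  have pos: "(0::'a) < of_nat (Suc n)" by (simp only: of_nat_0_less_iff)
  have "dn n x y \<le> (\<Sum>i<n. s / of_nat (Suc n))"
    unfolding dn_def using assms by (intro sum_mono) (auto intro: less_imp_le)
  also have "\<dots> = of_nat n * (s / of_nat (Suc n))" by simp
  also have "\<dots> < of_nat (Suc n) * (s / of_nat (Suc n))"
    using assms(2) pos by (intro mult_strict_right_mono) auto
  also have "\<dots> = s" using pos by (simp del: of_nat_Suc)
  finally show ?thesis .
qed

lemma dn_concat: "dn (m + n) (concat_vec m n x y) (concat_vec m n x' y') = dn m x x' + dn n y y'"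
proof -
  have "(\<Sum>i<m + n. f i) = (\<Sum>i<m. f i) + (\<Sum>i<n. f (m + i))" for f :: "nat \<Rightarrow> 'a"
    by (induction n) (simp_all add: add.assoc)
  then show ?thesis by (simp add: dn_def concat_vec_def)
qed

lemma dscal_dn: "dvect M n x \<Longrightarrow> dvect M n y \<Longrightarrow> dscal M (\<lambda>e. dn n (x e) (y e))"
  unfolding dn_def by (intro dscal_sum dscal_abs dscal_diff dvect_nth)

lemma topspace_Fn_top [simp]: "topspace (Fn_top n) = Fn n"
  by (simp add: Fn_top_def Fn_def)

lemma open_abs_ball:
  fixes x :: "'a::{linordered_field, linorder_topology}"
  assumes "open S" "x \<in> S"
  obtains s where "s > 0" "\<And>y. \<bar>y - x\<bar> < s \<Longrightarrow> y \<in> S"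
proof -
  obtain b where b: "b > x" "{x..<b} \<subseteq> S" using open_right[OF assms, of "x + 1"] by auto
  obtain a where a: "a < x" "{a<..x} \<subseteq> S" using open_left[OF assms, of "x - 1"] by auto
  show ?thesis
  proof (rule that[of "min (b - x) (x - a)"])
    fix y assume "\<bar>y - x\<bar> < min (b - x) (x - a)"
    then have "y < b" "a < y" by (auto simp: abs_if split: if_splits)
    then show "y \<in> S" using a b by (cases "x \<le> y") auto
  qed (use a b in auto)
qed

text \<open>The radii range over \<open>F\<close>, which need not contain a countable set of
  positive elements tending to 0; balls with such radii still describe the product of the order
  topologies.\<close>

lemma openin_Fn_top:
  fixes U :: "(nat \<Rightarrow> 'a::{linordered_field, linorder_topology}) set"
  shows "openin (Fn_top n) U \<longleftrightarrow>
    U \<subseteq> Fn n \<and> (\<forall>x\<in>U. \<exists>s>0. \<forall>y\<in>Fn n. dn n x y < s \<longrightarrow> y \<in> U)"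
proof (intro iffI conjI ballI)
  assume U: "openin (Fn_top n) U"
  then show "U \<subseteq> Fn n" using openin_subset by fastforce
  fix x assume "x \<in> U"
  then obtain V where V: "\<And>i. i < n \<Longrightarrow> open (V i)" "x \<in> Pi\<^sub>E {..<n} V" "Pi\<^sub>E {..<n} V \<subseteq> U"
    using U unfolding Fn_top_def openin_product_topology_alt by (metis lessThan_iff open_openin)
  have "\<exists>s>0. \<forall>y. \<bar>y - x i\<bar> < s \<longrightarrow> y \<in> V i" if "i < n" for i
    using open_abs_ball[OF V(1)[OF that], of "x i"] V(2) that by (metis PiE_mem lessThan_iff)
  then obtain s where s: "\<And>i. i < n \<Longrightarrow> s i > 0"
    "\<And>i y. i < n \<Longrightarrow> \<bar>y - x i\<bar> < s i \<Longrightarrow> y \<in> V i" by metis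
  \<comment> \<open>The entry 1 keeps the set nonempty when \<open>n = 0\<close>.\<close>
  define r where "r = Min (insert 1 (s ` {..<n}))"
  have "r > 0" using s(1) by (auto simp: r_def)
  moreover have "y \<in> U" if y: "y \<in> Fn n" "dn n x y < r" for y
  proof -
    have "y i \<in> V i" if i: "i < n" for i
    proof (rule s(2)[OF i])
      have "\<bar>y i - x i\<bar> \<le> dn n x y" using dn_coord[OF i, of x y] by (simp add: abs_minus_commute)
      also have "\<dots> < r" by (rule y)
      also have "r \<le> s i" using i by (auto simp: r_def)
      finally show "\<bar>y i - x i\<bar> < s i" .
    qed
    then have "y \<in> Pi\<^sub>E {..<n} V" using y(1) unfolding Fn_def by (auto simp: PiE_iff)
    then show ?thesis using V(3) by blast
  qed
  ultimately show "\<exists>s>0. \<forall>y\<in>Fn n. dn n x y < s \<longrightarrow> y \<in> U" by blast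
next
  assume U: "U \<subseteq> Fn n \<and> (\<forall>x\<in>U. \<exists>s>0. \<forall>y\<in>Fn n. dn n x y < s \<longrightarrow> y \<in> U)"
  show "openin (Fn_top n) U"
    unfolding Fn_top_def openin_product_topology_alt
  proof (intro ballI)
    fix x assume x: "x \<in> U"
    then obtain s where s: "s > 0" "\<And>y. y \<in> Fn n \<Longrightarrow> dn n x y < s \<Longrightarrow> y \<in> U" using U by blast
    define r where "r = s / of_nat (Suc n)"
    define V where "V i = {x i - r<..<x i + r}" for i
    have r: "r > 0" using s(1) by (simp add: r_def add_pos_nonneg)
    have "Pi\<^sub>E {..<n} V \<subseteq> U"
    proof
      fix y assume y: "y \<in> Pi\<^sub>E {..<n} V"
      show "y \<in> U"
      proof (rule s(2))
        show "y \<in> Fn n" using y by (auto simp: Fn_def PiE_iff)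
        show "dn n x y < s"
        proof (rule dn_bound[OF _ s(1)])
          fix i assume "i < n"
          then have "y i \<in> V i" using y by auto
          then show "\<bar>x i - y i\<bar> < s / of_nat (Suc n)"
            unfolding V_def r_def[symmetric] by (auto simp: abs_if algebra_simps)
        qed
      qed
    qed
    moreover have "x \<in> Pi\<^sub>E {..<n} V" using x U r by (auto simp: Fn_def V_def PiE_iff)
    ultimately show "\<exists>V. finite {i \<in> {..<n}. V i \<noteq> topspace euclidean} \<and>
        (\<forall>i\<in>{..<n}. openin euclidean (V i)) \<and> x \<in> Pi\<^sub>E {..<n} V \<and> Pi\<^sub>E {..<n} V \<subseteq> U"
      by (intro exI[of _ V]) (auto simp: V_def)
  qed
qed

lemma openin_top_on:
  fixes X :: "(nat \<Rightarrow> 'a::{linordered_field, linorder_topology}) set"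
  assumes "X \<subseteq> Fn n"
  shows "openin (top_on n X) U \<longleftrightarrow> U \<subseteq> X \<and> (\<forall>x\<in>U. \<exists>s>0. \<forall>y\<in>X. dn n x y < s \<longrightarrow> y \<in> U)"
proof
  assume "openin (top_on n X) U"
  then show "U \<subseteq> X \<and> (\<forall>x\<in>U. \<exists>s>0. \<forall>y\<in>X. dn n x y < s \<longrightarrow> y \<in> U)"
    using assms unfolding openin_subtopology openin_Fn_top by (metis Int_iff Int_lower2 subsetD)
next
  assume U: "U \<subseteq> X \<and> (\<forall>x\<in>U. \<exists>s>0. \<forall>y\<in>X. dn n x y < s \<longrightarrow> y \<in> U)"
  \<comment> \<open>The union of all balls around points of \<open>U\<close> whose trace on
    \<open>X\<close> lies in \<open>U\<close>; it is open in \<open>F^n\<close> and cuts out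
    \<open>U\<close>.\<close>
  define T where "T = {z \<in> Fn n. \<exists>x\<in>U. \<exists>s>0. (\<forall>y\<in>X. dn n x y < s \<longrightarrow> y \<in> U) \<and> dn n x z < s}"
  have "openin (Fn_top n) T"
    unfolding openin_Fn_top
  proof (intro conjI ballI)
    fix z assume "z \<in> T"
    then obtain x s where x: "x \<in> U" "s > 0" "\<forall>y\<in>X. dn n x y < s \<longrightarrow> y \<in> U" "dn n x z < s"
      unfolding T_def by blast
    have "w \<in> T" if w: "w \<in> Fn n" "dn n z w < s - dn n x z" for w
    proof -
      have "dn n x w < s" using dn_tri[of n x w z] w(2) by (simp add: less_diff_eq add.commute)
      then show ?thesis unfolding T_def using x w by blast
    qed
    with x show "\<exists>s>0. \<forall>y\<in>Fn n. dn n z y < s \<longrightarrow> y \<in> T"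
      by (intro exI[of _ "s - dn n x z"]) auto
  qed (auto simp: T_def)
  moreover have "U = T \<inter> X"
  proof
    show "U \<subseteq> T \<inter> X"
    proof
      fix x assume "x \<in> U"
      moreover from this obtain s where "s > 0" "\<forall>y\<in>X. dn n x y < s \<longrightarrow> y \<in> U" using U by blast
      ultimately show "x \<in> T \<inter> X" unfolding T_def using U assms
        by (auto intro!: bexI[of _ x] exI[of _ s])
    qed
  qed (auto simp: T_def)
  ultimately show "openin (top_on n X) U" unfolding openin_subtopology by blast
qed

lemma topspace_top_on: "X \<subseteq> Fn n \<Longrightarrow> topspace (top_on n X) = X"
  by auto

lemma closedin_top_on:
  fixes X :: "(nat \<Rightarrow> 'a::{linordered_field, linorder_topology}) set"
  assumes "X \<subseteq> Fn n"
  shows "closedin (top_on n X) C \<longleftrightarrow> C \<subseteq> X \<and> (\<forall>x\<in>X. (\<forall>s>0. \<exists>y\<in>C. dn n x y < s) \<longrightarrow> x \<in> C)"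
  unfolding closedin_def openin_top_on[OF assms] topspace_top_on[OF assms] by blast

lemma closedin_Fn_top:
  fixes C :: "(nat \<Rightarrow> 'a::{linordered_field, linorder_topology}) set"
  shows "closedin (Fn_top n) C \<longleftrightarrow>
    C \<subseteq> Fn n \<and> (\<forall>x\<in>Fn n. (\<forall>s>0. \<exists>y\<in>C. dn n x y < s) \<longrightarrow> x \<in> C)"
  unfolding closedin_def openin_Fn_top topspace_Fn_top by blast

definition cont_on ::
  "nat \<Rightarrow> nat \<Rightarrow> (nat \<Rightarrow> 'a::linordered_field) set \<Rightarrow> ((nat \<Rightarrow> 'a) \<Rightarrow> nat \<Rightarrow> 'a) \<Rightarrow> bool" where
  "cont_on m n X f \<longleftrightarrow> (\<forall>x\<in>X. \<forall>s>0. \<exists>r>0. \<forall>y\<in>X. dn m x y < r \<longrightarrow> dn n (f x) (f y) < s)"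

definition scont_on ::
  "nat \<Rightarrow> (nat \<Rightarrow> 'a::linordered_field) set \<Rightarrow> ((nat \<Rightarrow> 'a) \<Rightarrow> 'a) \<Rightarrow> bool" where
  "scont_on n X h \<longleftrightarrow> (\<forall>x\<in>X. \<forall>s>0. \<exists>r>0. \<forall>y\<in>X. dn n x y < r \<longrightarrow> \<bar>h x - h y\<bar> < s)"

lemma cont_onD:
  assumes "cont_on m n X f" "x \<in> X" "s > 0"
  obtains r where "r > 0" "\<And>y. y \<in> X \<Longrightarrow> dn m x y < r \<Longrightarrow> dn n (f x) (f y) < s"
  using assms unfolding cont_on_def by blast

lemma scont_onD:
  assumes "scont_on n X h" "x \<in> X" "s > 0"
  obtains r where "r > 0" "\<And>y. y \<in> X \<Longrightarrow> dn n x y < r \<Longrightarrow> \<bar>h x - h y\<bar> < s"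
  using assms unfolding scont_on_def by blast

lemma continuous_map_iff_cont_on:
  fixes X :: "(nat \<Rightarrow> 'a::{linordered_field, linorder_topology}) set"
  assumes "X \<subseteq> Fn m" "Y \<subseteq> Fn n"
  shows "continuous_map (top_on m X) (top_on n Y) f \<longleftrightarrow> f ` X \<subseteq> Y \<and> cont_on m n X f"
proof (intro iffI conjI)
  assume f: "continuous_map (top_on m X) (top_on n Y) f"
  then show fX: "f ` X \<subseteq> Y"
    using continuous_map_image_subset_topspace topspace_top_on assms by metis
  show "cont_on m n X f"
    unfolding cont_on_def
  proof (intro ballI allI impI)
    fix x s assume x: "x \<in> X" and s: "(0::'a) < s"
    have "openin (top_on n Y) {z \<in> Y. dn n (f x) z < s}"
      unfolding openin_top_on[OF assms(2)]
    proof (intro conjI ballI)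
      fix z assume z: "z \<in> {z \<in> Y. dn n (f x) z < s}"
      have "dn n (f x) y < s" if "dn n z y < s - dn n (f x) z" for y
        using that dn_tri[of n "f x" y z] by (simp add: less_diff_eq add.commute)
      with z show "\<exists>r>0. \<forall>y\<in>Y. dn n z y < r \<longrightarrow> y \<in> {z \<in> Y. dn n (f x) z < s}"
        by (intro exI[of _ "s - dn n (f x) z"]) auto
    qed auto
    then have "openin (top_on m X) {y \<in> X. f y \<in> {z \<in> Y. dn n (f x) z < s}}"
      using openin_continuous_map_preimage[OF f] by (simp only: topspace_top_on[OF assms(1)])
    moreover have "x \<in> {y \<in> X. f y \<in> {z \<in> Y. dn n (f x) z < s}}" using x fX s by auto
    ultimately show "\<exists>r>0. \<forall>y\<in>X. dn m x y < r \<longrightarrow> dn n (f x) (f y) < s"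
      unfolding openin_top_on[OF assms(1)] by blast
  qed
next
  assume f: "f ` X \<subseteq> Y \<and> cont_on m n X f"
  show "continuous_map (top_on m X) (top_on n Y) f"
    unfolding continuous_map_def topspace_top_on[OF assms(1)] topspace_top_on[OF assms(2)]
  proof (intro conjI allI impI)
    show "f \<in> X \<rightarrow> Y" using f by auto
    fix U assume U: "openin (top_on n Y) U"
    show "openin (top_on m X) {x \<in> X. f x \<in> U}"
      unfolding openin_top_on[OF assms(1)]
    proof (intro conjI ballI)
      fix x assume x: "x \<in> {x \<in> X. f x \<in> U}"
      then obtain s where s: "s > 0" "\<forall>z\<in>Y. dn n (f x) z < s \<longrightarrow> z \<in> U"
        using U unfolding openin_top_on[OF assms(2)] by blast
      obtain r where "r > 0" "\<And>y. y \<in> X \<Longrightarrow> dn m x y < r \<Longrightarrow> dn n (f x) (f y) < s"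
        using cont_onD[of m n X f x s] f x s(1) by auto
      with s f show "\<exists>r>0. \<forall>y\<in>X. dn m x y < r \<longrightarrow> y \<in> {x \<in> X. f x \<in> U}"
        by (intro exI[of _ r]) auto
    qed auto
  qed
qed

section \<open>Definable completeness and definable compactness\<close>

lemma vec1_image: "vec1 ` {a. P a} = {x \<in> Fn 1. P (x 0)}"
proof
  show "{x \<in> Fn 1. P (x 0)} \<subseteq> vec1 ` {a. P a}"
  proof
    fix x :: "nat \<Rightarrow> 'a" assume x: "x \<in> {x \<in> Fn 1. P (x 0)}"
    have "x = vec1 (x 0)"
      unfolding vec1_def by (rule Fn_eqI[of _ 1]) (use x in \<open>auto simp: Fn_restrict\<close>)
    with x show "x \<in> vec1 ` {a. P a}" by blast
  qed
qed (auto simp: vec1_def Fn_restrict[of _ 1, simplified])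

lemma definable1I:
  assumes "dpred M (\<lambda>e. P (e 0))" shows "definable1 M {a. P a}"
  unfolding definable1_def vec1_image by (rule definableI) (use assms in simp)

text \<open>The witness \<open>a\<close> and the bound \<open>b\<close> exclude the two infinite
  values of the extended supremum.\<close>

lemma definable_lub:
  assumes "definably_complete M" "dpred M (\<lambda>e. P (e 0))" "P a" "\<And>x. P x \<Longrightarrow> x \<le> b"
  shows "\<exists>s. (\<forall>x. P x \<longrightarrow> x \<le> s) \<and> (\<forall>u. (\<forall>x. P x \<longrightarrow> x \<le> u) \<longrightarrow> s \<le> u)"
proof -
  obtain s where s: "isLub UNIV (Fin ` {x. P x}) s"
    using assms(1) definable1I[OF assms(2)] unfolding definably_complete_def by blast
  then have ub: "Fin x \<le> s" if "P x" for x using that by (auto simp: isLub_def leastP_def isUb_def setle_def)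
  have least: "s \<le> u" if "\<And>x. P x \<Longrightarrow> Fin x \<le> u" for u
    using s that by (auto simp: isLub_def leastP_def isUb_def setle_def setge_def)
  have "Fin a \<le> s" "s \<le> Fin b" using ub assms(3) least[of "Fin b"] assms(4) by auto
  then obtain t where t: "s = Fin t" by (cases s) auto
  show ?thesis
  proof (intro exI conjI allI impI)
    show "x \<le> t" if "P x" for x using ub[OF that] t by simp
    show "t \<le> u" if "\<forall>x. P x \<longrightarrow> x \<le> u" for u using least[of "Fin u"] that t by simp
  qed
qed

lemma definable_glb:
  assumes "definably_complete M" "dpred M (\<lambda>e. P (e 0))" "P a" "\<And>x. P x \<Longrightarrow> b \<le> x"
  shows "\<exists>s. (\<forall>x. P x \<longrightarrow> s \<le> x) \<and> (\<forall>u. (\<forall>x. P x \<longrightarrow> u \<le> x) \<longrightarrow> u \<le> s)"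
proof -
  have "dpred M (\<lambda>e. P (- e 0))"
    using dpred_bind_scal[OF dscal_uminus[OF dscal_var[of M 0]], where P = "\<lambda>x e. P x"] assms(2) by simp
  then have "\<exists>s. (\<forall>x. P (- x) \<longrightarrow> x \<le> s) \<and> (\<forall>u. (\<forall>x. P (- x) \<longrightarrow> x \<le> u) \<longrightarrow> s \<le> u)"
  proof (rule definable_lub[OF assms(1)])
    show "P (- (- a))" using assms(3) by simp
    show "x \<le> - b" if "P (- x)" for x using assms(4)[OF that] by (simp add: le_minus_iff)
  qed
  then obtain s where s: "\<And>x. P (- x) \<Longrightarrow> x \<le> s" "\<And>u. (\<And>x. P (- x) \<Longrightarrow> x \<le> u) \<Longrightarrow> s \<le> u" by blast
  show ?thesis
  proof (intro exI conjI allI impI)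
    show "- s \<le> x" if "P x" for x using s(1)[of "- x"] that by (simp add: minus_le_iff)
    show "u \<le> - s" if "\<forall>x. P x \<longrightarrow> u \<le> x" for u
      using s(2)[of "- u"] that by (metis le_minus_iff)
  qed
qed

text \<open>The point \<open>p\<close> is the limit superior of the sets \<open>Q s\<close> as
  \<open>s\<close> tends to 0: \<open>L\<close> collects the upper bounds of the single sets
  \<open>Q s\<close>, and \<open>p\<close> is its infimum.\<close>

lemma definable_limit_point1:
  fixes Q :: "'a::linordered_field \<Rightarrow> 'a \<Rightarrow> bool"
  assumes M: "definably_complete M" and Q: "dpred M (\<lambda>e. Q (e 0) (e 1))"
    and ne: "\<And>s. s > 0 \<Longrightarrow> \<exists>x. Q s x" and mono: "\<And>s t x. Q s x \<Longrightarrow> s \<le> t \<Longrightarrow> Q t x"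
    and bdd: "\<And>s x. s > 0 \<Longrightarrow> Q s x \<Longrightarrow> \<bar>x\<bar> \<le> B"
  shows "\<exists>p. \<forall>s>0. \<exists>x. Q s x \<and> \<bar>x - p\<bar> < s"
proof -
  define L where "L a \<longleftrightarrow> (\<exists>s. s > 0 \<and> (\<forall>x. Q s x \<longrightarrow> x \<le> a))" for a
  have "dpred M (\<lambda>e. L (e 0))"
    unfolding L_def
    by (intro dpred_ex dpred_all dpred_conj dpred_imp dpred_less dpred_le dscal_var dscal_const)
      (use dpred_rename[OF Q, of "\<lambda>i. if i = 0 then 1 else 0"] in simp)
  moreover have "L B" unfolding L_def using bdd zero_less_one abs_le_D1 by blast
  moreover have "- B \<le> a" if L: "L a" for a
  proof -
    obtain s where s: "s > 0" "\<forall>x. Q s x \<longrightarrow> x \<le> a" using L unfolding L_def by blast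
    obtain x where "Q s x" using ne[OF s(1)] by blast
    with s bdd[OF s(1) this] show ?thesis by (meson abs_le_iff minus_le_iff order_trans)
  qed
  ultimately obtain p where p: "\<And>a. L a \<Longrightarrow> p \<le> a" "\<And>u. (\<And>a. L a \<Longrightarrow> u \<le> a) \<Longrightarrow> u \<le> p"
    using definable_glb[OF M, of L B "- B"] by blast
  have "\<exists>x. Q s x \<and> \<bar>x - p\<bar> < s" if s: "s > 0" for s
  proof -
    obtain l where l: "L l" "l < p + s" using p(2)[of "p + s"] s by (meson add_le_same_cancel1 leI not_le)
    then obtain r where r: "r > 0" "\<forall>x. Q r x \<longrightarrow> x \<le> l" unfolding L_def by blast
    \<comment> \<open>\<open>l\<close> is an upper bound of \<open>Q r\<close>, while
      \<open>p - s\<close> is an upper bound of no \<open>Q\<close> at a positive scale; a point of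
      \<open>Q (min s r)\<close> lies between the two.\<close>
    have "\<not> L (p - s)" using p(1)[of "p - s"] s by auto
    then obtain x where x: "Q (min s r) x" "x > p - s"
      unfolding L_def using s r(1) by (metis min_less_iff_conj not_le)
    have "x \<le> l" using mono[OF x(1), of r] r(2) by auto
    then have "\<bar>x - p\<bar> < s" using x(2) l(2) by (auto simp: abs_less_iff algebra_simps)
    then show ?thesis using mono[OF x(1), of s] by auto
  qed
  then show ?thesis by blast
qed

text \<open>The coordinates converge one after another. \<open>Q\<close> consists of the possible
  next coordinates of points of \<open>P s\<close> whose first \<open>j\<close> coordinates are
  already within \<open>s\<close> of the limit, so the one-dimensional case supplies the next
  one.\<close>

lemma definable_limit_point:
  fixes P :: "'a::linordered_field \<Rightarrow> (nat \<Rightarrow> 'a) \<Rightarrow> bool"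
  assumes M: "definably_complete M" and P: "dpred M (\<lambda>e. P (e 0) (\<lambda>i\<in>{..<n}. e (Suc i)))"
    and ne: "\<And>s. s > 0 \<Longrightarrow> \<exists>x\<in>Fn n. P s x" and mono: "\<And>s t x. P s x \<Longrightarrow> s \<le> t \<Longrightarrow> P t x"
    and bdd: "\<And>s x i. s > 0 \<Longrightarrow> x \<in> Fn n \<Longrightarrow> P s x \<Longrightarrow> i < n \<Longrightarrow> \<bar>x i\<bar> \<le> B"
  shows "\<exists>p\<in>Fn n. \<forall>s>0. \<exists>x\<in>Fn n. P s x \<and> dn n x p < s"
proof -
  have "\<exists>p\<in>Fn n. \<forall>s>0. \<exists>x\<in>Fn n. P s x \<and> (\<forall>i<j. \<bar>x i - p i\<bar> < s)" if "j \<le> n" for j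
    using that
  proof (induction j)
    case 0
    then show ?case using ne Fn_restrict by auto
  next
    case (Suc j)
    then obtain p where p: "p \<in> Fn n" "\<And>s. s > 0 \<Longrightarrow> \<exists>x\<in>Fn n. P s x \<and> (\<forall>i<j. \<bar>x i - p i\<bar> < s)"
      by auto
    define Q where "Q s b \<longleftrightarrow> (\<exists>x\<in>Fn n. P s x \<and> (\<forall>i<j. \<bar>x i - p i\<bar> < s) \<and> x j = b)" for s b
    have "\<exists>b. \<forall>s>0. \<exists>x. Q s x \<and> \<bar>x - b\<bar> < s"
    proof (rule definable_limit_point1[OF M])
      show "dpred M (\<lambda>e. Q (e 0) (e 1))"
        unfolding Q_def
        by (intro dpred_bex[OF definable_Fn] dpred_conj dpred_ball_fin dpred_less dpred_eq dscal_abs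
            dscal_diff dscal_nth dscal_var dscal_const)
          (use dpred_rename[OF P, of "\<lambda>i. if i = 0 then n else i - 1"] in simp)
      show "\<And>s. s > 0 \<Longrightarrow> \<exists>x. Q s x" using p(2) unfolding Q_def by blast
      show "\<And>s t x. Q s x \<Longrightarrow> s \<le> t \<Longrightarrow> Q t x" unfolding Q_def using mono less_le_trans by blast
      show "\<And>s x. s > 0 \<Longrightarrow> Q s x \<Longrightarrow> \<bar>x\<bar> \<le> B" unfolding Q_def using bdd Suc.prems by auto
    qed
    then obtain b where b: "\<And>s. s > 0 \<Longrightarrow> \<exists>x. Q s x \<and> \<bar>x - b\<bar> < s" by blast
    have "p(j := b) \<in> Fn n" using p(1) Suc.prems by (auto simp: Fn_def PiE_iff extensional_def)
    moreover have "\<exists>x\<in>Fn n. P s x \<and> (\<forall>i<Suc j. \<bar>x i - (p(j := b)) i\<bar> < s)" if "s > 0" for s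
      using b[OF that] unfolding Q_def by (fastforce simp: less_Suc_eq)
    ultimately show ?case by blast
  qed
  then obtain p where p: "p \<in> Fn n" "\<And>s. s > 0 \<Longrightarrow> \<exists>x\<in>Fn n. P s x \<and> (\<forall>i<n. \<bar>x i - p i\<bar> < s)" by blast
  have "\<exists>x\<in>Fn n. P s x \<and> dn n x p < s" if s: "s > 0" for s
  proof -
    have "s / of_nat (Suc n) > 0" using s by (intro divide_pos_pos) (simp_all only: of_nat_0_less_iff)
    then obtain x where x: "x \<in> Fn n" "P (s / of_nat (Suc n)) x" "\<forall>i<n. \<bar>x i - p i\<bar> < s / of_nat (Suc n)"
      using p(2) by blast
    have "s / of_nat (Suc n) \<le> s / 1" using s by (intro divide_left_mono) (auto simp: add_pos_nonneg)
    then show ?thesis using x mono[OF x(2)] dn_bound[of n x p s] s by auto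
  qed
  with p(1) show ?thesis by blast
qed

lemma definably_compact_iff:
  fixes M :: "('a::{linordered_field, linorder_topology}, 'f, 'r) expansion"
  shows "definably_compact M n C \<longleftrightarrow> definable M n C \<and>
    (\<forall>x\<in>Fn n. (\<forall>s>0. \<exists>y\<in>C. dn n x y < s) \<longrightarrow> x \<in> C) \<and> (\<exists>B. \<forall>x\<in>C. \<forall>i<n. \<bar>x i\<bar> \<le> B)"
proof -
  have "(\<exists>a b. \<forall>x\<in>C. \<forall>i<n. a \<le> x i \<and> x i \<le> b) \<longleftrightarrow> (\<exists>B. \<forall>x\<in>C. \<forall>i<n. \<bar>x i\<bar> \<le> B)"
  proof
    assume "\<exists>a b. \<forall>x\<in>C. \<forall>i<n. a \<le> x i \<and> x i \<le> b"
    then obtain a b where ab: "\<And>x i. x \<in> C \<Longrightarrow> i < n \<Longrightarrow> a \<le> x i \<and> x i \<le> b" by blast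
    have "\<bar>x i\<bar> \<le> max \<bar>a\<bar> \<bar>b\<bar>" if "x \<in> C" "i < n" for x i using ab[OF that] by linarith
    then show "\<exists>B. \<forall>x\<in>C. \<forall>i<n. \<bar>x i\<bar> \<le> B" by blast
  next
    assume "\<exists>B. \<forall>x\<in>C. \<forall>i<n. \<bar>x i\<bar> \<le> B"
    then obtain B where B: "\<And>x i. x \<in> C \<Longrightarrow> i < n \<Longrightarrow> \<bar>x i\<bar> \<le> B" by blast
    have "- B \<le> x i \<and> x i \<le> B" if "x \<in> C" "i < n" for x i using B[OF that] by linarith
    then show "\<exists>a b. \<forall>x\<in>C. \<forall>i<n. a \<le> x i \<and> x i \<le> b" by blast
  qed
  then show ?thesis unfolding definably_compact_def closedin_Fn_top
    by (cases "definable M n C") (simp_all add: definable_subset)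
qed

text \<open>This replaces the choice of a convergent subsequence: \<open>P s\<close> collects the
  points acceptable at scale \<open>s\<close>, and the conclusion keeps \<open>P s\<close> next to
  the nearness to \<open>p\<close>.\<close>

lemma definably_compact_limit_point:
  fixes M :: "('a::{linordered_field, linorder_topology}, 'f, 'r) expansion"
  assumes M: "definably_complete M" and C: "definably_compact M n C"
    and P: "dpred M (\<lambda>e. P (e 0) (\<lambda>i\<in>{..<n}. e (Suc i)))"
    and ne: "\<And>s. s > 0 \<Longrightarrow> \<exists>x\<in>C. P s x" and mono: "\<And>s t x. P s x \<Longrightarrow> s \<le> t \<Longrightarrow> P t x"
  shows "\<exists>p\<in>C. \<forall>s>0. \<exists>x\<in>C. P s x \<and> dn n x p < s"
proof -
  obtain B where B: "\<And>x i. x \<in> C \<Longrightarrow> i < n \<Longrightarrow> \<bar>x i\<bar> \<le> B" and dC: "definable M n C"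
    and clo: "\<And>x. x \<in> Fn n \<Longrightarrow> (\<And>s. s > 0 \<Longrightarrow> \<exists>y\<in>C. dn n x y < s) \<Longrightarrow> x \<in> C"
    using C unfolding definably_compact_iff by blast
  note CF = definable_subset[OF dC]
  have "\<exists>p\<in>Fn n. \<forall>s>0. \<exists>x\<in>Fn n. (P s x \<and> x \<in> C) \<and> dn n x p < s"
  proof (rule definable_limit_point[OF M, where B = B])
    show "dpred M (\<lambda>e. P (e 0) (\<lambda>i\<in>{..<n}. e (Suc i)) \<and> (\<lambda>i\<in>{..<n}. e (Suc i)) \<in> C)"
      by (intro dpred_conj P dpred_mem[OF dC] dvect_var)
    show "\<And>s. s > 0 \<Longrightarrow> \<exists>x\<in>Fn n. P s x \<and> x \<in> C" using ne CF by blast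
  qed (use mono B in auto)
  then obtain p where p: "p \<in> Fn n" "\<And>s. s > 0 \<Longrightarrow> \<exists>x\<in>Fn n. (P s x \<and> x \<in> C) \<and> dn n x p < s" by blast
  have "p \<in> C" by (rule clo[OF p(1)]) (use p(2) dn_sym in metis)
  with p(2) show ?thesis by blast
qed

text \<open>A pair is flattened to one vector, and \<open>dn_concat\<close> splits the distance back
  into its two parts.\<close>

lemma definably_compact_limit_pair:
  fixes M :: "('a::{linordered_field, linorder_topology}, 'f, 'r) expansion"
  assumes M: "definably_complete M" and C: "definably_compact M (m + n) (flat m n R)"
    and R: "R \<subseteq> Fn m \<times> Fn n"
    and P: "dpred M (\<lambda>e. P (e 0) (\<lambda>i\<in>{..<m}. e (Suc i)) (\<lambda>i\<in>{..<n}. e (Suc (m + i))))"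
    and ne: "\<And>s. s > 0 \<Longrightarrow> \<exists>(x, y)\<in>R. P s x y" and mono: "\<And>s t x y. P s x y \<Longrightarrow> s \<le> t \<Longrightarrow> P t x y"
  shows "\<exists>(p, q)\<in>R. \<forall>s>0. \<exists>(x, y)\<in>R. P s x y \<and> dn m x p < s \<and> dn n y q < s"
proof -
  have dR: "definable M (m + n) (flat m n R)" using C by (simp add: definably_compact_iff)
  define Q where "Q s z \<longleftrightarrow> (\<exists>x\<in>Fn m. \<exists>y\<in>Fn n. (x, y) \<in> R \<and> z = concat_vec m n x y \<and> P s x y)" for s z
  have "\<exists>p\<in>flat m n R. \<forall>s>0. \<exists>z\<in>flat m n R. Q s z \<and> dn (m + n) z p < s"
  proof (rule definably_compact_limit_point[OF M C])
    show "dpred M (\<lambda>e. Q (e 0) (\<lambda>i\<in>{..<m + n}. e (Suc i)))"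
      unfolding Q_def
      by (intro dpred_bex[OF definable_Fn] dpred_conj dpred_pair[OF dR R] dpred_vect_eq[where n = "m + n"]
          dvect_concat dvect_var)
        (use dpred_rename[OF P, of "\<lambda>i. if i = 0 then n + m else if i \<le> m then n + (i - 1) else i - Suc m"]
          in \<open>simp cong: restrict_cong\<close>)
    show "\<exists>z\<in>flat m n R. Q s z" if "s > 0" for s
      using ne[OF that] R unfolding Q_def flat_def by fastforce
    show "\<And>s t z. Q s z \<Longrightarrow> s \<le> t \<Longrightarrow> Q t z" unfolding Q_def using mono by blast
  qed
  then obtain p where p: "p \<in> flat m n R" "\<And>s. s > 0 \<Longrightarrow> \<exists>z\<in>flat m n R. Q s z \<and> dn (m + n) z p < s" by blast
  then obtain a b where ab: "(a, b) \<in> R" "p = concat_vec m n a b" unfolding flat_def by auto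
  have "\<exists>(x, y)\<in>R. P s x y \<and> dn m x a < s \<and> dn n y b < s" if s: "s > 0" for s
  proof -
    obtain x y where xy: "(x, y) \<in> R" "P s x y" "dn m x a + dn n y b < s"
      using p(2)[OF s] unfolding Q_def ab by (auto simp: dn_concat)
    then have "dn m x a < s" "dn n y b < s"
      using dn_nonneg[of m x a] dn_nonneg[of n y b] by linarith+
    with xy show ?thesis by blast
  qed
  with ab show ?thesis by blast
qed

section \<open>Definable functions\<close>

text \<open>Total functions, described by their effect on definable vectors instead of their graphs,
  so that composition needs no proof; \<open>dfunI\<close> recovers the property from a definable
  graph.\<close>

definition dfun ::
  "('a::linordered_field, 'f, 'r) expansion \<Rightarrow> nat \<Rightarrow> nat \<Rightarrow> ((nat \<Rightarrow> 'a) \<Rightarrow> nat \<Rightarrow> 'a) \<Rightarrow> bool" where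
  "dfun M m n F \<longleftrightarrow> (\<forall>x. dvect M m x \<longrightarrow> dvect M n (\<lambda>e. F (x e)))"

definition dsfun ::
  "('a::linordered_field, 'f, 'r) expansion \<Rightarrow> nat \<Rightarrow> ((nat \<Rightarrow> 'a) \<Rightarrow> 'a) \<Rightarrow> bool" where
  "dsfun M m h \<longleftrightarrow> (\<forall>x. dvect M m x \<longrightarrow> dscal M (\<lambda>e. h (x e)))"

lemma dfun_dvect: "dfun M m n F \<Longrightarrow> dvect M m x \<Longrightarrow> dvect M n (\<lambda>e. F (x e))"
  by (simp add: dfun_def)

lemma dsfun_dscal: "dsfun M m h \<Longrightarrow> dvect M m x \<Longrightarrow> dscal M (\<lambda>e. h (x e))"
  by (simp add: dsfun_def)

lemma dfun_Fn: "dfun M m n F \<Longrightarrow> x \<in> Fn m \<Longrightarrow> F x \<in> Fn n"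
  using dvect_Fn[OF dfun_dvect[OF _ dvect_const]] by metis

lemma dsfunI:
  assumes "dpred M (\<lambda>e. e m = h (\<lambda>i\<in>{..<m}. e i))" shows "dsfun M m h"
  unfolding dsfun_def dscal_def
proof (intro allI impI)
  fix x assume "dvect M m x"
  from dvect_rename[OF this, of Suc] assms
  show "dpred M (\<lambda>e. e 0 = h (x (\<lambda>i. e (Suc i))))"
    using dpred_bind_vect[of M m "\<lambda>e. x (\<lambda>i. e (Suc i))" "\<lambda>v e. e 0 = h v"] by simp
qed

lemma dfunI:
  assumes "\<And>x. x \<in> Fn m \<Longrightarrow> F x \<in> Fn n"
    and "\<And>i. i < n \<Longrightarrow> dpred M (\<lambda>e. e m = F (\<lambda>i\<in>{..<m}. e i) i)"
  shows "dfun M m n F"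
  unfolding dfun_def
proof (intro allI impI)
  fix x assume x: "dvect M m x"
  show "dvect M n (\<lambda>e. F (x e))"
    unfolding dvect_def
  proof (intro conjI allI impI)
    show "F (x e) \<in> Fn n" for e using assms(1) dvect_Fn[OF x] by blast
    show "dscal M (\<lambda>e. F (x e) i)" if "i < n" for i
      using dsfun_dscal[OF dsfunI[where h = "\<lambda>x. F x i", OF assms(2)[OF that]] x] .
  qed
qed

lemma dsfun_nth: "dfun M m n F \<Longrightarrow> i < n \<Longrightarrow> dsfun M m (\<lambda>x. F x i)"
  unfolding dsfun_def using dvect_nth[OF dfun_dvect] by blast

text \<open>A definable map is arbitrary outside \<open>X\<close>; the value 0 there turns it into a
  total function of the calculus.\<close>

lemma definable_map_dfun:
  assumes f: "definable_map M m n X Y f"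
  shows "dfun M m n (\<lambda>x. if x \<in> X then f x else (\<lambda>i\<in>{..<n}. 0))" (is "dfun M m n ?F")
proof (rule dfunI)
  define G where "G = {(x, f x) | x. x \<in> X}"
  have X: "definable M m X" and dG: "definable M (m + n) (flat m n G)" and fXY: "f ` X \<subseteq> Y"
    and Y: "definable M n Y"
    using f unfolding definable_map_def G_def by auto
  have G: "G \<subseteq> Fn m \<times> Fn n" using definable_subset[OF X] definable_subset[OF Y] fXY unfolding G_def by auto
  show "?F x \<in> Fn n" if "x \<in> Fn m" for x
    using fXY definable_subset[OF Y] by (auto simp: Fn_restrict)
  show "dpred M (\<lambda>e. e m = ?F (\<lambda>i\<in>{..<m}. e i) i)" if "i < n" for i
  proof -
    have "dpred M (\<lambda>e. ((\<lambda>i\<in>{..<m}. e i) \<in> X \<and> (\<exists>y\<in>Fn n. ((\<lambda>i\<in>{..<m}. e i), y) \<in> G \<and> e m = y i))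
       \<or> ((\<lambda>i\<in>{..<m}. e i) \<notin> X \<and> e m = 0))"
      by (intro dpred_disj dpred_conj dpred_not dpred_mem[OF X] dvect_var dpred_bex[OF definable_Fn]
          dpred_pair[OF dG G] dpred_eq dscal_var dscal_nth dscal_const)
    then show ?thesis
    proof (rule back_subst[of "dpred M"], intro ext)
      fix e :: "nat \<Rightarrow> 'a"
      show "(((\<lambda>i\<in>{..<m}. e i) \<in> X \<and> (\<exists>y\<in>Fn n. ((\<lambda>i\<in>{..<m}. e i), y) \<in> G \<and> e m = y i))
       \<or> ((\<lambda>i\<in>{..<m}. e i) \<notin> X \<and> e m = 0)) = (e m = ?F (\<lambda>i\<in>{..<m}. e i) i)"
        using that fXY definable_subset[OF Y] by (auto simp: G_def)
    qed
  qed
qed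

lemma definable_mapI:
  assumes X: "definable M m X" and Y: "definable M n Y" and f: "f ` X \<subseteq> Y" and F: "dfun M m n F"
    and eq: "\<And>x. x \<in> X \<Longrightarrow> f x = F x"
  shows "definable_map M m n X Y f"
proof -
  have "definable M (m + n) (flat m n {(x, f x) | x. x \<in> X})"
  proof (rule definable_flatI)
    have "dpred M (\<lambda>e. (\<lambda>i\<in>{..<m}. e i) \<in> X \<and> (\<lambda>i\<in>{..<n}. e (m + i)) = F (\<lambda>i\<in>{..<m}. e i))"
      by (intro dpred_conj dpred_mem[OF X] dpred_vect_eq[where n = n] dvect_var dfun_dvect[OF F])
    then show "dpred M (\<lambda>e. ((\<lambda>i\<in>{..<m}. e i), (\<lambda>i\<in>{..<n}. e (m + i))) \<in> {(x, f x) | x. x \<in> X})"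
      by (rule back_subst[of "dpred M"], intro ext) (use eq in auto)
    show "{(x, f x) | x. x \<in> X} \<subseteq> Fn m \<times> Fn n"
      using definable_subset[OF X] definable_subset[OF Y] f by auto
  qed
  with X Y f show ?thesis by (simp add: definable_map_def)
qed

lemma definable_image:
  assumes X: "definable M m X" and F: "dfun M m n F" shows "definable M n (F ` X)"
proof -
  have "definable M n {y \<in> Fn n. \<exists>x\<in>X. y = F x}"
    by (intro definableI dpred_bex[OF X] dpred_vect_eq[where n = n] dvect_var dfun_dvect[OF F])
  moreover have "F ` X = {y \<in> Fn n. \<exists>x\<in>X. y = F x}"
    using dfun_Fn[OF F] definable_subset[OF X] by auto
  ultimately show ?thesis by simp
qed

lemma dsfun_ops:
  assumes "dsfun M m g" "dsfun M m h"
  shows "dsfun M m (\<lambda>x. g x + h x)" "dsfun M m (\<lambda>x. g x - h x)" "dsfun M m (\<lambda>x. g x * h x)"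
    "dsfun M m (\<lambda>x. g x / h x)"
  using assms unfolding dsfun_def
  by (simp_all add: dscal_add dscal_diff dscal_mult dscal_divide)

lemma dsfun_inverse: "dsfun M m g \<Longrightarrow> dsfun M m (\<lambda>x. inverse (g x))"
  unfolding dsfun_def by (simp add: dscal_inverse)

lemma dsfun_const: "dsfun M m (\<lambda>_. c)"
  by (simp add: dsfun_def dscal_const)

lemma dsfun_if:
  assumes "definable M m X" "dsfun M m g" "dsfun M m h"
  shows "dsfun M m (\<lambda>x. if x \<in> X then g x else h x)"
  using assms unfolding dsfun_def by (simp add: dscal_if dpred_mem)

lemma dsfun_coord: "i < m \<Longrightarrow> dsfun M m (\<lambda>x. x i)"
  by (simp add: dsfun_def dvect_nth)

lemma dfun_coordI: "(\<And>i. i < n \<Longrightarrow> dsfun M m (t i)) \<Longrightarrow> dfun M m n (\<lambda>x. \<lambda>i\<in>{..<n}. t i x)"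
  unfolding dfun_def dsfun_def by (simp add: dvectI)

section \<open>Continuity of scalar functions\<close>

lemma scont_const: "scont_on n X (\<lambda>_. c)"
  unfolding scont_on_def by (auto intro: exI[of _ 1])

lemma scont_lipschitz:
  assumes "\<And>x y. x \<in> X \<Longrightarrow> y \<in> X \<Longrightarrow> \<bar>h x - h y\<bar> \<le> L * dn n x y"
  shows "scont_on n X h"
  unfolding scont_on_def
proof (intro ballI allI impI)
  fix x and s :: 'a assume x: "x \<in> X" and s: "s > 0"
  show "\<exists>r>0. \<forall>y\<in>X. dn n x y < r \<longrightarrow> \<bar>h x - h y\<bar> < s"
  proof (intro exI conjI ballI impI)
    show "s / (\<bar>L\<bar> + 1) > 0" using s by (simp add: add_nonneg_pos)
    fix y assume y: "y \<in> X" "dn n x y < s / (\<bar>L\<bar> + 1)"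
    have "\<bar>h x - h y\<bar> \<le> L * dn n x y" using assms x y(1) by blast
    also have "\<dots> \<le> (\<bar>L\<bar> + 1) * dn n x y" by (intro mult_right_mono) auto
    also have "\<dots> < (\<bar>L\<bar> + 1) * (s / (\<bar>L\<bar> + 1))" using y(2) by (intro mult_strict_left_mono) auto
    also have "\<dots> = s" by (simp add: add_nonneg_eq_0_iff)
    finally show "\<bar>h x - h y\<bar> < s" .
  qed
qed

lemma scont_coord: "i < n \<Longrightarrow> scont_on n X (\<lambda>x. x i)"
  by (rule scont_lipschitz[where L = 1]) (simp add: dn_coord)

lemma cont_subset: "cont_on m n X f \<Longrightarrow> Y \<subseteq> X \<Longrightarrow> cont_on m n Y f"
  unfolding cont_on_def by (meson subset_iff)

lemma scont_cong: "scont_on n X h \<Longrightarrow> (\<And>x. x \<in> X \<Longrightarrow> h x = g x) \<Longrightarrow> scont_on n X g"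
  unfolding scont_on_def by simp

lemma cont_cong: "cont_on m n X f \<Longrightarrow> (\<And>x. x \<in> X \<Longrightarrow> f x = g x) \<Longrightarrow> cont_on m n X g"
  unfolding cont_on_def by simp

lemma scont_add:
  assumes g: "scont_on n X g" and h: "scont_on n X h"
  shows "scont_on n X (\<lambda>x. g x + h x)"
  unfolding scont_on_def
proof (intro ballI allI impI)
  fix x and s :: 'a assume x: "x \<in> X" and s: "s > 0"
  obtain r1 where r1: "r1 > 0" "\<And>y. y \<in> X \<Longrightarrow> dn n x y < r1 \<Longrightarrow> \<bar>g x - g y\<bar> < s / 2"
    using scont_onD[OF g x, of "s / 2"] s by auto
  obtain r2 where r2: "r2 > 0" "\<And>y. y \<in> X \<Longrightarrow> dn n x y < r2 \<Longrightarrow> \<bar>h x - h y\<bar> < s / 2"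
    using scont_onD[OF h x, of "s / 2"] s by auto
  have "\<bar>g x + h x - (g y + h y)\<bar> < s" if "y \<in> X" "dn n x y < min r1 r2" for y
  proof -
    have "\<bar>g x - g y\<bar> < s / 2" "\<bar>h x - h y\<bar> < s / 2" using r1(2) r2(2) that by auto
    then show ?thesis by linarith
  qed
  with r1 r2 show "\<exists>r>0. \<forall>y\<in>X. dn n x y < r \<longrightarrow> \<bar>g x + h x - (g y + h y)\<bar> < s"
    by (intro exI[of _ "min r1 r2"]) auto
qed

lemma scont_mult:
  assumes g: "scont_on n X g" and h: "scont_on n X h"
  shows "scont_on n X (\<lambda>x. g x * h x)"
  unfolding scont_on_def
proof (intro ballI allI impI)
  fix x and s :: 'a assume x: "x \<in> X" and s: "s > 0"
  \<comment> \<open>The difference of products is split as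
    \<open>g x * (h x - h y) + (g x - g y) * h y\<close>; since \<open>t \<le> 1\<close>, the
    constant \<open>c\<close> bounds both outer factors.\<close>
  define c where "c = \<bar>g x\<bar> + \<bar>h x\<bar> + 1"
  define t where "t = min 1 (s / (2 * c))"
  have c: "c > 0" unfolding c_def by (simp add: add_nonneg_pos)
  have t: "t > 0" "t \<le> 1" using s c by (auto simp: t_def)
  obtain r1 where r1: "r1 > 0" "\<And>y. y \<in> X \<Longrightarrow> dn n x y < r1 \<Longrightarrow> \<bar>g x - g y\<bar> < t"
    using scont_onD[OF g x t(1)] by auto
  obtain r2 where r2: "r2 > 0" "\<And>y. y \<in> X \<Longrightarrow> dn n x y < r2 \<Longrightarrow> \<bar>h x - h y\<bar> < t"
    using scont_onD[OF h x t(1)] by auto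
  have "\<bar>g x * h x - g y * h y\<bar> < s" if y: "y \<in> X" "dn n x y < min r1 r2" for y
  proof -
    have 1: "\<bar>g x - g y\<bar> < t" "\<bar>h x - h y\<bar> < t" using r1(2) r2(2) y by auto
    then have "\<bar>h y\<bar> < \<bar>h x\<bar> + 1" using t(2) by linarith
    then have hy: "\<bar>h y\<bar> \<le> c" unfolding c_def by linarith
    have gx: "\<bar>g x\<bar> < c" unfolding c_def by linarith
    have "\<bar>g x * h x - g y * h y\<bar> = \<bar>g x * (h x - h y) + (g x - g y) * h y\<bar>" by (simp add: algebra_simps)
    also have "\<dots> \<le> \<bar>g x\<bar> * \<bar>h x - h y\<bar> + \<bar>g x - g y\<bar> * \<bar>h y\<bar>"
      by (metis abs_mult abs_triangle_ineq)
    also have "\<dots> \<le> c * \<bar>h x - h y\<bar> + \<bar>g x - g y\<bar> * c"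
      using gx hy by (intro add_mono mult_right_mono mult_left_mono) auto
    also have "\<dots> < c * t + t * c"
      using 1 c by (intro add_strict_mono mult_strict_left_mono mult_strict_right_mono) auto
    also have "\<dots> \<le> c * (s / (2 * c)) + (s / (2 * c)) * c"
      using c by (intro add_mono mult_left_mono mult_right_mono) (auto simp: t_def)
    also have "\<dots> = s" using c by (simp add: field_simps)
    finally show ?thesis .
  qed
  with r1 r2 show "\<exists>r>0. \<forall>y\<in>X. dn n x y < r \<longrightarrow> \<bar>g x * h x - g y * h y\<bar> < s"
    by (intro exI[of _ "min r1 r2"]) auto
qed

lemma scont_diff:
  assumes "scont_on n X g" "scont_on n X h"
  shows "scont_on n X (\<lambda>x. g x - h x)"
  using scont_add[OF assms(1) scont_mult[OF scont_const[of n X "-1"] assms(2)]] by simp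

lemma scont_inverse:
  assumes g: "scont_on n X g" and nz: "\<And>x. x \<in> X \<Longrightarrow> g x \<noteq> 0"
  shows "scont_on n X (\<lambda>x. inverse (g x))"
  unfolding scont_on_def
proof (intro ballI allI impI)
  fix x and s :: 'a assume x: "x \<in> X" and s: "s > 0"
  define c where "c = \<bar>g x\<bar>"
  have c: "c > 0" using nz[OF x] by (simp add: c_def)
  \<comment> \<open>The first bound keeps \<open>|g y|\<close> above \<open>c / 2\<close>; the
    second is \<open>s\<close> times the resulting lower bound of
    \<open>|g x * g y|\<close>.\<close>
  define t where "t = min (c / 2) (s * (c * c / 2))"
  have t: "t > 0" using s c by (simp add: t_def)
  obtain r where r: "r > 0" "\<And>y. y \<in> X \<Longrightarrow> dn n x y < r \<Longrightarrow> \<bar>g x - g y\<bar> < t"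
    using scont_onD[OF g x t] by auto
  have "\<bar>inverse (g x) - inverse (g y)\<bar> < s" if y: "y \<in> X" "dn n x y < r" for y
  proof -
    have 1: "\<bar>g x - g y\<bar> < t" using r(2) y by auto
    then have 2: "\<bar>g y\<bar> \<ge> c / 2" unfolding c_def t_def by linarith
    have "inverse (g x) - inverse (g y) = (g y - g x) / (g x * g y)"
      using nz[OF x] nz[OF y(1)] by (simp add: field_simps)
    then have "\<bar>inverse (g x) - inverse (g y)\<bar> = \<bar>g x - g y\<bar> / (c * \<bar>g y\<bar>)"
      by (simp add: c_def abs_mult abs_minus_commute)
    also have "\<dots> \<le> \<bar>g x - g y\<bar> / (c * (c / 2))"
      using c 2 by (intro divide_left_mono mult_left_mono) auto
    also have "\<dots> < t / (c * (c / 2))"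
      using c 1 by (intro divide_strict_right_mono) auto
    also have "\<dots> \<le> (s * (c * c / 2)) / (c * (c / 2))"
      using c by (intro divide_right_mono) (auto simp: t_def)
    also have "\<dots> = s" using c by simp
    finally show ?thesis .
  qed
  with r show "\<exists>r>0. \<forall>y\<in>X. dn n x y < r \<longrightarrow> \<bar>inverse (g x) - inverse (g y)\<bar> < s" by blast
qed

lemma scont_divide:
  assumes "scont_on n X g" "scont_on n X h" "\<And>x. x \<in> X \<Longrightarrow> h x \<noteq> 0"
  shows "scont_on n X (\<lambda>x. g x / h x)"
  unfolding divide_inverse by (intro scont_mult scont_inverse assms)

lemma scont_nth:
  assumes "cont_on m n X f" "i < n" shows "scont_on m X (\<lambda>x. f x i)"
  unfolding scont_on_def
proof (intro ballI allI impI)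
  fix x and s :: 'a assume "x \<in> X" "s > 0"
  then obtain r where "r > 0" "\<And>y. y \<in> X \<Longrightarrow> dn m x y < r \<Longrightarrow> dn n (f x) (f y) < s"
    using cont_onD[OF assms(1)] by blast
  then show "\<exists>r>0. \<forall>y\<in>X. dn m x y < r \<longrightarrow> \<bar>f x i - f y i\<bar> < s"
    using le_less_trans[OF dn_coord[OF assms(2)]] by blast
qed

lemma cont_coordI:
  assumes "\<And>i. i < n \<Longrightarrow> scont_on m X (\<lambda>x. f x i)" shows "cont_on m n X f"
  unfolding cont_on_def
proof (intro ballI allI impI)
  fix x and s :: 'a assume x: "x \<in> X" and s: "s > 0"
  have "\<exists>r>0. \<forall>y\<in>X. dn m x y < r \<longrightarrow> (\<forall>i<j. \<bar>f x i - f y i\<bar> < s / of_nat (Suc n))" if "j \<le> n" for j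
    using that
  proof (induction j)
    case 0
    then show ?case by (auto intro: exI[of _ 1])
  next
    case (Suc j)
    then obtain r where r: "r > 0" "\<forall>y\<in>X. dn m x y < r \<longrightarrow> (\<forall>i<j. \<bar>f x i - f y i\<bar> < s / of_nat (Suc n))"
      by auto
    have "s / of_nat (Suc n) > 0" using s by (intro divide_pos_pos) (simp_all only: of_nat_0_less_iff)
    then obtain q where q: "q > 0" "\<And>y. y \<in> X \<Longrightarrow> dn m x y < q \<Longrightarrow> \<bar>f x j - f y j\<bar> < s / of_nat (Suc n)"
      using scont_onD[OF assms[of j] x] Suc.prems by auto
    show ?case using r q by (intro exI[of _ "min q r"]) (auto simp: less_Suc_eq)
  qed
  then obtain r where "r > 0" "\<forall>y\<in>X. dn m x y < r \<longrightarrow> (\<forall>i<n. \<bar>f x i - f y i\<bar> < s / of_nat (Suc n))" by blast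
  then show "\<exists>r>0. \<forall>y\<in>X. dn m x y < r \<longrightarrow> dn n (f x) (f y) < s"
    using dn_bound[OF _ s] by blast
qed

lemma cont_comp:
  assumes "cont_on m n X f" "cont_on n k Y g" "f ` X \<subseteq> Y"
  shows "cont_on m k X (\<lambda>x. g (f x))"
  unfolding cont_on_def
proof (intro ballI allI impI)
  fix x and s :: 'a assume x: "x \<in> X" and s: "s > 0"
  obtain r where r: "r > 0" "\<And>y. y \<in> Y \<Longrightarrow> dn n (f x) y < r \<Longrightarrow> dn k (g (f x)) (g y) < s"
    using cont_onD[OF assms(2) _ s, of "f x"] x assms(3) by blast
  obtain q where "q > 0" "\<And>y. y \<in> X \<Longrightarrow> dn m x y < q \<Longrightarrow> dn n (f x) (f y) < r"
    using cont_onD[OF assms(1) x r(1)] by blast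
  with r assms(3) show "\<exists>r>0. \<forall>y\<in>X. dn m x y < r \<longrightarrow> dn k (g (f x)) (g (f y)) < s" by blast
qed

text \<open>If \<open>h\<close> were unbounded, the points with \<open>1 \<le> s * |h x|\<close>
  would accumulate at some \<open>p\<close> of \<open>C\<close> as \<open>s\<close> tends to 0,
  although \<open>h\<close> differs from \<open>h p\<close> by less than 1 near
  \<open>p\<close>.\<close>

lemma scont_bounded:
  fixes M :: "('a::{linordered_field, linorder_topology}, 'f, 'r) expansion"
  assumes M: "definably_complete M" and C: "definably_compact M n C" and h: "dsfun M n h" "scont_on n C h"
  shows "\<exists>B. \<forall>x\<in>C. \<bar>h x\<bar> \<le> B"
proof (rule ccontr)
  assume "\<nexists>B. \<forall>x\<in>C. \<bar>h x\<bar> \<le> B"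
  then have unb: "\<exists>x\<in>C. B < \<bar>h x\<bar>" for B by (meson not_le)
  have "\<exists>p\<in>C. \<forall>s>0. \<exists>x\<in>C. 1 \<le> s * \<bar>h x\<bar> \<and> dn n x p < s"
  proof (rule definably_compact_limit_point[OF M C])
    show "dpred M (\<lambda>e. 1 \<le> e 0 * \<bar>h (\<lambda>i\<in>{..<n}. e (Suc i))\<bar>)"
      by (intro dpred_le dscal_mult dscal_const dscal_abs dscal_var dsfun_dscal[OF h(1)] dvect_var)
    show "\<exists>x\<in>C. 1 \<le> s * \<bar>h x\<bar>" if "s > 0" for s
    proof -
      obtain x where "x \<in> C" "1 / s < \<bar>h x\<bar>" using unb by blast
      with that show ?thesis by (auto simp: field_simps intro!: bexI[of _ x])
    qed
    show "1 \<le> t * \<bar>h x\<bar>" if "1 \<le> s * \<bar>h x\<bar>" "s \<le> t" for s t x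
      using that by (meson abs_ge_zero mult_right_mono order_trans)
  qed
  then obtain p where p: "p \<in> C" "\<And>s. s > 0 \<Longrightarrow> \<exists>x\<in>C. 1 \<le> s * \<bar>h x\<bar> \<and> dn n x p < s" by blast
  obtain r where r: "r > 0" "\<And>y. y \<in> C \<Longrightarrow> dn n p y < r \<Longrightarrow> \<bar>h p - h y\<bar> < 1"
    using scont_onD[OF h(2) p(1), of 1] by auto
  define s where "s = min r (1 / (\<bar>h p\<bar> + 2))"
  have pos: "\<bar>h p\<bar> + 2 > 0" by linarith
  then have "s > 0" using r(1) by (simp add: s_def)
  then obtain x where x: "x \<in> C" "1 \<le> s * \<bar>h x\<bar>" "dn n x p < s" using p(2) by blast
  then have "\<bar>h p - h x\<bar> < 1" using r(2) by (simp add: dn_sym s_def)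
  then have "\<bar>h x\<bar> < \<bar>h p\<bar> + 2" by linarith
  then have "s * \<bar>h x\<bar> < s * (\<bar>h p\<bar> + 2)" using \<open>s > 0\<close> by simp
  also have "\<dots> \<le> 1 / (\<bar>h p\<bar> + 2) * (\<bar>h p\<bar> + 2)"
    using pos by (intro mult_right_mono) (auto simp: s_def)
  also have "\<dots> = 1" using pos by simp
  finally show False using x(2) by simp
qed

section \<open>Extension of a continuous map along a locally compact relation\<close>

text \<open>Suppose \<open>G y\<close> stays far from \<open>G x0\<close> for points
  \<open>y\<close> arbitrarily near \<open>x0\<close>, and take \<open>a\<close> with
  \<open>(y, a) \<in> R\<close>. By \<open>loc\<close> the pairs stay in a definably compact part of
  \<open>R\<close> and accumulate at some \<open>(x0, q) \<in> R\<close>. Then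
  \<open>G x0 = g q\<close>, while continuity of \<open>g\<close> brings \<open>g a\<close> close to
  \<open>g q\<close>. The role of \<open>loc\<close> is to prevent the second entries from
  escaping.\<close>

lemma extend_along_relation:
  fixes M :: "('a::{linordered_field, linorder_topology}, 'f, 'r) expansion"
  assumes M: "definably_complete M"
    and R: "R \<subseteq> Fn n \<times> Fn l" and dR: "definable M (n + l) (flat n l R)"
    and g: "dfun M l k g" "cont_on l k (Range R) g"
    and inv: "\<And>x a b. (x, a) \<in> R \<Longrightarrow> (x, b) \<in> R \<Longrightarrow> g a = g b"
    and loc: "\<And>x. x \<in> Domain R \<Longrightarrow> \<exists>r>0. \<exists>C\<subseteq>R. definably_compact M (n + l) (flat n l C) \<and>
      (\<forall>y a. (y, a) \<in> R \<and> dn n x y < r \<longrightarrow> (y, a) \<in> C)"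
  obtains G where "dfun M n k G" "cont_on n k (Domain R) G" "\<And>x a. (x, a) \<in> R \<Longrightarrow> G x = g a"
proof -
  define G where "G x = (if x \<in> Domain R then g (SOME a. (x, a) \<in> R) else (\<lambda>i\<in>{..<k}. 0))" for x
  have GR: "G x = g a" if "(x, a) \<in> R" for x a
  proof -
    have "(x, SOME a. (x, a) \<in> R) \<in> R" using someI[of "\<lambda>a. (x, a) \<in> R", OF that] .
    from inv[OF this that] show ?thesis using DomainI[OF that] by (simp add: G_def)
  qed
  have dG: "dfun M n k G"
  proof (rule dfunI)
    show "G x \<in> Fn k" if "x \<in> Fn n" for x
    proof (cases "x \<in> Domain R")
      case True
      then obtain a where "(x, a) \<in> R" by blast
      then show ?thesis using GR R dfun_Fn[OF g(1)] by auto
    qed (simp add: G_def Fn_restrict)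
    show "dpred M (\<lambda>e. e n = G (\<lambda>i\<in>{..<n}. e i) i)" if i: "i < k" for i
    proof -
      \<comment> \<open>The choice operator has no formula, but by \<open>inv\<close> all choices
        give the same value, so an existential quantifier describes the graph.\<close>
      have "dpred M (\<lambda>e. (\<exists>a\<in>Fn l. ((\<lambda>i\<in>{..<n}. e i), a) \<in> R \<and> e n = g a i) \<or>
         (\<not> (\<exists>a\<in>Fn l. ((\<lambda>i\<in>{..<n}. e i), a) \<in> R) \<and> e n = 0))"
        by (intro dpred_disj dpred_conj dpred_not dvect_var dpred_bex[OF definable_Fn]
          dpred_pair[OF dR R] dpred_eq dscal_var dscal_const dsfun_dscal[OF dsfun_nth[OF g(1) i]])
      then show ?thesis
      proof (rule back_subst[of "dpred M"], intro ext)
        fix e :: "nat \<Rightarrow> 'a"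
        let ?x = "\<lambda>i\<in>{..<n}. e i"
        show "((\<exists>a\<in>Fn l. (?x, a) \<in> R \<and> e n = g a i) \<or> (\<not> (\<exists>a\<in>Fn l. (?x, a) \<in> R) \<and> e n = 0))
          = (e n = G ?x i)"
        proof (cases "?x \<in> Domain R")
          case True
          then obtain a where a: "(?x, a) \<in> R" by blast
          with R have "a \<in> Fn l" by auto
          have "e n = g b i \<longleftrightarrow> e n = G ?x i" if "(?x, b) \<in> R" for b using GR[OF that] by simp
          with a \<open>a \<in> Fn l\<close> show ?thesis by blast
        next
          case False
          then show ?thesis using i by (auto simp: G_def)
        qed
      qed
    qed
  qed
  have "cont_on n k (Domain R) G"
    unfolding cont_on_def
  proof (intro ballI allI impI, rule ccontr)
    fix x0 and s :: 'a assume x0: "x0 \<in> Domain R" and s: "s > 0"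
    assume "\<not> (\<exists>r>0. \<forall>y\<in>Domain R. dn n x0 y < r \<longrightarrow> dn k (G x0) (G y) < s)"
    then have bad: "\<exists>y\<in>Domain R. dn n x0 y < r \<and> s \<le> dn k (G x0) (G y)" if "r > 0" for r
      using that by (meson not_le)
    obtain r C where r: "r > 0" and C: "C \<subseteq> R" "definably_compact M (n + l) (flat n l C)"
      "\<And>y a. (y, a) \<in> R \<Longrightarrow> dn n x0 y < r \<Longrightarrow> (y, a) \<in> C" using loc[OF x0] by blast
    have xF: "x0 \<in> Fn n" using x0 R by auto
    define P where "P t y a \<longleftrightarrow> dn n x0 y < t \<and> s \<le> dn k (G x0) (g a)" for t y a
    have "\<exists>(p, q)\<in>C. \<forall>t>0. \<exists>(y, a)\<in>C. P t y a \<and> dn n y p < t \<and> dn l a q < t"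
    proof (rule definably_compact_limit_pair[OF M C(2)])
      show "C \<subseteq> Fn n \<times> Fn l" using C(1) R by blast
      show "dpred M (\<lambda>e. P (e 0) (\<lambda>i\<in>{..<n}. e (Suc i)) (\<lambda>i\<in>{..<l}. e (Suc (n + i))))"
        unfolding P_def using xF dfun_Fn[OF dG xF]
        by (intro dpred_conj dpred_less dpred_le dscal_dn dvect_const dvect_var dfun_dvect[OF g(1)]
            dscal_var dscal_const)
      show "\<exists>(y, a)\<in>C. P t y a" if "t > 0" for t
      proof -
        have "0 < min r t" using r that by simp
        from bad[OF this] obtain y where y: "y \<in> Domain R" "dn n x0 y < min r t" "s \<le> dn k (G x0) (G y)"
          by blast
        then obtain a where a: "(y, a) \<in> R" by blast
        with y C(3)[OF a] GR[OF a] show ?thesis unfolding P_def by auto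
      qed
      show "\<And>s t x y. P s x y \<Longrightarrow> s \<le> t \<Longrightarrow> P t x y" unfolding P_def by auto
    qed
    then obtain p q where pq: "(p, q) \<in> C"
      "\<And>t. t > 0 \<Longrightarrow> \<exists>(y, a)\<in>C. P t y a \<and> dn n y p < t \<and> dn l a q < t" by blast
    \<comment> \<open>The condition in \<open>P\<close> draws the first entries to
      \<open>x0\<close>, so their limit \<open>p\<close> is \<open>x0\<close>.\<close>
    have "dn n x0 p \<le> 0"
    proof (rule ccontr)
      assume "\<not> dn n x0 p \<le> 0"
      then obtain y a where "dn n x0 y < dn n x0 p / 2" "dn n y p < dn n x0 p / 2"
        using pq(2)[of "dn n x0 p / 2"] unfolding P_def by auto
      with dn_tri[of n x0 p y] show False by linarith
    qed
    then have p: "x0 = p" using dn_eq_0[OF xF] pq(1) C(1) R by blast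
    then have Gq: "G x0 = g q" using GR pq(1) C(1) by blast
    obtain t where t: "t > 0" "\<And>a. a \<in> Range R \<Longrightarrow> dn l q a < t \<Longrightarrow> dn k (g q) (g a) < s"
      using cont_onD[OF g(2) _ s, of q] pq(1) C(1) by blast
    obtain y a where "(y, a) \<in> C" "P t y a" "dn l a q < t" using pq(2)[OF t(1)] by blast
    then show False using t(2)[of a] C(1) Gq unfolding P_def by (auto simp: dn_sym)
  qed
  from that[OF dG this GR] show ?thesis .
qed

section \<open>Definable infima and the extension of continuous functions\<close>

text \<open>\<open>F\<close> is only definably complete, so this denotes an infimum just for
  definable families that are nonempty and bounded below, as assumed in the context that
  follows.\<close>

definition inf_over :: "'b set \<Rightarrow> ('c \<Rightarrow> 'b \<Rightarrow> 'a::linordered_field) \<Rightarrow> 'c \<Rightarrow> 'a" where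
  "inf_over B \<phi> x = (THE s. (\<forall>b\<in>B. s \<le> \<phi> x b) \<and> (\<forall>u. (\<forall>b\<in>B. u \<le> \<phi> x b) \<longrightarrow> u \<le> s))"

context
  fixes M :: "('a::linordered_field, 'f, 'r) expansion" and B :: "(nat \<Rightarrow> 'a) set"
    and \<phi> :: "(nat \<Rightarrow> 'a) \<Rightarrow> (nat \<Rightarrow> 'a) \<Rightarrow> 'a" and n l :: nat
  assumes M: "definably_complete M" and B: "definable M l B" "B \<noteq> {}"
    and \<phi>: "\<And>x b. dvect M n x \<Longrightarrow> dvect M l b \<Longrightarrow> dscal M (\<lambda>e. \<phi> (x e) (b e))"
    and nonneg: "\<And>x b. x \<in> Fn n \<Longrightarrow> b \<in> B \<Longrightarrow> 0 \<le> \<phi> x b"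
begin

lemma inf_over_glb:
  assumes x: "x \<in> Fn n"
  shows "(\<forall>b\<in>B. inf_over B \<phi> x \<le> \<phi> x b) \<and> (\<forall>u. (\<forall>b\<in>B. u \<le> \<phi> x b) \<longrightarrow> u \<le> inf_over B \<phi> x)"
proof -
  obtain b0 where b0: "b0 \<in> B" using B(2) by blast
  define A where "A = \<phi> x ` B"
  have dA: "dpred M (\<lambda>e. e 0 \<in> A)"
    unfolding A_def image_iff
    by (intro dpred_bex[OF B(1)] dpred_eq dscal_var \<phi> dvect_const dvect_var x)
  have "\<exists>s. (\<forall>a. a \<in> A \<longrightarrow> s \<le> a) \<and> (\<forall>u. (\<forall>a. a \<in> A \<longrightarrow> u \<le> a) \<longrightarrow> u \<le> s)"
  proof (rule definable_glb[OF M dA])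
    show "\<phi> x b0 \<in> A" using b0 by (simp add: A_def)
    show "\<And>a. a \<in> A \<Longrightarrow> 0 \<le> a" using nonneg[OF x] by (auto simp: A_def)
  qed
  then obtain s where s: "(\<forall>b\<in>B. s \<le> \<phi> x b) \<and> (\<forall>u. (\<forall>b\<in>B. u \<le> \<phi> x b) \<longrightarrow> u \<le> s)"
    unfolding A_def by (simp only: Ball_def[symmetric] ball_simps) (elim exE, simp)
  then show ?thesis
    unfolding inf_over_def
  proof (rule theI)
    fix s'
    assume s': "(\<forall>b\<in>B. s' \<le> \<phi> x b) \<and> (\<forall>u. (\<forall>b\<in>B. u \<le> \<phi> x b) \<longrightarrow> u \<le> s')"
    show "s' = s" by (rule order_antisym) (use s s' in blast)+
  qed
qed

lemma inf_over_lower: "x \<in> Fn n \<Longrightarrow> b \<in> B \<Longrightarrow> inf_over B \<phi> x \<le> \<phi> x b"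
  using inf_over_glb by blast

lemma inf_over_greatest: "x \<in> Fn n \<Longrightarrow> (\<And>b. b \<in> B \<Longrightarrow> u \<le> \<phi> x b) \<Longrightarrow> u \<le> inf_over B \<phi> x"
  using inf_over_glb by blast

lemma inf_over_approx:
  assumes "x \<in> Fn n" "s > 0" obtains b where "b \<in> B" "\<phi> x b < inf_over B \<phi> x + s"
proof -
  have "\<not> inf_over B \<phi> x + s \<le> inf_over B \<phi> x" using assms(2) by simp
  then show ?thesis using inf_over_greatest[OF assms(1), of "inf_over B \<phi> x + s"] that
    by (meson not_le)
qed

lemma inf_over_nonneg: "x \<in> Fn n \<Longrightarrow> 0 \<le> inf_over B \<phi> x"
  using inf_over_greatest nonneg by blast

lemma dsfun_inf_over: "dsfun M n (inf_over B \<phi>)"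
proof (rule dsfunI)
  have "dpred M (\<lambda>e. (\<forall>b\<in>B. e n \<le> \<phi> (\<lambda>i\<in>{..<n}. e i) b) \<and>
     (\<forall>u. (\<forall>b\<in>B. u \<le> \<phi> (\<lambda>i\<in>{..<n}. e i) b) \<longrightarrow> u \<le> e n))"
    by (intro dpred_conj dpred_all dpred_imp dpred_ball[OF B(1)] dpred_le dscal_var \<phi> dvect_var)
  then show "dpred M (\<lambda>e. e n = inf_over B \<phi> (\<lambda>i\<in>{..<n}. e i))"
  proof (rule back_subst[of "dpred M"], intro ext iffI)
    fix e :: "nat \<Rightarrow> 'a"
    note * = inf_over_glb[OF Fn_restrict[of e n]]
    show "e n = inf_over B \<phi> (\<lambda>i\<in>{..<n}. e i)"
      if "(\<forall>b\<in>B. e n \<le> \<phi> (\<lambda>i\<in>{..<n}. e i) b) \<and>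
        (\<forall>u. (\<forall>b\<in>B. u \<le> \<phi> (\<lambda>i\<in>{..<n}. e i) b) \<longrightarrow> u \<le> e n)"
      by (rule order_antisym) (use * that in blast)+
    show "(\<forall>b\<in>B. e n \<le> \<phi> (\<lambda>i\<in>{..<n}. e i) b) \<and>
        (\<forall>u. (\<forall>b\<in>B. u \<le> \<phi> (\<lambda>i\<in>{..<n}. e i) b) \<longrightarrow> u \<le> e n)"
      if "e n = inf_over B \<phi> (\<lambda>i\<in>{..<n}. e i)"
      unfolding that by (rule *)
  qed
qed

lemma inf_over_lipschitz:
  assumes x: "x \<in> Fn n" and y: "y \<in> Fn n" and c: "\<And>b. b \<in> B \<Longrightarrow> \<bar>\<phi> x b - \<phi> y b\<bar> \<le> c"
  shows "\<bar>inf_over B \<phi> x - inf_over B \<phi> y\<bar> \<le> c"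
proof -
  have "inf_over B \<phi> x - c \<le> inf_over B \<phi> y"
  proof (rule inf_over_greatest[OF y])
    fix b assume "b \<in> B"
    with inf_over_lower[OF x this] c[OF this] show "inf_over B \<phi> x - c \<le> \<phi> y b" by linarith
  qed
  moreover have "inf_over B \<phi> y - c \<le> inf_over B \<phi> x"
  proof (rule inf_over_greatest[OF x])
    fix b assume "b \<in> B"
    with inf_over_lower[OF y this] c[OF this] show "inf_over B \<phi> y - c \<le> \<phi> x b" by linarith
  qed
  ultimately show ?thesis by (simp add: abs_le_iff algebra_simps)
qed

end

section \<open>Distance to a definable set and Tietze extension\<close>

context
  fixes M :: "('a::linordered_field, 'f, 'r) expansion" and B :: "(nat \<Rightarrow> 'a) set" and n :: nat
  assumes M: "definably_complete M" and B: "definable M n B" "B \<noteq> {}"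
begin

lemma dist_set_lower: "x \<in> Fn n \<Longrightarrow> b \<in> B \<Longrightarrow> inf_over B (dn n) x \<le> dn n x b"
  by (rule inf_over_lower[OF M B]) (auto intro: dscal_dn)

lemma dist_set_approx:
  assumes "x \<in> Fn n" "s > 0" obtains b where "b \<in> B" "dn n x b < inf_over B (dn n) x + s"
  by (rule inf_over_approx[OF M B, of n "dn n" x s]) (use assms in \<open>auto intro: dscal_dn\<close>)

lemma dist_set_nonneg: "x \<in> Fn n \<Longrightarrow> 0 \<le> inf_over B (dn n) x"
  by (rule inf_over_nonneg[OF M B]) (auto intro: dscal_dn)

lemma dsfun_dist_set: "dsfun M n (inf_over B (dn n))"
  by (rule dsfun_inf_over[OF M B]) (auto intro: dscal_dn)

lemma dist_set_lipschitz:
  assumes "x \<in> Fn n" "y \<in> Fn n"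
  shows "\<bar>inf_over B (dn n) x - inf_over B (dn n) y\<bar> \<le> dn n x y"
proof (rule inf_over_lipschitz[OF M B _ _ assms])
  fix b
  show "\<bar>dn n x b - dn n y b\<bar> \<le> dn n x y"
    using dn_tri[of n x b y] dn_tri[of n y b x] dn_sym[of n x y] by (simp add: abs_le_iff)
qed (auto intro: dscal_dn)

lemma dist_set_eq_0:
  assumes clo: "\<And>x. x \<in> Fn n \<Longrightarrow> (\<And>s. s > 0 \<Longrightarrow> \<exists>y\<in>B. dn n x y < s) \<Longrightarrow> x \<in> B"
    and x: "x \<in> Fn n"
  shows "inf_over B (dn n) x = 0 \<longleftrightarrow> x \<in> B"
proof
  assume 0: "inf_over B (dn n) x = 0"
  show "x \<in> B"
  proof (rule clo[OF x])
    fix s :: 'a assume "s > 0"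
    from dist_set_approx[OF x this] 0 show "\<exists>y\<in>B. dn n x y < s" by auto
  qed
next
  assume "x \<in> B"
  from dist_set_lower[OF x this] dist_set_nonneg[OF x] show "inf_over B (dn n) x = 0" by simp
qed

text \<open>
  Tietze extension by Hausdorff's formula \<open>G x = inf\<^sub>b (g b + 2 c d(x, b) / d(x, B)) - 2 c\<close>. Multiplied
  by \<open>d(x, B)\<close>, the infimum is Lipschitz in \<open>x\<close>.
\<close>

lemma tietze:
  assumes clo: "\<And>x. x \<in> Fn n \<Longrightarrow> (\<And>s. s > 0 \<Longrightarrow> \<exists>y\<in>B. dn n x y < s) \<Longrightarrow> x \<in> B"
    and g: "dsfun M n g" "scont_on n B g" and gc: "\<And>b. b \<in> B \<Longrightarrow> \<bar>g b\<bar> \<le> c" and c: "c > 0"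
  obtains G where "dsfun M n G" "scont_on n (Fn n) G" "\<And>b. b \<in> B \<Longrightarrow> G b = g b"
proof -
  define \<delta> where "\<delta> = inf_over B (dn n)"
  \<comment> \<open>Since \<open>|g b| \<le> c\<close> and \<open>dn n x b \<ge> \<delta> x\<close>,
    the weight \<open>2 * c\<close> makes \<open>\<phi>\<close> nonnegative. Its infimum thus exists
    without a division by \<open>\<delta> x\<close>, which vanishes on \<open>B\<close>.\<close>
  define \<phi> where "\<phi> x b = \<delta> x * g b + 2 * c * dn n x b" for x b
  define N where "N = inf_over B \<phi>"
  define G where "G x = (if x \<in> B then g x else N x / \<delta> x - 2 * c)" for x
  note BF = definable_subset[OF B(1)]
  have \<delta>_low: "\<delta> x \<le> dn n x b" if "x \<in> Fn n" "b \<in> B" for x b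
    unfolding \<delta>_def by (rule dist_set_lower[OF that])
  have \<delta>_nn: "0 \<le> \<delta> x" if "x \<in> Fn n" for x unfolding \<delta>_def by (rule dist_set_nonneg[OF that])
  have \<delta>_pos: "0 < \<delta> x" if "x \<in> Fn n" "x \<notin> B" for x
    using \<delta>_nn[OF that(1)] dist_set_eq_0[OF clo that(1)] that(2) unfolding \<delta>_def by (simp add: less_le)
  have \<delta>_lip: "\<bar>\<delta> x - \<delta> y\<bar> \<le> dn n x y" if "x \<in> Fn n" "y \<in> Fn n" for x y
    unfolding \<delta>_def by (rule dist_set_lipschitz[OF that])
  have d\<delta>: "dsfun M n \<delta>" unfolding \<delta>_def by (rule dsfun_dist_set)
  have gl: "- c \<le> g b" "g b \<le> c" if "b \<in> B" for b using gc[OF that] by linarith+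
  have d\<phi>: "dscal M (\<lambda>e. \<phi> (x e) (b e))" if "dvect M n x" "dvect M n b" for x b
    unfolding \<phi>_def using that
    by (intro dscal_add dscal_mult dscal_const dscal_dn dsfun_dscal[OF d\<delta>] dsfun_dscal[OF g(1)])
  have \<phi>_nn: "0 \<le> \<phi> x b" if x: "x \<in> Fn n" and b: "b \<in> B" for x b
  proof -
    have "\<delta> x * (- c) \<le> \<delta> x * g b" using gl[OF b] \<delta>_nn[OF x] by (intro mult_left_mono) auto
    moreover have "2 * c * \<delta> x \<le> 2 * c * dn n x b" using \<delta>_low[OF x b] c by (intro mult_left_mono) auto
    moreover have "0 \<le> c * \<delta> x" using c \<delta>_nn[OF x] by simp
    ultimately show ?thesis unfolding \<phi>_def by (simp add: algebra_simps)
  qed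
  have N_low: "N x \<le> \<phi> x b" if "x \<in> Fn n" "b \<in> B" for x b
    unfolding N_def by (rule inf_over_lower[where \<phi> = \<phi>, OF M B d\<phi> \<phi>_nn that])
  have N_great: "u \<le> N x" if "x \<in> Fn n" "\<And>b. b \<in> B \<Longrightarrow> u \<le> \<phi> x b" for u x
    unfolding N_def by (rule inf_over_greatest[where \<phi> = \<phi> and x = x, OF M B d\<phi> \<phi>_nn that])
  have dN: "dsfun M n N" unfolding N_def by (rule dsfun_inf_over[OF M B d\<phi> \<phi>_nn])
  have N_lip: "\<bar>N x - N y\<bar> \<le> 3 * c * dn n x y" if xy: "x \<in> Fn n" "y \<in> Fn n" for x y
    unfolding N_def
  proof (rule inf_over_lipschitz[OF M B d\<phi> \<phi>_nn xy])
    fix b assume b: "b \<in> B"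
    have "\<bar>\<phi> x b - \<phi> y b\<bar> = \<bar>(\<delta> x - \<delta> y) * g b + 2 * c * (dn n x b - dn n y b)\<bar>"
      by (simp add: \<phi>_def algebra_simps)
    also have "\<dots> \<le> \<bar>(\<delta> x - \<delta> y) * g b\<bar> + \<bar>2 * c * (dn n x b - dn n y b)\<bar>" by (rule abs_triangle_ineq)
    also have "\<dots> = \<bar>\<delta> x - \<delta> y\<bar> * \<bar>g b\<bar> + 2 * c * \<bar>dn n x b - dn n y b\<bar>" using c by (simp add: abs_mult)
    also have "\<dots> \<le> dn n x y * c + 2 * c * dn n x y"
    proof (intro add_mono mult_mono mult_left_mono \<delta>_lip xy gc b)
      show "\<bar>dn n x b - dn n y b\<bar> \<le> dn n x y"
        using dn_tri[of n x b y] dn_tri[of n y b x] dn_sym[of n x y] by (simp add: abs_le_iff)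
    qed (use c in auto)
    also have "\<dots> = 3 * c * dn n x y" by simp
    finally show "\<bar>\<phi> x b - \<phi> y b\<bar> \<le> 3 * c * dn n x y" .
  qed
  have dG: "dsfun M n G"
    unfolding G_def by (intro dsfun_if B g dsfun_ops dN d\<delta> dsfun_const)
  have "scont_on n (Fn n - B) (\<lambda>x. N x / \<delta> x - 2 * c)"
  proof (intro scont_diff scont_divide scont_const)
    show "scont_on n (Fn n - B) N" by (rule scont_lipschitz[where L = "3 * c"]) (use N_lip in auto)
    show "scont_on n (Fn n - B) \<delta>" by (rule scont_lipschitz[where L = 1]) (use \<delta>_lip in auto)
    show "\<And>x. x \<in> Fn n - B \<Longrightarrow> \<delta> x \<noteq> 0" using \<delta>_pos by force
  qed
  then have off: "scont_on n (Fn n - B) G" by (rule scont_cong) (simp add: G_def)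
  have "scont_on n (Fn n) G"
    unfolding scont_on_def
  proof (intro ballI allI impI)
    fix x :: "nat \<Rightarrow> 'a" and s :: 'a assume x: "x \<in> Fn n" and s: "s > 0"
    show "\<exists>r>0. \<forall>y\<in>Fn n. dn n x y < r \<longrightarrow> \<bar>G x - G y\<bar> < s"
    proof (cases "x \<in> B")
      case False
      then obtain r where r: "r > 0" "\<And>y. y \<in> Fn n - B \<Longrightarrow> dn n x y < r \<Longrightarrow> \<bar>G x - G y\<bar> < s"
        using scont_onD[OF off _ s, of x] x by blast
      show ?thesis
      proof (intro exI conjI ballI impI)
        show "min r (\<delta> x) > 0" using r \<delta>_pos[OF x False] by simp
        fix y assume y: "y \<in> Fn n" "dn n x y < min r (\<delta> x)"
        then have "y \<notin> B" using \<delta>_low[OF x, of y] by auto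
        with y r(2) show "\<bar>G x - G y\<bar> < s" by auto
      qed
    next
      case True
      obtain r where r: "r > 0" "\<And>y. y \<in> B \<Longrightarrow> dn n x y < r \<Longrightarrow> \<bar>g x - g y\<bar> < s / 2"
        using scont_onD[OF g(2) True, of "s / 2"] s by auto
      show ?thesis
      proof (intro exI conjI ballI impI)
        \<comment> \<open>As \<open>x \<in> B\<close>, also \<open>\<delta> y < r / 3\<close>;
          points of \<open>B\<close> within \<open>2 * \<delta> y\<close> of \<open>y\<close> are
          then within \<open>r\<close> of \<open>x\<close>.\<close>
        show "r / 3 > 0" using r by simp
        fix y assume y: "y \<in> Fn n" "dn n x y < r / 3"
        show "\<bar>G x - G y\<bar> < s"
        proof (cases "y \<in> B")
          case yB: True
          have "dn n x y < r" using y(2) r(1) by linarith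
          with r(2)[OF yB] yB True s show ?thesis unfolding G_def by auto
        next
          case yB: False
          define d where "d = \<delta> y"
          have d: "d > 0" unfolding d_def by (rule \<delta>_pos[OF y(1) yB])
          have "d \<le> dn n y x" unfolding d_def by (rule \<delta>_low[OF y(1) True])
          then have d3: "d < r / 3" using y(2) by (simp add: dn_sym)
          have near: "\<bar>g x - g b\<bar> < s / 2" if "b \<in> B" "dn n y b < 2 * d" for b
          proof (rule r(2)[OF that(1)])
            show "dn n x b < r" using dn_tri[of n x b y] that(2) d3 y(2) by linarith
          qed
          have low: "d * (g x - s / 2 + 2 * c) \<le> N y"
          proof (rule N_great)
            fix b assume b: "b \<in> B"
            show "d * (g x - s / 2 + 2 * c) \<le> \<phi> y b"
            proof (cases "dn n y b < 2 * d")
              case lt: True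
              have "d * (g x - s / 2) \<le> d * g b"
                using near[OF b lt] d by (intro mult_left_mono) linarith+
              moreover have "2 * c * d \<le> 2 * c * dn n y b"
                using \<delta>_low[OF y(1) b] c by (intro mult_left_mono) (auto simp: d_def)
              ultimately show ?thesis unfolding \<phi>_def d_def[symmetric] by (simp add: algebra_simps)
            next
              case ge: False
              \<comment> \<open>A far point pays at least \<open>4 * c * d\<close> for its distance,
                enough to offset \<open>g b \<ge> - c\<close> against
                \<open>g x \<le> c\<close>.\<close>
              have "d * (g x - s / 2 + 2 * c) \<le> d * (g b + 4 * c)"
                using gl[OF b] gl[OF True] d s c by (intro mult_left_mono) linarith+
              moreover have "2 * c * (2 * d) \<le> 2 * c * dn n y b"
                using ge c by (intro mult_left_mono) auto
              ultimately show ?thesis unfolding \<phi>_def d_def[symmetric] by (simp add: algebra_simps)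
            qed
          qed (use y in auto)
          \<comment> \<open>The first bound keeps \<open>b\<close> within \<open>2 * d\<close> of
            \<open>y\<close>, so that \<open>near\<close> applies; the second makes the error
            \<open>2 * c * t\<close> at most \<open>d * s / 2\<close>.\<close>
          define t where "t = min d (d * s / (4 * c))"
          have t: "t > 0" using d s c by (simp add: t_def)
          obtain b where b: "b \<in> B" "dn n y b < d + t"
            using dist_set_approx[OF y(1) t] unfolding d_def \<delta>_def by blast
          have "t \<le> d" by (simp add: t_def)
          then have b2: "dn n y b < 2 * d" using b(2) by linarith
          have "N y \<le> \<phi> y b" using y(1) b(1) by (intro N_low)
          also have "\<dots> < d * (g x + s / 2) + 2 * c * (d + t)"
            unfolding \<phi>_def d_def[symmetric] using near[OF b(1) b2] d b(2) c
            by (intro add_strict_mono mult_strict_left_mono) linarith+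
          also have "\<dots> \<le> d * (g x + s / 2) + 2 * c * (d + d * s / (4 * c))"
            using c by (intro add_left_mono mult_left_mono) (auto simp: t_def)
          also have "\<dots> = d * (g x + s + 2 * c)" using c by (simp add: field_simps)
          finally have up: "N y < d * (g x + s + 2 * c)" .
          have "g x - s / 2 + 2 * c \<le> N y / d" using low d by (simp add: pos_le_divide_eq mult.commute)
          moreover have "N y / d < g x + s + 2 * c" using up d by (simp add: pos_divide_less_eq mult.commute)
          ultimately have "\<bar>g x - (N y / d - 2 * c)\<bar> < s" using s by (simp add: abs_less_iff)
          then show ?thesis using True yB by (simp add: G_def d_def)
        qed
      qed
    qed
  qed
  with dG show ?thesis by (rule that) (simp add: G_def)
qed

end

text \<open>\<open>f\<close> lists Tietze extensions of the coordinates of \<open>g\<close>, which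
  are bounded as \<open>B\<close> is definably compact, then the distance \<open>\<delta>\<close> to
  \<open>B\<close>, then the products \<open>\<delta> x * x i\<close>. On \<open>B\<close> only the
  first block can be nonzero; off \<open>B\<close> the point \<open>x\<close> is recovered on
  dividing by \<open>\<delta> x\<close>, and \<open>\<delta>\<close> itself separates
  \<open>B\<close> from its complement.\<close>

lemma glue:
  fixes M :: "('a::{linordered_field, linorder_topology}, 'f, 'r) expansion"
  assumes M: "definably_complete M" and B: "definably_compact M n B"
    and g: "dfun M n k g" "cont_on n k B g"
  obtains m f where "dfun M n m f" "cont_on n m (Fn n) f"
    "\<And>x y. x \<in> Fn n \<Longrightarrow> y \<in> Fn n \<Longrightarrow> f x = f y \<longleftrightarrow> x = y \<or> (x \<in> B \<and> y \<in> B \<and> g x = g y)"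
proof (cases "B = {}")
  case True
  \<comment> \<open>The distance to the empty set has no meaning; as nothing is to be collapsed, the
    identity serves.\<close>
  show ?thesis
  proof (rule that[of n "\<lambda>x. x"])
    show "dfun M n n (\<lambda>x. x)" by (simp add: dfun_def)
    show "cont_on n n (Fn n) (\<lambda>x. x)" unfolding cont_on_def by blast
  qed (use True in auto)
next
  case False
  have dB: "definable M n B"
    and clo: "\<And>x. x \<in> Fn n \<Longrightarrow> (\<And>s. s > 0 \<Longrightarrow> \<exists>y\<in>B. dn n x y < s) \<Longrightarrow> x \<in> B"
    using B unfolding definably_compact_iff by blast+
  define \<delta> where "\<delta> = inf_over B (dn n)"
  have "\<exists>G. dsfun M n G \<and> scont_on n (Fn n) G \<and> (\<forall>b\<in>B. G b = g b i)" if i: "i < k" for i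
  proof -
    note gi = dsfun_nth[OF g(1) i] scont_nth[OF g(2) i]
    obtain c where c: "\<And>b. b \<in> B \<Longrightarrow> \<bar>g b i\<bar> \<le> c" using scont_bounded[OF M B gi] by blast
    have "0 < \<bar>c\<bar> + 1" by (simp add: add_nonneg_pos)
    moreover have "\<And>b. b \<in> B \<Longrightarrow> \<bar>g b i\<bar> \<le> \<bar>c\<bar> + 1" using c by fastforce
    ultimately show ?thesis using tietze[OF M dB False clo gi, where c = "\<bar>c\<bar> + 1"] by metis
  qed
  then obtain G where G: "\<And>i. i < k \<Longrightarrow> dsfun M n (G i)" "\<And>i. i < k \<Longrightarrow> scont_on n (Fn n) (G i)"
    "\<And>i b. i < k \<Longrightarrow> b \<in> B \<Longrightarrow> G i b = g b i" by metis
  define t where "t i = (if i < k then G i else if i = k then \<delta> else (\<lambda>x. \<delta> x * x (i - Suc k)))" for i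
  define f where "f x = (\<lambda>i\<in>{..<Suc k + n}. t i x)" for x
  have \<delta>0: "\<delta> x = 0 \<longleftrightarrow> x \<in> B" if "x \<in> Fn n" for x
    unfolding \<delta>_def by (rule dist_set_eq_0[OF M dB False clo that])
  have d\<delta>: "dsfun M n \<delta>" unfolding \<delta>_def by (rule dsfun_dist_set[OF M dB False])
  have c\<delta>: "scont_on n (Fn n) \<delta>"
    unfolding \<delta>_def by (rule scont_lipschitz[where L = 1]) (simp add: dist_set_lipschitz[OF M dB False])
  show ?thesis
  proof (rule that)
    show "dfun M n (Suc k + n) f"
      unfolding f_def
    proof (rule dfun_coordI)
      fix i assume "i < Suc k + n"
      then show "dsfun M n (t i)" unfolding t_def using G(1) d\<delta>
        by (auto intro!: dsfun_ops(3) dsfun_coord)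
    qed
    show "cont_on n (Suc k + n) (Fn n) f"
    proof (rule cont_coordI)
      fix i assume i: "i < Suc k + n"
      then have "scont_on n (Fn n) (t i)" unfolding t_def using G(2) c\<delta>
        by (auto intro!: scont_mult scont_coord)
      then show "scont_on n (Fn n) (\<lambda>x. f x i)" using i by (simp add: f_def)
    qed
    fix x y :: "nat \<Rightarrow> 'a" assume x: "x \<in> Fn n" and y: "y \<in> Fn n"
    have gF: "g x \<in> Fn k" "g y \<in> Fn k" using dfun_Fn[OF g(1)] x y by auto
    show "f x = f y \<longleftrightarrow> x = y \<or> (x \<in> B \<and> y \<in> B \<and> g x = g y)"
    proof
      assume eq: "f x = f y"
      have t: "t i x = t i y" if "i < Suc k + n" for i using fun_cong[OF eq, of i] that by (simp add: f_def)
      have \<delta>: "\<delta> x = \<delta> y" using t[of k] by (simp add: t_def)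
      show "x = y \<or> (x \<in> B \<and> y \<in> B \<and> g x = g y)"
      proof (cases "\<delta> x = 0")
        case True
        then have B': "x \<in> B" "y \<in> B" using \<delta>0[OF x] \<delta>0[OF y] \<delta> by auto
        have "g x = g y"
        proof (rule Fn_eqI[OF gF])
          fix i assume "i < k"
          then show "g x i = g y i" using t[of i] G(3) B' by (simp add: t_def)
        qed
        with B' show ?thesis by blast
      next
        case False
        have "x = y"
        proof (rule Fn_eqI[OF x y])
          fix i assume "i < n"
          then show "x i = y i" using t[of "Suc k + i"] \<delta> False by (simp add: t_def)
        qed
        then show ?thesis ..
      qed
    next
      assume "x = y \<or> (x \<in> B \<and> y \<in> B \<and> g x = g y)"
      then consider "x = y" | "x \<in> B" "y \<in> B" "g x = g y" by blast
      then show "f x = f y"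
      proof cases
        case 2
        then have "\<delta> x = 0" "\<delta> y = 0" using \<delta>0 x y by auto
        then have "t i x = t i y" for i using 2 G(3) by (simp add: t_def)
        then show ?thesis by (simp add: f_def)
      qed simp
    qed
  qed
qed

section \<open>Closed equivalence relations on definably compact sets\<close>

lemma dn_eqI:
  assumes "x \<in> Fn n" "y \<in> Fn n" "\<And>s. s > 0 \<Longrightarrow> \<exists>z. dn n x z < s \<and> dn n z y < s"
  shows "x = y"
proof (rule dn_eq_0[OF assms(1,2)], rule ccontr)
  assume "\<not> dn n x y \<le> 0"
  then obtain z where "dn n x z < dn n x y / 2" "dn n z y < dn n x y / 2"
    using assms(3)[of "dn n x y / 2"] by auto
  with dn_tri[of n x y z] show False by linarith
qed

lemma Fn_splitE:
  assumes "z \<in> Fn (m + l)"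
  obtains x y where "x \<in> Fn m" "y \<in> Fn l" "z = concat_vec m l x y"
proof (rule that[of "\<lambda>i\<in>{..<m}. z i" "\<lambda>i\<in>{..<l}. z (m + i)"])
  show "z = concat_vec m l (\<lambda>i\<in>{..<m}. z i) (\<lambda>i\<in>{..<l}. z (m + i))"
    by (rule Fn_eqI[OF assms concat_vec_Fn]) (auto simp: concat_vec_def)
qed (rule Fn_restrict)+

lemma compact_subset:
  fixes M :: "('a::{linordered_field, linorder_topology}, 'f, 'r) expansion"
  assumes C: "definably_compact M n C" and D: "definable M n D" "D \<subseteq> C"
    and clo: "\<And>x. x \<in> C \<Longrightarrow> (\<And>s. s > 0 \<Longrightarrow> \<exists>y\<in>D. dn n x y < s) \<Longrightarrow> x \<in> D"
  shows "definably_compact M n D"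
  unfolding definably_compact_iff
proof (intro conjI ballI impI)
  obtain B where "\<forall>x\<in>C. \<forall>i<n. \<bar>x i\<bar> \<le> B" using C unfolding definably_compact_iff by blast
  then show "\<exists>B. \<forall>x\<in>D. \<forall>i<n. \<bar>x i\<bar> \<le> B" using D(2) by blast
  fix x assume x: "x \<in> Fn n" "\<forall>s>0. \<exists>y\<in>D. dn n x y < s"
  with D(2) have "\<forall>s>0. \<exists>y\<in>C. dn n x y < s" by blast
  with C x(1) have "x \<in> C" unfolding definably_compact_iff by blast
  with clo x(2) show "x \<in> D" by blast
qed (rule D(1))

section \<open>Closed relations between definably compact sets\<close>

definition closed_rel :: "nat \<Rightarrow> nat \<Rightarrow> (nat \<Rightarrow> 'a::linordered_field) set \<Rightarrow> (nat \<Rightarrow> 'a) set \<Rightarrow>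
    ((nat \<Rightarrow> 'a) \<times> (nat \<Rightarrow> 'a)) set \<Rightarrow> bool" where
  "closed_rel m n X Y R \<longleftrightarrow>
    (\<forall>x\<in>X. \<forall>y\<in>Y. (\<forall>s>0. \<exists>(a, b)\<in>R. dn m x a < s \<and> dn n y b < s) \<longrightarrow> (x, y) \<in> R)"

lemma closed_relD:
  "closed_rel m n X Y R \<Longrightarrow> x \<in> X \<Longrightarrow> y \<in> Y \<Longrightarrow>
    (\<And>s. s > 0 \<Longrightarrow> \<exists>(a, b)\<in>R. dn m x a < s \<and> dn n y b < s) \<Longrightarrow> (x, y) \<in> R"
  unfolding closed_rel_def by blast

lemma closed_rel_flat:
  fixes R :: "((nat \<Rightarrow> 'a::{linordered_field, linorder_topology}) \<times> (nat \<Rightarrow> 'a)) set"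
  assumes X: "X \<subseteq> Fn m" and Y: "Y \<subseteq> Fn n" and R: "R \<subseteq> X \<times> Y"
  shows "closedin (top_on (m + n) (flat m n (X \<times> Y))) (flat m n R) \<longleftrightarrow> closed_rel m n X Y R"
proof -
  have XY: "flat m n (X \<times> Y) \<subseteq> Fn (m + n)" using concat_vec_Fn by (auto simp: flat_def)
  have RF: "R \<subseteq> Fn m \<times> Fn n" using R X Y by blast
  have lim: "(\<forall>s>0. \<exists>w\<in>flat m n R. dn (m + n) (concat_vec m n x y) w < s) \<longleftrightarrow>
     (\<forall>s>0. \<exists>(a, b)\<in>R. dn m x a < s \<and> dn n y b < s)" for x y
  proof (intro iffI allI impI)
    fix s :: 'a assume s: "s > 0" and *: "\<forall>s>0. \<exists>w\<in>flat m n R. dn (m + n) (concat_vec m n x y) w < s"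
    then obtain a b where ab: "(a, b) \<in> R" "dn m x a + dn n y b < s"
      by (auto simp: flat_def dn_concat)
    have "dn m x a < s" "dn n y b < s" using ab(2) dn_nonneg[of m x a] dn_nonneg[of n y b] by linarith+
    with ab(1) show "\<exists>(a, b)\<in>R. dn m x a < s \<and> dn n y b < s" by blast
  next
    fix s :: 'a assume s: "s > 0" and *: "\<forall>s>0. \<exists>(a, b)\<in>R. dn m x a < s \<and> dn n y b < s"
    have "s / 2 > 0" using s by simp
    with * obtain a b where ab: "(a, b) \<in> R" "dn m x a < s / 2" "dn n y b < s / 2" by blast
    then have "dn m x a + dn n y b < s" by linarith
    with ab(1) show "\<exists>w\<in>flat m n R. dn (m + n) (concat_vec m n x y) w < s"
      unfolding flat_def by (intro bexI[of _ "concat_vec m n a b"]) (auto simp: dn_concat intro: rev_image_eqI)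
  qed
  have "closedin (top_on (m + n) (flat m n (X \<times> Y))) (flat m n R) \<longleftrightarrow>
    (\<forall>x\<in>X. \<forall>y\<in>Y. (\<forall>s>0. \<exists>w\<in>flat m n R. dn (m + n) (concat_vec m n x y) w < s) \<longrightarrow>
       concat_vec m n x y \<in> flat m n R)"
    unfolding closedin_top_on[OF XY] using R by (auto simp: flat_def)
  also have "\<dots> \<longleftrightarrow> closed_rel m n X Y R"
    unfolding closed_rel_def lim using flat_mem[OF RF] X Y by (meson subsetD)
  finally show ?thesis .
qed

lemma closed_rel_restrict:
  assumes E: "closed_rel m n X Y E" and A: "A \<subseteq> X" and B: "B \<subseteq> Y"
  shows "closed_rel m n A B (E \<inter> A \<times> B)"
  unfolding closed_rel_def
proof (intro ballI impI)
  fix x y assume x: "x \<in> A" and y: "y \<in> B"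
    and lim: "\<forall>s>0. \<exists>(a, b)\<in>E \<inter> A \<times> B. dn m x a < s \<and> dn n y b < s"
  have "(x, y) \<in> E"
  proof (rule closed_relD[OF E])
    show "x \<in> X" "y \<in> Y" using x y A B by auto
    show "\<exists>(a, b)\<in>E. dn m x a < s \<and> dn n y b < s" if "s > 0" for s using lim that by blast
  qed
  with x y show "(x, y) \<in> E \<inter> A \<times> B" by blast
qed

text \<open>Closedness relative to \<open>X \<times> Y\<close> is enough, because a limit in
  \<open>F^(m+n)\<close> has its components in the closed sets \<open>X\<close> and
  \<open>Y\<close>.\<close>

lemma compact_flatI:
  fixes M :: "('a::{linordered_field, linorder_topology}, 'f, 'r) expansion"
  assumes X: "definably_compact M m X" and Y: "definably_compact M n Y" and R: "R \<subseteq> X \<times> Y"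
    and dR: "definable M (m + n) (flat m n R)" and clo: "closed_rel m n X Y R"
  shows "definably_compact M (m + n) (flat m n R)"
  unfolding definably_compact_iff
proof (intro conjI ballI impI)
  have XF: "X \<subseteq> Fn m" and YF: "Y \<subseteq> Fn n"
    using X Y definable_subset unfolding definably_compact_iff by blast+
  obtain B C where B: "\<And>x i. x \<in> X \<Longrightarrow> i < m \<Longrightarrow> \<bar>x i\<bar> \<le> B" and C: "\<And>x i. x \<in> Y \<Longrightarrow> i < n \<Longrightarrow> \<bar>x i\<bar> \<le> C"
    using X Y unfolding definably_compact_iff by blast
  show "\<exists>B. \<forall>z\<in>flat m n R. \<forall>i<m + n. \<bar>z i\<bar> \<le> B"
  proof (intro exI ballI allI impI)
    fix z i assume "z \<in> flat m n R" and i: "i < m + n"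
    then obtain x y where xy: "x \<in> X" "y \<in> Y" "z = concat_vec m n x y" using R by (auto simp: flat_def)
    show "\<bar>z i\<bar> \<le> max B C"
    proof (cases "i < m")
      case True
      then show ?thesis using B[OF xy(1) True] by (simp add: xy concat_vec_def le_max_iff_disj)
    next
      case False
      then show ?thesis using i C[OF xy(2), of "i - m"] by (simp add: xy concat_vec_def le_max_iff_disj)
    qed
  qed
  fix z assume z: "z \<in> Fn (m + n)" and lim: "\<forall>s>0. \<exists>w\<in>flat m n R. dn (m + n) z w < s"
  obtain x y where xy: "x \<in> Fn m" "y \<in> Fn n" "z = concat_vec m n x y" using Fn_splitE[OF z] .
  have near: "\<exists>(a, b)\<in>R. dn m x a < s \<and> dn n y b < s" if s: "s > 0" for s
  proof -
    obtain a b where ab: "(a, b) \<in> R" "dn m x a + dn n y b < s"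
      using lim s by (auto simp: flat_def dn_concat xy)
    have "dn m x a < s" "dn n y b < s" using ab(2) dn_nonneg[of m x a] dn_nonneg[of n y b] by linarith+
    with ab(1) show ?thesis by blast
  qed
  have "\<exists>a\<in>X. dn m x a < s" "\<exists>b\<in>Y. dn n y b < s" if "s > 0" for s using near[OF that] R by blast+
  then have "x \<in> X" "y \<in> Y" using X Y xy unfolding definably_compact_iff by blast+
  from closed_relD[OF clo this near] show "z \<in> flat m n R"
    unfolding xy flat_def by (auto intro: rev_image_eqI)
qed (rule dR)

text \<open>Pairs of \<open>R\<close> whose first entries tend to \<open>x0\<close> accumulate at
  some \<open>(p, q) \<in> R\<close>, and then \<open>p = x0\<close>.\<close>

lemma compact_Domain:
  fixes M :: "('a::{linordered_field, linorder_topology}, 'f, 'r) expansion"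
  assumes M: "definably_complete M" and R: "R \<subseteq> Fn m \<times> Fn n"
    and C: "definably_compact M (m + n) (flat m n R)"
  shows "definably_compact M m (Domain R)"
  unfolding definably_compact_iff
proof (intro conjI ballI impI)
  have dR: "definable M (m + n) (flat m n R)" using C by (simp add: definably_compact_iff)
  have "definable M m {x \<in> Fn m. \<exists>a\<in>Fn n. (x, a) \<in> R}"
    by (intro definableI dpred_bex[OF definable_Fn] dpred_pair[OF dR R] dvect_var)
  moreover have "Domain R = {x \<in> Fn m. \<exists>a\<in>Fn n. (x, a) \<in> R}" using R by blast
  ultimately show "definable M m (Domain R)" by simp
  obtain B where B: "\<And>z i. z \<in> flat m n R \<Longrightarrow> i < m + n \<Longrightarrow> \<bar>z i\<bar> \<le> B"
    using C unfolding definably_compact_iff by blast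
  have "\<bar>x i\<bar> \<le> B" if "(x, a) \<in> R" "i < m" for x a i
  proof -
    have "concat_vec m n x a \<in> flat m n R" using that(1) unfolding flat_def by (auto intro: rev_image_eqI)
    from B[OF this, of i] that(2) show ?thesis by (simp add: concat_vec_def)
  qed
  then show "\<exists>B. \<forall>x\<in>Domain R. \<forall>i<m. \<bar>x i\<bar> \<le> B" by blast
  fix x0 assume x0: "x0 \<in> Fn m" and lim: "\<forall>s>0. \<exists>y\<in>Domain R. dn m x0 y < s"
  have "\<exists>(p, q)\<in>R. \<forall>s>0. \<exists>(x, y)\<in>R. dn m x0 x < s \<and> dn m x p < s \<and> dn n y q < s"
    by (rule definably_compact_limit_pair[OF M C R])
      (use lim x0 in \<open>auto intro!: dpred_less dscal_dn dscal_var dvect_const dvect_var\<close>)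
  then obtain p q where pq: "(p, q) \<in> R"
    "\<And>s. s > 0 \<Longrightarrow> \<exists>(x, y)\<in>R. dn m x0 x < s \<and> dn m x p < s \<and> dn n y q < s" by blast
  have "x0 = p" by (rule dn_eqI[OF x0]) (use pq R in blast)+
  with pq(1) show "x0 \<in> Domain R" by blast
qed

section \<open>Closures and saturations\<close>

definition clos :: "nat \<Rightarrow> (nat \<Rightarrow> 'a::linordered_field) set \<Rightarrow> (nat \<Rightarrow> 'a) set" where
  "clos n S = {x \<in> Fn n. \<forall>s>0. \<exists>y\<in>S. dn n x y < s}"

lemma clos_superset: "S \<subseteq> Fn n \<Longrightarrow> S \<subseteq> clos n S"
proof
  fix x assume "S \<subseteq> Fn n" "x \<in> S"
  then show "x \<in> clos n S" unfolding clos_def by (auto intro!: bexI[of _ x])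
qed

lemma clos_closed:
  assumes "x \<in> Fn n" "\<And>s. s > 0 \<Longrightarrow> \<exists>y\<in>clos n S. dn n x y < s"
  shows "x \<in> clos n S"
proof -
  have "\<exists>z\<in>S. dn n x z < s" if s: "s > 0" for s
  proof -
    have s2: "s / 2 > 0" using s by simp
    then obtain y where y: "y \<in> clos n S" "dn n x y < s / 2" using assms(2) by blast
    then obtain z where "z \<in> S" "dn n y z < s / 2" using s2 unfolding clos_def by blast
    with y(2) dn_tri[of n x z y] show ?thesis by (intro bexI[of _ z]) linarith+
  qed
  with assms(1) show ?thesis unfolding clos_def by blast
qed

lemma definable_clos:
  assumes "definable M n S" shows "definable M n (clos n S)"
  unfolding clos_def
  by (intro definableI dpred_all dpred_imp dpred_bex[OF assms] dpred_less dscal_dn dvect_var dscal_var dscal_const)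

lemma compact_clos:
  fixes M :: "('a::{linordered_field, linorder_topology}, 'f, 'r) expansion"
  assumes X: "definably_compact M n X" and S: "definable M n S" "S \<subseteq> X"
  shows "clos n S \<subseteq> X" "definably_compact M n (clos n S)"
proof -
  show sub: "clos n S \<subseteq> X" using X S(2) unfolding definably_compact_iff clos_def by blast
  have "X \<subseteq> Fn n" using X definable_subset unfolding definably_compact_iff by blast
  then show "definably_compact M n (clos n S)"
    using clos_closed by (intro compact_subset[OF X definable_clos[OF S(1)] sub]) blast
qed

text \<open>\<open>R\<close> relates a point to the members of \<open>A\<close> in its class. As a
  closed part of \<open>X \<times> A\<close> it is definably compact, so
  \<open>extend_along_relation\<close> applies with \<open>R\<close> itself as the compact part, and
  \<open>B\<close> is definably compact as a projection of \<open>R\<close>.\<close>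

lemma saturate:
  fixes M :: "('a::{linordered_field, linorder_topology}, 'f, 'r) expansion"
  assumes M: "definably_complete M" and X: "definably_compact M n X"
    and A: "definably_compact M n A" "A \<subseteq> X"
    and E: "equiv X E" "definable M (n + n) (flat n n E)" "closed_rel n n X X E"
    and g: "dfun M n k g" "cont_on n k A g" "\<And>a b. a \<in> A \<Longrightarrow> b \<in> A \<Longrightarrow> g a = g b \<longleftrightarrow> (a, b) \<in> E"
    and B: "B = {x \<in> X. \<exists>a\<in>A. (x, a) \<in> E}"
  obtains G where "definably_compact M n B" "dfun M n k G" "cont_on n k B G"
    "\<And>x y. x \<in> B \<Longrightarrow> y \<in> B \<Longrightarrow> G x = G y \<longleftrightarrow> (x, y) \<in> E"
proof -
  have EX: "E \<subseteq> X \<times> X" using E(1) equiv_type by blast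
  have XF: "X \<subseteq> Fn n" using X definable_subset unfolding definably_compact_iff by blast
  have dA: "definable M n A" using A(1) unfolding definably_compact_iff by blast
  have Esym: "(y, x) \<in> E" if "(x, y) \<in> E" for x y using E(1) that by (meson equiv_def symE)
  have Etr: "(x, z) \<in> E" if "(x, y) \<in> E" "(y, z) \<in> E" for x y z using E(1) that by (meson equiv_def transE)
  have EF: "E \<subseteq> Fn n \<times> Fn n" using EX XF by blast
  define R where "R = E \<inter> X \<times> A"
  have R: "R \<subseteq> X \<times> A" "R \<subseteq> Fn n \<times> Fn n" using EX XF A(2) unfolding R_def by auto
  have dX: "definable M n X" using X unfolding definably_compact_iff by blast
  have dR: "definable M (n + n) (flat n n R)"
    unfolding R_def by (rule definable_flat_restrict[OF E(2) EF dX dA])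
  have cR: "definably_compact M (n + n) (flat n n R)"
    using closed_rel_restrict[OF E(3) order_refl A(2)]
    by (intro compact_flatI[OF X A(1) R(1) dR]) (simp add: R_def)
  have DB: "Domain R = B" using EX unfolding B R_def by blast
  have rel: "g a = g b" if "(x, a) \<in> R" "(x, b) \<in> R" for x a b
    using that g(3) Esym Etr unfolding R_def by blast
  have loc: "\<exists>r>0. \<exists>C\<subseteq>R. definably_compact M (n + n) (flat n n C) \<and>
      (\<forall>y a. (y, a) \<in> R \<and> dn n x y < r \<longrightarrow> (y, a) \<in> C)" for x
    by (rule exI[of _ 1]) (use cR in auto)
  have RA: "Range R \<subseteq> A" using R(1) by blast
  have "\<exists>G. dfun M n k G \<and> cont_on n k (Domain R) G \<and> (\<forall>x a. (x, a) \<in> R \<longrightarrow> G x = g a)"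
    by (rule extend_along_relation[OF M R(2) dR g(1) cont_subset[OF g(2) RA]])
      (erule (1) rel | rule loc | blast)+
  then obtain G where G: "dfun M n k G" "cont_on n k (Domain R) G" "\<And>x a. (x, a) \<in> R \<Longrightarrow> G x = g a"
    by blast
  have "G x = G y \<longleftrightarrow> (x, y) \<in> E" if "x \<in> B" "y \<in> B" for x y
  proof -
    obtain a b where ab: "(x, a) \<in> R" "(y, b) \<in> R" using \<open>x \<in> B\<close> \<open>y \<in> B\<close> DB by blast
    have "(a, b) \<in> E \<longleftrightarrow> (x, y) \<in> E" using ab Esym Etr unfolding R_def by blast
    moreover have "a \<in> A" "b \<in> A" using ab R(1) by auto
    ultimately show ?thesis using G(3)[OF ab(1)] G(3)[OF ab(2)] g(3) by simp
  qed
  with G DB compact_Domain[OF M R(2) cR] show ?thesis by (intro that[of G]) simp_all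
qed

section \<open>Consequences of the rank axioms\<close>

lemma
  assumes "good_extended_rank M \<E> eRank"
  shows good_rank_range: "definable M n A \<Longrightarrow> eRank n A \<in> insert None (Some ` \<E> n)"
    and good_rank_None: "definable M n A \<Longrightarrow> eRank n A = None \<longleftrightarrow> A = {}"
    and good_rank_wf: "\<not> (\<exists>s. \<forall>i::nat. s i \<in> \<E> n \<and> s (Suc i) < s i)"
    and good_rank_Un: "definable M n A \<Longrightarrow> definable M n B \<Longrightarrow>
      eRank n (A \<union> B) = max (eRank n A) (eRank n B)"
    and good_rank_open: "definable M n A \<Longrightarrow> definable M n B \<Longrightarrow> A \<subseteq> B \<Longrightarrow> A \<noteq> {} \<Longrightarrow>
      eRank n A = eRank n B \<Longrightarrow>
      \<exists>U. definable M n U \<and> U \<subseteq> A \<and> openin (top_on n B) U \<and> eRank n (A - U) < eRank n B"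
proof -
  note * = spec[OF assms[unfolded good_extended_rank_def], of n]
  show "definable M n A \<Longrightarrow> eRank n A \<in> insert None (Some ` \<E> n)"
    using *[THEN conjunct1] by simp
  show "definable M n A \<Longrightarrow> eRank n A = None \<longleftrightarrow> A = {}"
    using *[THEN conjunct2, THEN conjunct2, THEN conjunct1] by simp
  show "\<not> (\<exists>s. \<forall>i::nat. s i \<in> \<E> n \<and> s (Suc i) < s i)"
    using *[THEN conjunct2, THEN conjunct2, THEN conjunct2, THEN conjunct1] .
  show "definable M n A \<Longrightarrow> definable M n B \<Longrightarrow> eRank n (A \<union> B) = max (eRank n A) (eRank n B)"
    using *[THEN conjunct2, THEN conjunct2, THEN conjunct2, THEN conjunct2, THEN conjunct1] by simp
  show "definable M n A \<Longrightarrow> definable M n B \<Longrightarrow> A \<subseteq> B \<Longrightarrow> A \<noteq> {} \<Longrightarrow> eRank n A = eRank n B \<Longrightarrow>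
      \<exists>U. definable M n U \<and> U \<subseteq> A \<and> openin (top_on n B) U \<and> eRank n (A - U) < eRank n B"
    using *[THEN conjunct2, THEN conjunct2, THEN conjunct2, THEN conjunct2, THEN conjunct2, THEN conjunct1]
    by simp
qed

lemma good_rank_mono:
  assumes "good_extended_rank M \<E> eRank" "definable M n X" "definable M n Y" "X \<subseteq> Y"
  shows "eRank n X \<le> eRank n Y"
proof -
  have "eRank n (X \<union> Y) = max (eRank n X) (eRank n Y)"
    using good_rank_Un[OF assms(1-3)] .
  moreover have "X \<union> Y = Y" using assms(4) by blast
  ultimately show ?thesis by (simp add: max_def split: if_splits)
qed

text \<open>
  A dense definable subset of \<open>Y\<close> contains a definable open subset of \<open>Y\<close> with a complement of smaller
  rank: the complement of the dense set cannot have full rank, as it has empty interior.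
\<close>

lemma dense_open_part:
  fixes M :: "('a::{linordered_field, linorder_topology}, 'f, 'r) expansion"
  assumes rk: "good_extended_rank M \<E> eRank" and S: "definable M n S" and Y: "definable M n Y" "Y \<noteq> {}"
    and SY: "S \<subseteq> Y" and dense: "\<And>y s. y \<in> Y \<Longrightarrow> s > 0 \<Longrightarrow> \<exists>x\<in>S. dn n y x < s"
  obtains U where "definable M n U" "U \<subseteq> S" "\<And>x. x \<in> U \<Longrightarrow> \<exists>s>0. \<forall>y\<in>Y. dn n x y < s \<longrightarrow> y \<in> U"
    "eRank n (Y - U) < eRank n Y"
proof -
  note none = good_rank_None[OF rk] and un = good_rank_Un[OF rk]
  have YF: "Y \<subseteq> Fn n" using definable_subset[OF Y(1)] .
  note dD = definable_Diff[OF Y(1) S]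
  have "eRank n (Y - S) \<noteq> eRank n Y"
  proof
    assume eq: "eRank n (Y - S) = eRank n Y"
    then have "Y - S \<noteq> {}" using none[OF dD] none[OF Y(1)] Y(2) by auto
    from good_rank_open[OF rk dD Y(1) Diff_subset this eq] obtain U where U: "U \<subseteq> Y - S" "openin (top_on n Y) U"
      "eRank n (Y - S - U) < eRank n Y" by blast
    have "U \<noteq> {}" using U(3) eq by auto
    then obtain u where u: "u \<in> U" by blast
    then obtain s where s: "s > 0" "\<forall>y\<in>Y. dn n u y < s \<longrightarrow> y \<in> U"
      using U(2) unfolding openin_top_on[OF YF] by blast
    obtain x where "x \<in> S" "dn n u x < s" using dense[of u s] u U(1) s(1) by blast
    with s(2) SY U(1) show False by blast
  qed
  then have lt: "eRank n (Y - S) < eRank n Y" using good_rank_mono[OF rk dD Y(1)] by auto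
  have "Y = (Y - S) \<union> S" using SY by blast
  then have eqS: "eRank n S = eRank n Y" using un[OF dD S] lt by (metis max_def order_less_irrefl)
  have "S \<noteq> {}" using eqS none[OF S] none[OF Y(1)] Y(2) by auto
  from good_rank_open[OF rk S Y(1) SY this eqS] obtain U where U: "definable M n U" "U \<subseteq> S" "openin (top_on n Y) U"
    "eRank n (S - U) < eRank n Y" by blast
  note dSU = definable_Diff[OF S U(1)]
  have "Y - U = (Y - S) \<union> (S - U)" using U(2) SY by blast
  then have "eRank n (Y - U) < eRank n Y" using un[OF dD dSU] lt U(4) by simp
  moreover have "\<And>x. x \<in> U \<Longrightarrow> \<exists>s>0. \<forall>y\<in>Y. dn n x y < s \<longrightarrow> y \<in> U"
    using U(3) unfolding openin_top_on[OF YF] by blast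
  ultimately show ?thesis using that U(1,2) by blast
qed

section \<open>Quotients of definably compact sets by induction on the rank\<close>

lemma equiv_restrict: "equiv X E \<Longrightarrow> A \<subseteq> X \<Longrightarrow> equiv A (E \<inter> A \<times> A)"
  unfolding equiv_def refl_on_def sym_def trans_def by blast

lemma definable_representatives:
  assumes "definable_choice M" "definable M n X" "equiv X E" "definable M (n + n) (flat n n E)"
  obtains S where "definable M n S" "S \<subseteq> X" "\<forall>C \<in> X // E. \<exists>!s. s \<in> S \<inter> C"
proof -
  have "definable_equiv M n X E" using assms(3,4) by (simp add: definable_equiv_def)
  with assms(1)[unfolded definable_choice_def, THEN conjunct2] assms(2)
  have "\<exists>S. definable M n S \<and> S \<subseteq> X \<and> (\<forall>C \<in> X // E. \<exists>!s. s \<in> S \<inter> C)" by simp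
  then show ?thesis using that by (elim exE conjE)
qed

text \<open>The dimension \<open>n\<close> is fixed, since ranks are compared inside
  \<open>\<E> n\<close>, while the target dimension \<open>m\<close> may change at each level. Only
  continuity and the fibres of \<open>f\<close> are asserted; the identifying property is derived
  for the final map on the possibly noncompact set.\<close>

lemma compact_quotient:
  fixes M :: "('a::{linordered_field, linorder_topology}, 'f, 'r) expansion"
    and \<E> :: "nat \<Rightarrow> 'e::linorder set"
  assumes M: "definably_complete M" and ch: "definable_choice M" and rk: "good_extended_rank M \<E> eRank"
    and X0: "definably_compact M n X"
    and E0: "equiv X E" "definable M (n + n) (flat n n E)" "closed_rel n n X X E"
  shows "\<exists>m f. dfun M n m f \<and> cont_on n m X f \<and> (\<forall>x\<in>X. \<forall>y\<in>X. f x = f y \<longleftrightarrow> (x, y) \<in> E)"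
proof -
  have empty: "\<exists>m f. dfun M n m f \<and> cont_on n m {} f \<and>
    (\<forall>x\<in>{}. \<forall>y\<in>{}. f x = f y \<longleftrightarrow> (x, y) \<in> E)" for E :: "((nat \<Rightarrow> 'a) \<times> (nat \<Rightarrow> 'a)) set"
    by (intro exI[of _ n] exI[of _ "\<lambda>x. x"]) (simp add: dfun_def cont_on_def)
  \<comment> \<open>Infinite descent is excluded only inside \<open>\<E> n\<close>, so the order is
    restricted to that set.\<close>
  define W where "W = {(a, b). a \<in> \<E> n \<and> b \<in> \<E> n \<and> a < b}"
  have "wf W" using good_rank_wf[OF rk, of n] unfolding wf_iff_no_infinite_down_chain W_def by auto
  have "\<exists>m f. dfun M n m f \<and> cont_on n m X f \<and> (\<forall>x\<in>X. \<forall>y\<in>X. f x = f y \<longleftrightarrow> (x, y) \<in> E)"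
    if "eRank n X = Some r" "definably_compact M n X" "equiv X E"
      "definable M (n + n) (flat n n E)" "closed_rel n n X X E" for r X E
    using \<open>wf W\<close> that
  proof (induction r arbitrary: X E)
    case (less r)
    note X = less.prems(2) and E = less.prems(3-5)
    have dX: "definable M n X" using X unfolding definably_compact_iff by blast
    have XF: "X \<subseteq> Fn n" using definable_subset[OF dX] .
    have EX: "E \<subseteq> X \<times> X" using E(1) equiv_type by blast
    have EF: "E \<subseteq> Fn n \<times> Fn n" using EX XF by blast
    have Esym: "(y, x) \<in> E" if "(x, y) \<in> E" for x y using E(1) that by (meson equiv_def symE)
    have Etr: "(x, z) \<in> E" if "(x, y) \<in> E" "(y, z) \<in> E" for x y z using E(1) that by (meson equiv_def transE)
    have Erefl: "(x, x) \<in> E" if "x \<in> X" for x using E(1) that by (meson equiv_def refl_onD)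
    note rkin = good_rank_range[OF rk] and none = good_rank_None[OF rk]
    have "X \<noteq> {}" using none[OF dX] less.prems(1) by auto
    obtain S where S: "definable M n S" "S \<subseteq> X" "\<forall>C \<in> X // E. \<exists>!s. s \<in> S \<inter> C"
      using definable_representatives[OF ch dX E(1,2)] .
    have rep: "\<exists>s\<in>S. (x, s) \<in> E" if "x \<in> X" for x
    proof -
      have "E `` {x} \<in> X // E" using that by (rule quotientI)
      from bspec[OF S(3) this] obtain s where "s \<in> S \<inter> E `` {x}" by (elim ex1E)
      then show ?thesis by blast
    qed
    have uniq: "s = t" if "s \<in> S" "t \<in> S" "(s, t) \<in> E" for s t
    proof -
      have s: "s \<in> X" using that S(2) by blast
      then have "E `` {s} \<in> X // E" by (rule quotientI)
      from bspec[OF S(3) this] obtain u where "\<forall>v. v \<in> S \<inter> E `` {s} \<longrightarrow> v = u" by (elim ex1E)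
      then have "s = u" "t = u" using that Erefl[OF s] by blast+
      then show ?thesis by simp
    qed
    define Y where "Y = clos n S"
    have YX: "Y \<subseteq> X" and Y: "definably_compact M n Y"
      unfolding Y_def using compact_clos[OF X S(1,2)] by auto
    have SY: "S \<subseteq> Y" unfolding Y_def using clos_superset S(2) XF by blast
    have dY: "definable M n Y" using Y unfolding definably_compact_iff by blast
    have "Y \<noteq> {}" using rep \<open>X \<noteq> {}\<close> SY by blast
    obtain U where U: "definable M n U" "U \<subseteq> S"
      "\<And>x. x \<in> U \<Longrightarrow> \<exists>s>0. \<forall>y\<in>Y. dn n x y < s \<longrightarrow> y \<in> U" "eRank n (Y - U) < eRank n Y"
      using dense_open_part[OF rk S(1) dY \<open>Y \<noteq> {}\<close> SY] unfolding Y_def clos_def by blast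
    \<comment> \<open>\<open>U\<close> is open in \<open>Y\<close>, so \<open>A\<close> is closed in
      \<open>Y\<close> and definably compact; its rank lies below that of \<open>Y\<close>, hence
      below that of \<open>X\<close>.\<close>
    define A where "A = Y - U"
    have AX: "A \<subseteq> X" "A \<subseteq> Y" using YX unfolding A_def by auto
    have dA: "definable M n A" unfolding A_def by (rule definable_Diff[OF dY U(1)])
    have A: "definably_compact M n A"
      by (rule compact_subset[OF Y dA AX(2)]) (use U(3) in \<open>unfold A_def, blast\<close>)
    have restr: "equiv Z (E \<inter> Z \<times> Z)" "definable M (n + n) (flat n n (E \<inter> Z \<times> Z))"
      "closed_rel n n Z Z (E \<inter> Z \<times> Z)" if Z: "Z \<subseteq> X" "definable M n Z" for Z
      using equiv_restrict[OF E(1) Z(1)] definable_flat_restrict[OF E(2) EF Z(2) Z(2)]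
        closed_rel_restrict[OF E(3) Z(1) Z(1)] by auto
    have "\<exists>m f. dfun M n m f \<and> cont_on n m A f \<and> (\<forall>x\<in>A. \<forall>y\<in>A. f x = f y \<longleftrightarrow> (x, y) \<in> E \<inter> A \<times> A)"
    proof (cases "eRank n A")
      case None
      then have "A = {}" using none[OF dA] by simp
      then show ?thesis using empty by simp
    next
      case (Some q)
      have "eRank n A < eRank n X"
        using U(4) good_rank_mono[OF rk dY dX YX] unfolding A_def by simp
      then have "q < r" using Some less.prems(1) by simp
      moreover have "q \<in> \<E> n" "r \<in> \<E> n" using rkin[OF dA] rkin[OF dX] Some less.prems(1) by auto
      ultimately have "(q, r) \<in> W" unfolding W_def by simp
      from less.IH[OF this Some A restr[OF AX(1) dA]] show ?thesis .
    qed
    then obtain k g where g: "dfun M n k g" "cont_on n k A g"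
      "\<And>x y. x \<in> A \<Longrightarrow> y \<in> A \<Longrightarrow> g x = g y \<longleftrightarrow> (x, y) \<in> E \<inter> Y \<times> Y"
      using AX(2) by blast
    \<comment> \<open>Collapsing \<open>A\<close> alone would leave points of \<open>U\<close>
      separate from related points of \<open>A\<close>. The saturation \<open>B\<close> of
      \<open>A\<close> in \<open>Y\<close> contains every pair of distinct related points of
      \<open>Y\<close>.\<close>
    define B where "B = {x \<in> Y. \<exists>a\<in>A. (x, a) \<in> E \<inter> Y \<times> Y}"
    have "\<exists>h. definably_compact M n B \<and> dfun M n k h \<and> cont_on n k B h \<and>
        (\<forall>x\<in>B. \<forall>y\<in>B. h x = h y \<longleftrightarrow> (x, y) \<in> E \<inter> Y \<times> Y)"
      by (rule saturate[OF M Y A AX(2) restr[OF YX dY] g(1,2) _ B_def]) (erule (1) g(3) | blast)+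
    then obtain h where B: "definably_compact M n B" and h: "dfun M n k h" "cont_on n k B h"
      "\<And>x y. x \<in> B \<Longrightarrow> y \<in> B \<Longrightarrow> h x = h y \<longleftrightarrow> (x, y) \<in> E \<inter> Y \<times> Y"
      by blast
    have "\<exists>m f. dfun M n m f \<and> cont_on n m (Fn n) f \<and>
        (\<forall>x\<in>Fn n. \<forall>y\<in>Fn n. f x = f y \<longleftrightarrow> x = y \<or> (x \<in> B \<and> y \<in> B \<and> h x = h y))"
      by (rule glue[OF M B h(1,2)]) blast
    then obtain m f where f: "dfun M n m f" "cont_on n m (Fn n) f"
      "\<And>x y. x \<in> Fn n \<Longrightarrow> y \<in> Fn n \<Longrightarrow> f x = f y \<longleftrightarrow> x = y \<or> (x \<in> B \<and> y \<in> B \<and> h x = h y)"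
      by blast
    \<comment> \<open>\<open>B\<close> is saturated in \<open>Y\<close>, so both points avoid
      \<open>B\<close> and with it \<open>A\<close>. Hence both lie in
      \<open>U \<subseteq> S\<close>, and \<open>S\<close> meets their class only once.\<close>
    have offB: "x = y" if "x \<in> Y" "y \<in> Y" "(x, y) \<in> E" "x \<notin> B \<or> y \<notin> B" for x y
    proof -
      have "x \<notin> B" "y \<notin> B" using that Esym Etr unfolding B_def by blast+
      moreover have "A \<subseteq> B" using AX Erefl unfolding B_def by blast
      ultimately have "x \<in> U" "y \<in> U" using that(1,2) unfolding A_def by blast+
      then show ?thesis using uniq U(2) that(3) by blast
    qed
    have fY: "f x = f y \<longleftrightarrow> (x, y) \<in> E" if xy: "x \<in> Y" "y \<in> Y" for x y
    proof -
      have "x \<in> Fn n" "y \<in> Fn n" using xy YX XF by auto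
      note * = f(3)[OF this]
      show ?thesis
      proof
        assume "f x = f y"
        then show "(x, y) \<in> E" using * h(3) Erefl xy(1) YX by blast
      next
        assume E: "(x, y) \<in> E"
        show "f x = f y"
        proof (cases "x \<in> B \<and> y \<in> B")
          case True
          then show ?thesis using * h(3) E xy by blast
        next
          case False
          then show ?thesis using offB[OF xy E] by auto
        qed
      qed
    qed
    \<comment> \<open>Every class meets \<open>S \<subseteq> Y\<close>, so the saturation of
      \<open>Y\<close> is all of \<open>X\<close>.\<close>
    have X_eq: "X = {x \<in> X. \<exists>a\<in>Y. (x, a) \<in> E}" using rep SY by blast
    have YF: "Y \<subseteq> Fn n" using YX XF by blast
    have "\<exists>F. dfun M n m F \<and> cont_on n m X F \<and> (\<forall>x\<in>X. \<forall>y\<in>X. F x = F y \<longleftrightarrow> (x, y) \<in> E)"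
      by (rule saturate[OF M X Y YX E f(1) cont_subset[OF f(2) YF] _ X_eq]) (erule (1) fY | blast)+
    then show ?case by blast
  qed
  \<comment> \<open>The empty set has rank \<open>None\<close>, outside \<open>\<E> n\<close>, and
    is left out of the induction.\<close>
  moreover have "eRank n X = None \<Longrightarrow> X = {}"
    using good_rank_None[OF rk] X0 unfolding definably_compact_iff by blast
  ultimately show ?thesis using empty X0 E0 by (cases "eRank n X") auto
qed

section \<open>Exhaustion of a locally closed set by definably compact sets\<close>

text \<open>A locally closed set is open in its closure: near a point of \<open>X\<close> every
  point of the closure lies in the open factor \<open>U\<close>, and it lies in the closed factor
  \<open>C\<close> anyway. Local closedness of \<open>X\<close> enters the proof here.\<close>

lemma frontier_closed:
  fixes X :: "(nat \<Rightarrow> 'a::{linordered_field, linorder_topology}) set"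
  assumes lc: "locally_closed_in (Fn_top n) X"
    and z: "z \<in> Fn n" "\<And>s. s > 0 \<Longrightarrow> \<exists>w\<in>clos n X - X. dn n z w < s"
  shows "z \<in> clos n X - X"
proof
  show "z \<in> clos n X" using clos_closed[OF z(1)] z(2) by blast
  show "z \<notin> X"
  proof
    assume zX: "z \<in> X"
    obtain U C where U: "openin (Fn_top n) U" and C: "closedin (Fn_top n) C" and X: "X = U \<inter> C"
      using lc unfolding locally_closed_in_def by blast
    obtain s where s: "s > 0" "\<And>y. y \<in> Fn n \<Longrightarrow> dn n z y < s \<Longrightarrow> y \<in> U"
      using U zX X unfolding openin_Fn_top by blast
    obtain w where w: "w \<in> clos n X" "w \<notin> X" "dn n z w < s" using z(2)[OF s(1)] by blast
    have "w \<in> Fn n" using w(1) unfolding clos_def by blast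
    have "\<forall>s>0. \<exists>y\<in>C. dn n w y < s" using w(1) X unfolding clos_def by blast
    then have "w \<in> C" using C \<open>w \<in> Fn n\<close> unfolding closedin_Fn_top by blast
    moreover have "w \<in> U" using s(2) \<open>w \<in> Fn n\<close> w(3) by blast
    ultimately show False using w(2) X by blast
  qed
qed

text \<open>\<open>h\<close> is 1 plus the \<open>l1\<close>-norm plus the reciprocal of the
  distance to the frontier \<open>Z\<close>. The norm keeps sublevel sets bounded, and the
  reciprocal keeps them away from \<open>Z\<close>, so that they are closed in \<open>F^n\<close>.
  The bounds of 1 and of \<open>|x i|\<close> by \<open>h x\<close> serve the compactification of
  \<open>K\<close> later.\<close>

lemma exhaustion:
  fixes M :: "('a::{linordered_field, linorder_topology}, 'f, 'r) expansion"
  assumes M: "definably_complete M" and dX: "definable M n X" and lc: "locally_closed_in (Fn_top n) X"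
  shows "\<exists>h. dsfun M n h \<and> scont_on n X h \<and> (\<forall>x\<in>X. 1 \<le> h x) \<and> (\<forall>x\<in>X. \<forall>i<n. \<bar>x i\<bar> \<le> h x) \<and>
    (\<forall>r. definably_compact M n {x \<in> X. h x \<le> r})"
proof -
  note XF = definable_subset[OF dX]
  define Z where "Z = clos n X - X"
  have dZ: "definable M n Z" unfolding Z_def by (rule definable_Diff[OF definable_clos[OF dX] dX])
  have "\<exists>\<delta>. dsfun M n \<delta> \<and> (\<forall>x\<in>Fn n. \<forall>y\<in>Fn n. \<bar>\<delta> x - \<delta> y\<bar> \<le> dn n x y) \<and> (\<forall>x\<in>Fn n. 0 \<le> \<delta> x) \<and>
    (\<forall>x\<in>Fn n. \<delta> x = 0 \<longleftrightarrow> x \<in> Z)"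
  proof (cases "Z = {}")
    case True
    \<comment> \<open>With an empty frontier there is nothing to stay away from, and a constant
      stands in for the distance.\<close>
    then show ?thesis by (intro exI[of _ "\<lambda>_. 1"]) (simp add: dsfun_const)
  next
    case False
    have clo: "x \<in> Z" if "x \<in> Fn n" "\<And>s. s > 0 \<Longrightarrow> \<exists>y\<in>Z. dn n x y < s" for x
      unfolding Z_def by (rule frontier_closed[OF lc that[unfolded Z_def]])
    show ?thesis
    proof (intro exI conjI ballI)
      show "dsfun M n (inf_over Z (dn n))" by (rule dsfun_dist_set[OF M dZ False])
      show "inf_over Z (dn n) x = 0 \<longleftrightarrow> x \<in> Z" if "x \<in> Fn n" for x
        by (rule dist_set_eq_0[OF M dZ False clo that])
    qed (simp_all add: dist_set_lipschitz[OF M dZ False] dist_set_nonneg[OF M dZ False])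
  qed
  then obtain \<delta> where *: "dsfun M n \<delta> \<and> (\<forall>x\<in>Fn n. \<forall>y\<in>Fn n. \<bar>\<delta> x - \<delta> y\<bar> \<le> dn n x y) \<and>
    (\<forall>x\<in>Fn n. 0 \<le> \<delta> x) \<and> (\<forall>x\<in>Fn n. \<delta> x = 0 \<longleftrightarrow> x \<in> Z)" ..
  have d\<delta>: "dsfun M n \<delta>"
    and \<delta>_lip: "\<And>x y. x \<in> Fn n \<Longrightarrow> y \<in> Fn n \<Longrightarrow> \<bar>\<delta> x - \<delta> y\<bar> \<le> dn n x y"
    and \<delta>_nn: "\<And>x. x \<in> Fn n \<Longrightarrow> 0 \<le> \<delta> x" and \<delta>0: "\<And>x. x \<in> Fn n \<Longrightarrow> \<delta> x = 0 \<longleftrightarrow> x \<in> Z"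
    using * by simp_all
  have \<delta>_pos: "0 < \<delta> x" if "x \<in> X" for x
    using \<delta>_nn[of x] \<delta>0[of x] that XF unfolding Z_def by (auto simp: less_le)
  define o' :: "nat \<Rightarrow> 'a" where "o' = (\<lambda>i\<in>{..<n}. 0)"
  define h where "h x = 1 + dn n x o' + inverse (\<delta> x)" for x
  have dh: "dsfun M n h"
    unfolding h_def
  proof (intro dsfun_ops(1) dsfun_inverse dsfun_const d\<delta>)
    show "dsfun M n (\<lambda>x. dn n x o')" unfolding dsfun_def
      by (auto intro!: dscal_dn dvect_const simp: o'_def Fn_restrict)
  qed
  have ch: "scont_on n X h"
    unfolding h_def
  proof (intro scont_add scont_const scont_inverse)
    show "scont_on n X (\<lambda>x. dn n x o')"
    proof (rule scont_lipschitz[where L = 1])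
      show "\<bar>dn n x o' - dn n y o'\<bar> \<le> 1 * dn n x y" for x y
        using dn_tri[of n x o' y] dn_tri[of n y o' x] dn_sym[of n x y] by (simp add: abs_le_iff)
    qed
    show "scont_on n X \<delta>" by (rule scont_lipschitz[where L = 1]) (use \<delta>_lip XF in auto)
    show "\<And>x. x \<in> X \<Longrightarrow> \<delta> x \<noteq> 0" using \<delta>_pos by force
  qed
  have h1: "1 \<le> h x" if "x \<in> X" for x
    using \<delta>_pos[OF that] unfolding h_def by (simp add: add_increasing add_increasing2)
  have hi: "\<bar>x i\<bar> \<le> h x" if "x \<in> X" "i < n" for x i
  proof -
    have "\<bar>x i\<bar> \<le> dn n x o'" using dn_coord[OF that(2), of x o'] that(2) by (simp add: o'_def)
    moreover have "0 \<le> inverse (\<delta> x)" using \<delta>_pos[OF that(1)] by simp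
    ultimately show ?thesis unfolding h_def by linarith
  qed
  have "definably_compact M n {x \<in> X. h x \<le> r}" for r
    unfolding definably_compact_iff
  proof (intro conjI ballI impI)
    show "definable M n {x \<in> X. h x \<le> r}"
      by (intro definable_Collect[OF dX] dpred_le dsfun_dscal[OF dh] dvect_var dscal_const)
    have "\<bar>x i\<bar> \<le> r" if "x \<in> X" "h x \<le> r" "i < n" for x i using hi[OF that(1,3)] that(2) by linarith
    then show "\<exists>B. \<forall>x\<in>{x \<in> X. h x \<le> r}. \<forall>i<n. \<bar>x i\<bar> \<le> B" by blast
    fix x assume x: "x \<in> Fn n" and lim: "\<forall>s>0. \<exists>y\<in>{x \<in> X. h x \<le> r}. dn n x y < s"
    have xc: "x \<in> clos n X" using x lim unfolding clos_def by blast
    obtain y0 where "y0 \<in> X" "h y0 \<le> r" using lim zero_less_one by blast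
    then have r: "r > 0" using h1[of y0] by (meson le_less_trans less_le_trans not_le zero_less_one)
    have xX: "x \<in> X"
    proof (rule ccontr)
      assume "x \<notin> X"
      then have "\<delta> x = 0" using \<delta>0[OF x] xc unfolding Z_def by blast
      have "1 / r > 0" using r by simp
      with lim obtain y where y: "y \<in> X" "h y \<le> r" "dn n x y < 1 / r" by blast
      \<comment> \<open>\<open>\<delta>\<close> is 1-Lipschitz and vanishes at \<open>x\<close>, so
        it is below \<open>1 / r\<close> near \<open>x\<close>, whereas \<open>h y \<le> r\<close>
        forces \<open>\<delta> y \<ge> 1 / r\<close>.\<close>
      have "\<delta> y < 1 / r" using \<delta>_lip[OF x, of y] y(1,3) XF \<open>\<delta> x = 0\<close> \<delta>_pos[OF y(1)] by auto
      moreover have "inverse (\<delta> y) \<le> r" using y(2) dn_nonneg[of n y o'] unfolding h_def by linarith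
      ultimately show False using \<delta>_pos[OF y(1)] r by (simp add: field_simps)
    qed
    moreover have "h x \<le> r"
    proof (rule ccontr)
      assume "\<not> h x \<le> r"
      then have "h x - r > 0" by simp
      then obtain q where q: "q > 0" "\<And>y. y \<in> X \<Longrightarrow> dn n x y < q \<Longrightarrow> \<bar>h x - h y\<bar> < h x - r"
        using scont_onD[OF ch xX] by blast
      then obtain y where "y \<in> X" "h y \<le> r" "dn n x y < q" using lim by blast
      with q(2)[of y] show False by linarith
    qed
    ultimately show "x \<in> {x \<in> X. h x \<le> r}" by blast
  qed
  with dh ch h1 hi show ?thesis by blast
qed

lemma exhaustion_closed_subset:
  fixes M :: "('a::{linordered_field, linorder_topology}, 'f, 'r) expansion"
  assumes h: "dsfun M n h" "definably_compact M n {x \<in> X. h x \<le> r}" and XF: "X \<subseteq> Fn n"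
    and K: "definable M n K" "K \<subseteq> X" "closedin (top_on n X) K"
  shows "definably_compact M n {x \<in> K. h x \<le> r}"
proof (rule compact_subset[OF h(2)])
  show "definable M n {x \<in> K. h x \<le> r}"
    by (intro definable_Collect[OF K(1)] dpred_le dsfun_dscal[OF h(1)] dvect_var dscal_const)
  show "{x \<in> K. h x \<le> r} \<subseteq> {x \<in> X. h x \<le> r}" using K(2) by blast
  fix x assume x: "x \<in> {x \<in> X. h x \<le> r}" and lim: "\<And>s. s > 0 \<Longrightarrow> \<exists>y\<in>{x \<in> K. h x \<le> r}. dn n x y < s"
  from lim have "\<forall>s>0. \<exists>y\<in>K. dn n x y < s" by blast
  then have "x \<in> K" using K(3) x unfolding closedin_top_on[OF XF] by blast
  with x show "x \<in> {x \<in> K. h x \<le> r}" by blast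
qed

section \<open>Properness of the first projection\<close>

lemma proj1_concat: "x \<in> Fn n \<Longrightarrow> proj1 n (concat_vec n n x y) = x"
  by (rule Fn_eqI[of _ n]) (auto simp: proj1_def concat_vec_def Fn_restrict)

lemma proj2_concat: "y \<in> Fn n \<Longrightarrow> proj2 n (concat_vec n n x y) = y"
  by (rule Fn_eqI[of _ n]) (auto simp: proj2_def concat_vec_def Fn_restrict)

lemma flat_fibre:
  assumes "E \<subseteq> Fn n \<times> Fn n"
  shows "{z \<in> flat n n E. proj2 n z \<in> K \<and> proj1 n z \<in> C} = flat n n {(x, k) \<in> E. k \<in> K \<and> x \<in> C}"
proof
  show "{z \<in> flat n n E. proj2 n z \<in> K \<and> proj1 n z \<in> C} \<subseteq> flat n n {(x, k) \<in> E. k \<in> K \<and> x \<in> C}"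
  proof
    fix z assume z: "z \<in> {z \<in> flat n n E. proj2 n z \<in> K \<and> proj1 n z \<in> C}"
    then obtain x y where xy: "(x, y) \<in> E" "z = concat_vec n n x y" unfolding flat_def by auto
    then have "x \<in> Fn n" "y \<in> Fn n" using assms by auto
    then have "(x, y) \<in> {(x, k) \<in> E. k \<in> K \<and> x \<in> C}" using z xy by (simp add: proj1_concat proj2_concat)
    then show "z \<in> flat n n {(x, k) \<in> E. k \<in> K \<and> x \<in> C}" unfolding flat_def xy(2) by (force intro: rev_image_eqI)
  qed
  show "flat n n {(x, k) \<in> E. k \<in> K \<and> x \<in> C} \<subseteq> {z \<in> flat n n E. proj2 n z \<in> K \<and> proj1 n z \<in> C}"
  proof
    fix z assume "z \<in> flat n n {(x, k) \<in> E. k \<in> K \<and> x \<in> C}"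
    then obtain x y where xy: "(x, y) \<in> E" "y \<in> K" "x \<in> C" "z = concat_vec n n x y" unfolding flat_def by auto
    then have "x \<in> Fn n" "y \<in> Fn n" using assms by auto
    with xy show "z \<in> {z \<in> flat n n E. proj2 n z \<in> K \<and> proj1 n z \<in> C}"
      by (auto simp: proj1_concat proj2_concat flat_def intro: rev_image_eqI)
  qed
qed

context
  fixes M :: "('a::{linordered_field, linorder_topology}, 'f, 'r) expansion"
    and n :: nat and X K :: "(nat \<Rightarrow> 'a) set" and E :: "((nat \<Rightarrow> 'a) \<times> (nat \<Rightarrow> 'a)) set"
  assumes dX: "definable M n X" and EX: "E \<subseteq> X \<times> X" and dE: "definable M (n + n) (flat n n E)"
    and dK: "definable M n K"
begin

lemma definable_fibre: "definable M (n + n) (flat n n {(x, k) \<in> E. k \<in> K})"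
proof -
  have "E \<subseteq> Fn n \<times> Fn n" using EX definable_subset[OF dX] by blast
  from definable_flat_restrict[OF dE this dX dK] show ?thesis
    by (rule back_subst[where P = "\<lambda>R. definable M (n + n) (flat n n R)"]) (use EX in blast)
qed

text \<open>Definability and continuity of the projection come for free, so properness is a
  condition on preimages only. It is restated with sets of pairs, the form in which both directions
  of the theorem handle it.\<close>

lemma definably_proper_proj1_iff:
  "definably_proper M (n + n) n {z \<in> flat n n E. proj2 n z \<in> K} X (proj1 n) \<longleftrightarrow>
    (\<forall>C. definably_compact M n C \<and> C \<subseteq> X \<longrightarrow>
      definably_compact M (n + n) (flat n n {(x, k) \<in> E. k \<in> K \<and> x \<in> C}))"
proof -
  have XF: "X \<subseteq> Fn n" using definable_subset[OF dX] .
  have EF: "E \<subseteq> Fn n \<times> Fn n" using EX XF by blast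
  define Z where "Z = {z \<in> flat n n E. proj2 n z \<in> K}"
  have Z: "Z = flat n n {(x, k) \<in> E. k \<in> K}" unfolding Z_def using flat_fibre[OF EF, of K UNIV] by simp
  have ZF: "Z \<subseteq> Fn (n + n)" unfolding Z flat_def using concat_vec_Fn by auto
  have "proj1 n (concat_vec n n x k) \<in> X" if "(x, k) \<in> E" for x k
  proof -
    have "x \<in> X" using that EX by blast
    then show ?thesis using proj1_concat[of x n k] XF by auto
  qed
  then have p: "proj1 n ` Z \<subseteq> X" unfolding Z flat_def by auto
  have "definable_map M (n + n) n Z X (proj1 n)"
  proof (rule definable_mapI)
    show "dfun M (n + n) n (proj1 n)"
      unfolding proj1_def by (rule dfun_coordI) (rule dsfun_coord, simp)
  qed (use dX p definable_fibre in \<open>simp_all add: Z\<close>)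
  moreover have "cont_on (n + n) n Z (proj1 n)"
  proof (rule cont_coordI)
    fix i assume "i < n"
    then show "scont_on (n + n) Z (\<lambda>x. proj1 n x i)" by (simp add: proj1_def scont_coord)
  qed
  then have "continuous_map (top_on (n + n) Z) (top_on n X) (proj1 n)"
    unfolding continuous_map_iff_cont_on[OF ZF XF] using p by blast
  moreover have "{z \<in> Z. proj1 n z \<in> C} = flat n n {(x, k) \<in> E. k \<in> K \<and> x \<in> C}" for C
    unfolding flat_fibre[OF EF, symmetric] Z_def by blast
  ultimately show ?thesis
    unfolding definably_proper_def definable_continuous_map_def Z_def[symmetric] by simp
qed

lemma surj_proj1_iff: "proj1 n ` {z \<in> flat n n E. proj2 n z \<in> K} = X \<longleftrightarrow> (\<forall>x\<in>X. \<exists>k\<in>K. (x, k) \<in> E)"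
proof -
  have EF: "E \<subseteq> Fn n \<times> Fn n" using EX definable_subset[OF dX] by blast
  have "{z \<in> flat n n E. proj2 n z \<in> K} = flat n n {(x, k) \<in> E. k \<in> K}"
    using flat_fibre[OF EF, of K UNIV] by simp
  moreover have "proj1 n ` flat n n {(x, k) \<in> E. k \<in> K} = {x. \<exists>k\<in>K. (x, k) \<in> E}"
    using EF by (force simp: flat_def image_iff proj1_concat)
  ultimately show ?thesis using EX by auto
qed

end

section \<open>From quotients to proper projections\<close>

lemma vec1_Fn: "vec1 t \<in> Fn 1"
  unfolding vec1_def by (rule Fn_restrict)

lemma vec1_0 [simp]: "vec1 t 0 = t"
  by (simp add: vec1_def)

lemma vec1_mem_iff: "vec1 t \<in> vec1 ` D \<longleftrightarrow> t \<in> D"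
  by (metis image_iff vec1_0)

text \<open>Definable choice is applied to the projection of \<open>F^(1+m)\<close> to its first
  coordinate. A selected point of \<open>V\<close> over \<open>t\<close> starts with
  \<open>t\<close>, and \<open>\<psi>\<close> is the rest of it.\<close>

lemma definable_curve:
  fixes M :: "('a::{linordered_field, linorder_topology}, 'f, 'r) expansion"
  assumes ch: "definable_choice M" and D: "definable M 1 (vec1 ` D)"
    and P: "dpred M (\<lambda>e. P (e 0) (\<lambda>i\<in>{..<m}. e (Suc i)))"
    and ne: "\<And>t. t \<in> D \<Longrightarrow> \<exists>y\<in>Fn m. P t y"
  shows "\<exists>\<psi>. dfun M 1 m \<psi> \<and> (\<forall>t\<in>D. P t (\<psi> (vec1 t)))"
proof -
  define V where "V = {z \<in> Fn (1 + m). (\<lambda>i\<in>{..<1}. z i) \<in> vec1 ` D \<and> P (z 0) (\<lambda>i\<in>{..<m}. z (Suc i))}"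
  have dV: "definable M (1 + m) V"
    unfolding V_def
  proof (rule definableI, rule dpred_conj)
    have "dvect M 1 (\<lambda>e. \<lambda>i\<in>{..<1}. (\<lambda>i\<in>{..<1 + m}. e i) i)" by (intro dvectI dscal_nth)
    then show "dpred M (\<lambda>e. (\<lambda>i\<in>{..<1}. (\<lambda>i\<in>{..<1 + m}. e i) i) \<in> vec1 ` D)" by (rule dpred_mem[OF D])
    show "dpred M (\<lambda>e. P ((\<lambda>i\<in>{..<1 + m}. e i) 0) (\<lambda>i\<in>{..<m}. (\<lambda>i\<in>{..<1 + m}. e i) (Suc i)))"
      using P by (simp cong: restrict_cong)
  qed
  have proj: "coord_proj 1 id ` V = vec1 ` D"
  proof
    show "coord_proj 1 id ` V \<subseteq> vec1 ` D" unfolding V_def coord_proj_def by auto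
    show "vec1 ` D \<subseteq> coord_proj 1 id ` V"
    proof
      fix x assume "x \<in> vec1 ` D"
      then obtain t where t: "t \<in> D" "x = vec1 t" by blast
      obtain y where y: "y \<in> Fn m" "P t y" using ne[OF t(1)] by blast
      define z where "z = concat_vec 1 m (vec1 t) y"
      have z1: "(\<lambda>i\<in>{..<1}. z i) = vec1 t"
        by (rule Fn_eqI[OF Fn_restrict vec1_Fn]) (simp add: z_def concat_vec_def)
      have z2: "(\<lambda>i\<in>{..<m}. z (Suc i)) = y"
        by (rule Fn_eqI[OF Fn_restrict y(1)]) (simp add: z_def concat_vec_def)
      have "z 0 = t" by (simp add: z_def concat_vec_def)
      then have "z \<in> V" unfolding V_def using z1 z2 y(2) t(1) concat_vec_Fn[of 1 m] by (auto simp: z_def)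
      moreover have "coord_proj 1 id z = x" unfolding coord_proj_def id_apply z1 t(2) ..
      ultimately show "x \<in> coord_proj 1 id ` V" by blast
    qed
  qed
  have "strict_mono_on {..<1} (id :: nat \<Rightarrow> nat) \<and> id ` {..<1} \<subseteq> {..<1 + m} \<and>
      definable M 1 (vec1 ` D) \<and> definable M (1 + m) V \<and> coord_proj 1 id ` V = vec1 ` D"
    using D dV proj by (auto simp: strict_mono_on_def)
  then have "\<exists>\<phi>. definable_map M 1 (1 + m) (vec1 ` D) V \<phi> \<and> (\<forall>x\<in>vec1 ` D. coord_proj 1 id (\<phi> x) = x)"
    by (rule mp[OF ch[unfolded definable_choice_def, THEN conjunct1, THEN spec, of 1, THEN spec, of m,
        THEN spec, of id, THEN spec, of "vec1 ` D", THEN spec, of V]])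
  then obtain \<phi> where \<phi>: "definable_map M 1 (1 + m) (vec1 ` D) V \<phi>"
    "\<And>x. x \<in> vec1 ` D \<Longrightarrow> coord_proj 1 id (\<phi> x) = x" by blast
  define \<Phi> where "\<Phi> x = (if x \<in> vec1 ` D then \<phi> x else (\<lambda>i\<in>{..<1 + m}. 0))" for x
  have d\<Phi>: "dfun M 1 (1 + m) \<Phi>" unfolding \<Phi>_def by (rule definable_map_dfun[OF \<phi>(1)])
  define \<psi> where "\<psi> x = (\<lambda>i\<in>{..<m}. \<Phi> x (Suc i))" for x
  have "dfun M 1 m \<psi>"
    unfolding \<psi>_def by (rule dfun_coordI) (rule dsfun_nth[OF d\<Phi>], simp)
  moreover have "P t (\<psi> (vec1 t))" if t: "t \<in> D" for t
  proof -
    have tD: "vec1 t \<in> vec1 ` D" using t by simp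
    then have "\<phi> (vec1 t) \<in> V" using \<phi>(1) unfolding definable_map_def by blast
    moreover have "\<phi> (vec1 t) 0 = t"
      using fun_cong[OF \<phi>(2)[OF tD], of 0] by (simp add: coord_proj_def)
    ultimately show ?thesis using tD unfolding V_def \<psi>_def \<Phi>_def by simp
  qed
  ultimately show ?thesis by blast
qed

lemma good_pseudo_filterE:
  fixes M :: "('a::{linordered_field, linorder_topology}, 'f, 'r) expansion"
  assumes "good_pseudo_filter M \<DD>"
  obtains D where "D \<in> \<DD>"
    and "\<And>D. D \<in> \<DD> \<Longrightarrow> definable1 M D \<and> D \<subseteq> {0<..} \<and> 0 \<in> closure D"
    and "\<And>D. D \<in> \<DD> \<Longrightarrow> (\<exists>a b. D \<subseteq> {a..b}) \<and> closure D = D \<union> {0}"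
    and "\<And>D n \<gamma>. D \<in> \<DD> \<Longrightarrow> definable_map1 M n D \<gamma> \<Longrightarrow>
        \<exists>D'\<in>\<DD>. D' \<subseteq> D \<and> continuous_map (top_of_set D') (Fn_top n) \<gamma>"
proof -
  note * = assms[unfolded good_pseudo_filter_def]
  obtain D where "D \<in> \<DD>" using *[THEN conjunct1] by blast
  moreover have "definable1 M D \<and> D \<subseteq> {0<..} \<and> 0 \<in> closure D" if "D \<in> \<DD>" for D
    using bspec[OF *[THEN conjunct2, THEN conjunct1] that] .
  moreover have "(\<exists>a b. D \<subseteq> {a..b}) \<and> closure D = D \<union> {0}" if "D \<in> \<DD>" for D
    using bspec[OF *[THEN conjunct2, THEN conjunct2, THEN conjunct1] that] .
  moreover have "\<exists>D'\<in>\<DD>. D' \<subseteq> D \<and> continuous_map (top_of_set D') (Fn_top n) \<gamma>"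
    if "D \<in> \<DD>" "definable_map1 M n D \<gamma>" for D n \<gamma>
    using bspec[OF *[THEN conjunct2, THEN conjunct2, THEN conjunct2, THEN conjunct2] that(1)] that(2) by blast
  ultimately show ?thesis by (rule that)
qed

lemma abs_ball_closure:
  fixes D :: "'a::{linordered_field, linorder_topology} set"
  shows "p \<in> closure D \<longleftrightarrow> (\<forall>s>0. \<exists>t\<in>D. \<bar>t - p\<bar> < s)"
proof
  assume p: "p \<in> closure D"
  show "\<forall>s>0. \<exists>t\<in>D. \<bar>t - p\<bar> < s"
  proof (intro allI impI)
    fix s :: 'a assume "s > 0"
    then have "open {p - s<..<p + s}" "p \<in> {p - s<..<p + s}" by auto
    then obtain t where "t \<in> D" "t \<in> {p - s<..<p + s}"
      using p open_Int_closure_eq_empty[of "{p - s<..<p + s}" D] by blast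
    then show "\<exists>t\<in>D. \<bar>t - p\<bar> < s" by (intro bexI[of _ t]) (auto simp: abs_less_iff algebra_simps)
  qed
next
  assume *: "\<forall>s>0. \<exists>t\<in>D. \<bar>t - p\<bar> < s"
  show "p \<in> closure D"
  proof (rule ccontr)
    assume "p \<notin> closure D"
    then obtain s where "s > 0" "\<And>y. \<bar>y - p\<bar> < s \<Longrightarrow> y \<in> - closure D"
      using open_abs_ball[of "- closure D" p] by auto
    with * closure_subset show False by blast
  qed
qed

text \<open>
  The domains provided by the pseudo-filter need not be intervals; what survives of a curve selection
  lemma is a continuous definable curve on a bounded set \<open>D \<subseteq> (0, \<infinity>)\<close> that accumulates at \<open>0\<close> and is
  closed in \<open>(0, \<infinity>)\<close>.
\<close>

lemma curve_selection:
  fixes M :: "('a::{linordered_field, linorder_topology}, 'f, 'r) expansion"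
  assumes ch: "definable_choice M" and pf: "good_pseudo_filter M \<DD>"
    and P: "dpred M (\<lambda>e. P (e 0) (\<lambda>i\<in>{..<m}. e (Suc i)))"
    and ne: "\<And>t. t > 0 \<Longrightarrow> \<exists>y\<in>Fn m. P t y"
  shows "\<exists>D \<psi> b. definable M 1 (vec1 ` D) \<and> D \<subseteq> {0<..b} \<and> (\<forall>s>0. \<exists>t\<in>D. t < s) \<and>
    (\<forall>p>0. (\<forall>s>0. \<exists>t\<in>D. \<bar>t - p\<bar> < s) \<longrightarrow> p \<in> D) \<and> dfun M 1 m \<psi> \<and> (\<forall>t\<in>D. P t (\<psi> (vec1 t))) \<and>
    (\<forall>p\<in>D. \<forall>s>0. \<exists>r>0. \<forall>t\<in>D. \<bar>t - p\<bar> < r \<longrightarrow> dn m (\<psi> (vec1 p)) (\<psi> (vec1 t)) < s)"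
proof -
  obtain D0 where D0: "D0 \<in> \<DD>"
    and pf1: "\<And>D. D \<in> \<DD> \<Longrightarrow> definable1 M D \<and> D \<subseteq> {0<..} \<and> 0 \<in> closure D"
    and pf2: "\<And>D. D \<in> \<DD> \<Longrightarrow> (\<exists>a b. D \<subseteq> {a..b}) \<and> closure D = D \<union> {0}"
    and pf3: "\<And>D n \<gamma>. D \<in> \<DD> \<Longrightarrow> definable_map1 M n D \<gamma> \<Longrightarrow>
        \<exists>D'\<in>\<DD>. D' \<subseteq> D \<and> continuous_map (top_of_set D') (Fn_top n) \<gamma>"
    using good_pseudo_filterE[OF pf] by metis
  have dD0: "definable M 1 (vec1 ` D0)" "D0 \<subseteq> {0<..}" using pf1[OF D0] unfolding definable1_def by auto
  have "\<exists>\<psi>. dfun M 1 m \<psi> \<and> (\<forall>t\<in>D0. P t (\<psi> (vec1 t)))"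
    by (rule definable_curve[OF ch dD0(1) P]) (use ne dD0(2) in auto)
  then obtain \<psi> where \<psi>: "dfun M 1 m \<psi>" "\<forall>t\<in>D0. P t (\<psi> (vec1 t))" by blast
  have "definable_map1 M m D0 (\<lambda>t. \<psi> (vec1 t))"
    unfolding definable_map1_def
    by (rule definable_mapI[OF dD0(1) definable_Fn _ \<psi>(1)]) (use dfun_Fn[OF \<psi>(1) vec1_Fn] in auto)
  then obtain D where D: "D \<in> \<DD>" "D \<subseteq> D0"
    and cont: "continuous_map (top_of_set D) (Fn_top m) (\<lambda>t. \<psi> (vec1 t))"
    using pf3[OF D0] by blast
  obtain a b where ab: "D \<subseteq> {a..b}" using pf2[OF D(1)] by blast
  show ?thesis
  proof (intro exI conjI)
    show "definable M 1 (vec1 ` D)" using pf1[OF D(1)] unfolding definable1_def by blast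
    show "D \<subseteq> {0<..b}" using ab pf1[OF D(1)] by (auto simp: subset_iff)
    have "\<exists>t\<in>D. t < s" if "s > 0" for s
      using pf1[OF D(1)] that unfolding abs_ball_closure by fastforce
    then show "\<forall>s>0. \<exists>t\<in>D. t < s" by blast
    have "p \<in> D" if "p > 0" "\<forall>s>0. \<exists>t\<in>D. \<bar>t - p\<bar> < s" for p
    proof -
      have "p \<in> closure D" using that(2) unfolding abs_ball_closure by blast
      then show ?thesis using pf2[OF D(1)] that(1) by auto
    qed
    then show "\<forall>p>0. (\<forall>s>0. \<exists>t\<in>D. \<bar>t - p\<bar> < s) \<longrightarrow> p \<in> D" by blast
    show "\<forall>t\<in>D. P t (\<psi> (vec1 t))" using \<psi>(2) D(2) by blast
    have "\<exists>r>0. \<forall>t\<in>D. \<bar>t - p\<bar> < r \<longrightarrow> dn m (\<psi> (vec1 p)) (\<psi> (vec1 t)) < s" if p: "p \<in> D" and s: "s > 0" for p s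
    proof -
      define U where "U = {y \<in> Fn m. dn m (\<psi> (vec1 p)) y < s}"
      have "openin (Fn_top m) U"
        unfolding openin_Fn_top
      proof (intro conjI ballI)
        fix x assume x: "x \<in> U"
        show "\<exists>q>0. \<forall>y\<in>Fn m. dn m x y < q \<longrightarrow> y \<in> U"
        proof (intro exI conjI ballI impI)
          show "s - dn m (\<psi> (vec1 p)) x > 0" using x unfolding U_def by simp
          fix y assume "y \<in> Fn m" "dn m x y < s - dn m (\<psi> (vec1 p)) x"
          moreover from this(2) have "dn m (\<psi> (vec1 p)) y < s" using dn_tri[of m "\<psi> (vec1 p)" y x] by linarith
          ultimately show "y \<in> U" unfolding U_def by simp
        qed
      qed (auto simp: U_def)
      from openin_continuous_map_preimage[OF cont this]
      have "openin (top_of_set D) {t \<in> D. \<psi> (vec1 t) \<in> U}" by simp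
      then obtain T where T: "open T" "{t \<in> D. \<psi> (vec1 t) \<in> U} = D \<inter> T" unfolding openin_open by blast
      have "\<psi> (vec1 p) \<in> U" unfolding U_def using dfun_Fn[OF \<psi>(1) vec1_Fn] s by simp
      then have "p \<in> T" using T(2) p by blast
      then obtain r where r: "r > 0" "\<And>t. \<bar>t - p\<bar> < r \<Longrightarrow> t \<in> T" using open_abs_ball[OF T(1)] by metis
      then have "\<psi> (vec1 t) \<in> U" if "t \<in> D" "\<bar>t - p\<bar> < r" for t using T(2) that by blast
      with r(1) show ?thesis unfolding U_def by blast
    qed
    then show "\<forall>p\<in>D. \<forall>s>0. \<exists>r>0. \<forall>t\<in>D. \<bar>t - p\<bar> < r \<longrightarrow> dn m (\<psi> (vec1 p)) (\<psi> (vec1 t)) < s"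
      by blast
  qed (rule \<psi>(1))
qed

text \<open>Since \<open>f\<close> is identifying, a definable subset of \<open>Y\<close> with
  closed preimage is closed. If \<open>h\<close> were unbounded, a definable curve in
  \<open>Y\<close> would approach \<open>F x0\<close> through images of points
  \<open>k \<in> K0\<close> with \<open>h k\<close> tending to infinity. But \<open>h\<close> is
  bounded near each \<open>x \<in> X\<close>, and \<open>h k\<close> exceeds \<open>h\<close> at
  related points by at most 1. So only parameters bounded away from 0 matter near \<open>x\<close>,
  which makes the preimage of the image \<open>Z\<close> closed, although \<open>Z\<close> misses
  \<open>F x0\<close>.\<close>

lemma identifying_bounded:
  fixes M :: "('a::{linordered_field, linorder_topology}, 'f, 'r) expansion"
  assumes M: "definably_complete M" and ch: "definable_choice M" and pf: "good_pseudo_filter M \<DD>"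
    and dX: "definable M n X" and dE: "definable M (n + n) (flat n n E)" and EX: "E \<subseteq> X \<times> X"
    and Q: "definable_quotient M n m X E Y f"
    and h: "dsfun M n h" "scont_on n X h" "\<And>x. x \<in> X \<Longrightarrow> 1 \<le> h x"
    and dK0: "definable M n K0" and K0X: "K0 \<subseteq> X"
    and K0: "\<And>k x. k \<in> K0 \<Longrightarrow> (k, x) \<in> E \<Longrightarrow> h k \<le> h x + 1"
    and K: "K = {x \<in> X. \<forall>s>0. \<exists>y\<in>K0. dn n x y < s}"
    and C: "definably_compact M n C" "C \<subseteq> X"
  shows "\<exists>r. \<forall>(x, k)\<in>E. x \<in> C \<and> k \<in> K \<longrightarrow> h k \<le> r"
proof (rule ccontr)
  assume "\<not> ?thesis"
  then have unb: "\<exists>x k. (x, k) \<in> E \<and> x \<in> C \<and> k \<in> K \<and> r < h k" for r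
    by (metis (no_types, lifting) case_prodI2 not_le)
  have XF: "X \<subseteq> Fn n" using definable_subset[OF dX] .
  have EF: "E \<subseteq> Fn n \<times> Fn n" using EX XF by blast
  have ident: "definably_identifying M n m X Y f" and fE: "\<And>x y. x \<in> X \<Longrightarrow> y \<in> X \<Longrightarrow> f x = f y \<longleftrightarrow> (x, y) \<in> E"
    using Q unfolding definable_quotient_def by auto
  have fmap: "definable_map M n m X Y f" and fc: "continuous_map (top_on n X) (top_on m Y) f"
    and fXY: "f ` X = Y" using ident unfolding definably_identifying_def definable_continuous_map_def by auto
  have closing: "closedin (top_on m Y) Z"
    if "definable M m Z" "Z \<subseteq> Y" "closedin (top_on n X) {x \<in> X. f x \<in> Z}" for Z
    using ident[unfolded definably_identifying_def, THEN conjunct2, THEN conjunct2] that by simp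
  have dY: "definable M m Y" using fmap unfolding definable_map_def by blast
  have YF: "Y \<subseteq> Fn m" using definable_subset[OF dY] .
  define F where "F x = (if x \<in> X then f x else (\<lambda>i\<in>{..<m}. 0))" for x
  have dF: "dfun M n m F" unfolding F_def by (rule definable_map_dfun[OF fmap])
  have cF: "cont_on n m X F"
    by (rule cont_cong[of n m X f]) (use fc in \<open>auto simp: continuous_map_iff_cont_on[OF XF YF] F_def\<close>)
  have FE: "F x = F y \<longleftrightarrow> (x, y) \<in> E" if "x \<in> X" "y \<in> X" for x y using fE that by (simp add: F_def)
  have FY: "F x \<in> Y" if "x \<in> X" for x using fXY that by (auto simp: F_def)

  \<comment> \<open>Unboundedness on \<open>K\<close> is moved to \<open>K0\<close> by continuity of
    \<open>h\<close> and \<open>F\<close>, because the comparison with related points is known on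
    \<open>K0\<close> only; the price is that related points become points with nearby
    images.\<close>
  define P where "P s x \<longleftrightarrow> (\<exists>k\<in>K0. 1 < s * h k \<and> dn m (F k) (F x) < s)" for s x
  have "\<exists>p\<in>C. \<forall>s>0. \<exists>x\<in>C. P s x \<and> dn n x p < s"
  proof (rule definably_compact_limit_point[OF M C(1)])
    show "dpred M (\<lambda>e. P (e 0) (\<lambda>i\<in>{..<n}. e (Suc i)))"
      unfolding P_def
      by (intro dpred_bex[OF dK0] dpred_conj dpred_less dscal_mult dscal_const dscal_var
          dsfun_dscal[OF h(1)] dscal_dn dfun_dvect[OF dF] dvect_var)
    show "P t x" if "P s x" "s \<le> t" for s t x
    proof -
      obtain k where k: "k \<in> K0" "1 < s * h k" "dn m (F k) (F x) < s" using \<open>P s x\<close> unfolding P_def by blast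
      have "0 \<le> h k" using h(3)[of k] k(1) K0X by (meson order_trans subsetD zero_le_one)
      then have "s * h k \<le> t * h k" using that(2) by (rule mult_right_mono[rotated])
      then show ?thesis unfolding P_def using k that(2) by (intro bexI[of _ k]) auto
    qed
    show "\<exists>x\<in>C. P s x" if s: "s > 0" for s
    proof -
      obtain x k where xk: "(x, k) \<in> E" "x \<in> C" "k \<in> K" "1 / s + 1 < h k" using unb by blast
      have kX: "k \<in> X" using xk(3) K by blast
      obtain r1 where r1: "r1 > 0" "\<And>y. y \<in> X \<Longrightarrow> dn n k y < r1 \<Longrightarrow> \<bar>h k - h y\<bar> < 1"
        using scont_onD[OF h(2) kX, of 1] by auto
      obtain r2 where r2: "r2 > 0" "\<And>y. y \<in> X \<Longrightarrow> dn n k y < r2 \<Longrightarrow> dn m (F k) (F y) < s"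
        using cont_onD[OF cF kX s] by blast
      have "0 < min r1 r2" using r1(1) r2(1) by simp
      then obtain k0 where k0: "k0 \<in> K0" "dn n k k0 < min r1 r2" using xk(3) unfolding K by blast
      have "k0 \<in> X" using k0(1) K0X by blast
      have "\<bar>h k - h k0\<bar> < 1" using r1(2)[OF \<open>k0 \<in> X\<close>] k0(2) by simp
      then have "1 / s < h k0" using xk(4) by linarith
      then have "1 < s * h k0" using s by (simp add: field_simps)
      moreover have "F x = F k" using FE xk(1) EX by blast
      then have "dn m (F k0) (F x) < s" using r2(2)[OF \<open>k0 \<in> X\<close>] k0(2) by (simp add: dn_sym)
      ultimately show ?thesis using k0(1) xk(2) unfolding P_def by blast
    qed
  qed
  then obtain x0 where x0: "x0 \<in> C" "\<And>s. s > 0 \<Longrightarrow> \<exists>x\<in>C. P s x \<and> dn n x x0 < s" by blast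
  have x0X: "x0 \<in> X" using x0(1) C(2) by blast
  have x0F: "x0 \<in> Fn n" using x0X XF by blast
  have hx0: "1 \<le> h x0" by (rule h(3)[OF x0X])

  \<comment> \<open>The term \<open>1 / t\<close> drives \<open>h k\<close> to infinity as
    \<open>t\<close> tends to 0; the surplus \<open>h x0 + 1\<close> prevents \<open>k\<close> from
    being related to \<open>x0\<close>, so the curve avoids \<open>F x0\<close>. The curve is
    selected in \<open>Y\<close> and \<open>k\<close> stays quantified, as no continuity in
    \<open>k\<close> is needed.\<close>
  define Q where "Q t y \<longleftrightarrow> (\<exists>k\<in>K0. y = F k \<and> 1 / t + h x0 + 1 < h k \<and> dn m (F k) (F x0) < t)" for t y
  have Q_ne: "\<exists>y\<in>Fn m. Q t y" if t: "t > 0" for t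
  proof -
    define c where "c = 1 / t + h x0 + 1"
    have c: "c > 0" using t hx0 unfolding c_def by (simp add: add_pos_pos)
    have "t / 2 > 0" using t by simp
    then obtain r where r: "r > 0" "\<And>y. y \<in> X \<Longrightarrow> dn n x0 y < r \<Longrightarrow> dn m (F x0) (F y) < t / 2"
      using cont_onD[OF cF x0X] by blast
    \<comment> \<open>\<open>t / 2\<close> serves the triangle inequality, \<open>r\<close> the
      continuity of \<open>F\<close> at \<open>x0\<close>, and \<open>1 / c\<close> turns
      \<open>1 < s * h k\<close> into \<open>c < h k\<close>.\<close>
    define s where "s = min (t / 2) (min r (1 / c))"
    have s: "s > 0" using t r(1) c by (simp add: s_def)
    obtain x k where xk: "x \<in> C" "dn n x x0 < s" "k \<in> K0" "1 < s * h k" "dn m (F k) (F x) < s"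
      using x0(2)[OF s] unfolding P_def by blast
    have "k \<in> X" "x \<in> X" using xk K0X C(2) by auto
    have "1 \<le> h k" by (rule h(3)[OF \<open>k \<in> X\<close>])
    then have "s * h k \<le> 1 / c * h k" by (intro mult_right_mono) (auto simp: s_def)
    then have "1 < h k / c" using xk(4) by simp
    then have "c < h k" using c by (simp add: pos_less_divide_eq)
    moreover have "dn m (F x0) (F x) < t / 2" using r(2)[OF \<open>x \<in> X\<close>] xk(2) by (simp add: dn_sym s_def)
    then have "dn m (F k) (F x0) < t"
      using dn_tri[of m "F k" "F x0" "F x"] xk(5) dn_sym[of m "F x" "F x0"] by (simp add: s_def)
    ultimately have "Q t (F k)" unfolding Q_def c_def using xk(3) by blast
    moreover have "F k \<in> Fn m" using FY[OF \<open>k \<in> X\<close>] YF by blast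
    ultimately show ?thesis by blast
  qed
  have dQ: "dpred M (\<lambda>e. Q (e 0) (\<lambda>i\<in>{..<m}. e (Suc i)))"
    unfolding Q_def using dfun_Fn[OF dF x0F]
    by (intro dpred_bex[OF dK0] dpred_conj dpred_less dpred_vect_eq[where n = m] dscal_add dscal_divide
        dscal_const dscal_var dsfun_dscal[OF h(1)] dscal_dn dfun_dvect[OF dF] dvect_var dvect_const)
  define sel where "sel D \<psi> b \<longleftrightarrow> definable M 1 (vec1 ` D) \<and> D \<subseteq> {0<..b} \<and> (\<forall>s>0. \<exists>t\<in>D. t < s) \<and>
    (\<forall>p>0. (\<forall>s>0. \<exists>t\<in>D. \<bar>t - p\<bar> < s) \<longrightarrow> p \<in> D) \<and> dfun M 1 m \<psi> \<and> (\<forall>t\<in>D. Q t (\<psi> (vec1 t))) \<and>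
    (\<forall>p\<in>D. \<forall>s>0. \<exists>r>0. \<forall>t\<in>D. \<bar>t - p\<bar> < r \<longrightarrow> dn m (\<psi> (vec1 p)) (\<psi> (vec1 t)) < s)" for D \<psi> b
  have "\<exists>D \<psi> b. sel D \<psi> b"
    unfolding sel_def by (rule curve_selection[OF ch pf dQ]) (rule Q_ne)
  then obtain D \<psi> b where *: "sel D \<psi> b" by blast
  then have D: "definable M 1 (vec1 ` D)" "D \<subseteq> {0<..b}" "\<And>s. s > 0 \<Longrightarrow> \<exists>t\<in>D. t < s"
    "\<And>p. p > 0 \<Longrightarrow> (\<And>s. s > 0 \<Longrightarrow> \<exists>t\<in>D. \<bar>t - p\<bar> < s) \<Longrightarrow> p \<in> D"
    and \<psi>: "dfun M 1 m \<psi>" "\<And>t. t \<in> D \<Longrightarrow> Q t (\<psi> (vec1 t))"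
    "\<And>p s. p \<in> D \<Longrightarrow> s > 0 \<Longrightarrow> \<exists>r>0. \<forall>t\<in>D. \<bar>t - p\<bar> < r \<longrightarrow> dn m (\<psi> (vec1 p)) (\<psi> (vec1 t)) < s"
    unfolding sel_def by simp_all
  define Z where "Z = \<psi> ` vec1 ` D"
  have dZ: "definable M m Z" unfolding Z_def by (rule definable_image[OF D(1) \<psi>(1)])
  have ZY: "Z \<subseteq> Y" using \<psi>(2) FY K0X unfolding Z_def Q_def by fastforce
  have "closedin (top_on n X) {x \<in> X. f x \<in> Z}"
    unfolding closedin_top_on[OF XF]
  proof (intro conjI ballI impI)
    fix x assume x: "x \<in> X" and lim: "\<forall>s>0. \<exists>y\<in>{x \<in> X. f x \<in> Z}. dn n x y < s"
    \<comment> \<open>One unit for the variation of \<open>h\<close> near \<open>x\<close> and one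
      for the slack in \<open>K0\<close>: every parameter \<open>t\<close> that contributes near
      \<open>x\<close> has \<open>1 / t < R\<close>.\<close>
    define R where "R = h x + 2"
    have R: "R > 0" using h(3)[OF x] unfolding R_def by linarith
    have FxF: "F x \<in> Fn m" using FY[OF x] YF by blast
    define T where "T s t \<longleftrightarrow> t \<in> D \<and> 1 \<le> R * t \<and> dn m (F x) (\<psi> (vec1 t)) < s" for s t
    have "\<exists>p. \<forall>s>0. \<exists>t. T s t \<and> \<bar>t - p\<bar> < s"
    proof (rule definable_limit_point1[OF M, where B = b])
      have v1: "dvect M 1 (\<lambda>e. vec1 (e 1))" unfolding vec1_def by (rule dvectI) (rule dscal_var)
      have "dpred M (\<lambda>e. vec1 (e 1) \<in> vec1 ` D \<and> 1 \<le> R * e 1 \<and> dn m (F x) (\<psi> (vec1 (e 1))) < e 0)"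
        by (intro dpred_conj dpred_mem[OF D(1)] dpred_le dpred_less dscal_const dscal_mult dscal_var dscal_dn
            dvect_const FxF dfun_dvect[OF \<psi>(1)] v1)
      then show "dpred M (\<lambda>e. T (e 0) (e 1))" unfolding T_def by (simp add: vec1_mem_iff)
      show "\<exists>t. T s t" if s: "s > 0" for s
      proof -
        obtain r1 where r1: "r1 > 0" "\<And>y. y \<in> X \<Longrightarrow> dn n x y < r1 \<Longrightarrow> \<bar>h x - h y\<bar> < 1"
          using scont_onD[OF h(2) x, of 1] by auto
        obtain r2 where r2: "r2 > 0" "\<And>y. y \<in> X \<Longrightarrow> dn n x y < r2 \<Longrightarrow> dn m (F x) (F y) < s"
          using cont_onD[OF cF x s] by blast
        have "0 < min r1 r2" using r1(1) r2(1) by simp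
        then obtain y where y: "y \<in> X" "f y \<in> Z" "dn n x y < min r1 r2" using lim by blast
        then obtain t where t: "t \<in> D" "F y = \<psi> (vec1 t)" unfolding Z_def F_def by auto
        then obtain k where k: "k \<in> K0" "F y = F k" "1 / t + h x0 + 1 < h k" using \<psi>(2)[OF t(1)] unfolding Q_def by auto
        have tpos: "t > 0" using t(1) D(2) by auto
        have "(k, y) \<in> E" using FE[of k y] k(1,2) K0X y(1) by auto
        then have "h k \<le> h y + 1" using K0 k(1) by blast
        moreover have "\<bar>h x - h y\<bar> < 1" using r1(2)[OF y(1)] y(3) by simp
        ultimately have "1 / t < R" using k(3) hx0 unfolding R_def by linarith
        then have "1 \<le> R * t" using tpos by (simp add: field_simps)
        moreover have "dn m (F x) (\<psi> (vec1 t)) < s" using r2(2)[OF y(1)] y(3) t(2) by simp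
        ultimately show ?thesis using t(1) unfolding T_def by blast
      qed
      show "\<And>s t x. T s x \<Longrightarrow> s \<le> t \<Longrightarrow> T t x" unfolding T_def by auto
      show "\<And>s t. s > 0 \<Longrightarrow> T s t \<Longrightarrow> \<bar>t\<bar> \<le> b" unfolding T_def using D(2) by auto
    qed
    then obtain p where p: "\<And>s. s > 0 \<Longrightarrow> \<exists>t. T s t \<and> \<bar>t - p\<bar> < s" by blast
    have "p > 0"
    proof (rule ccontr)
      assume "\<not> p > 0"
      have "1 / R > 0" using R by simp
      then obtain t where t: "T (1 / R) t" "\<bar>t - p\<bar> < 1 / R" using p by blast
      then have "t < 1 / R" using \<open>\<not> p > 0\<close> by linarith
      then have "R * t < 1" using R by (simp add: field_simps)
      with t(1) show False unfolding T_def by simp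
    qed
    \<comment> \<open>\<open>D\<close> is closed in the positive half-line only, so
      \<open>p > 0\<close> has to be known before.\<close>
    have pD: "p \<in> D"
    proof (rule D(4)[OF \<open>p > 0\<close>])
      show "\<exists>t\<in>D. \<bar>t - p\<bar> < s" if "s > 0" for s using p[OF that] unfolding T_def by blast
    qed
    have "F x = \<psi> (vec1 p)"
    proof (rule dn_eqI[OF FxF dfun_Fn[OF \<psi>(1) vec1_Fn]])
      fix s :: 'a assume s: "s > 0"
      obtain r where r: "r > 0" "\<forall>t\<in>D. \<bar>t - p\<bar> < r \<longrightarrow> dn m (\<psi> (vec1 p)) (\<psi> (vec1 t)) < s"
        using \<psi>(3)[OF pD s] by blast
      have "min r s > 0" using r s by simp
      then obtain t where t: "T (min r s) t" "\<bar>t - p\<bar> < min r s" using p by blast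
      show "\<exists>z. dn m (F x) z < s \<and> dn m z (\<psi> (vec1 p)) < s"
      proof (intro exI conjI)
        show "dn m (F x) (\<psi> (vec1 t)) < s" using t(1) unfolding T_def by simp
        show "dn m (\<psi> (vec1 t)) (\<psi> (vec1 p)) < s"
          using r(2) t dn_sym[of m "\<psi> (vec1 t)" "\<psi> (vec1 p)"] unfolding T_def by simp
      qed
    qed
    then have "f x \<in> Z" using x pD unfolding Z_def F_def by auto
    with x show "x \<in> {x \<in> X. f x \<in> Z}" by blast
  qed auto
  from closing[OF dZ ZY this] have Zcl: "\<forall>y\<in>Y. (\<forall>s>0. \<exists>z\<in>Z. dn m y z < s) \<longrightarrow> y \<in> Z"
    unfolding closedin_top_on[OF YF] by blast
  have "F x0 \<in> Z"
  proof (rule Zcl[rule_format, OF FY[OF x0X]])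
    fix s :: 'a assume "s > 0"
    then obtain t where t: "t \<in> D" "t < s" using D(3) by blast
    then have "dn m (F x0) (\<psi> (vec1 t)) < s" using \<psi>(2)[OF t(1)] unfolding Q_def by (auto simp: dn_sym)
    then show "\<exists>z\<in>Z. dn m (F x0) z < s" using t(1) unfolding Z_def by blast
  qed
  then obtain t where t: "t \<in> D" "F x0 = \<psi> (vec1 t)" unfolding Z_def by blast
  then obtain k where k: "k \<in> K0" "F x0 = F k" "1 / t + h x0 + 1 < h k" using \<psi>(2)[OF t(1)] unfolding Q_def by auto
  have "(k, x0) \<in> E" using FE[of k x0] k(1,2) K0X x0X by auto
  then have "h k \<le> h x0 + 1" using K0 k(1) by blast
  moreover have "1 / t > 0" using t(1) D(2) by auto
  ultimately show False using k(3) by linarith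
qed

lemma quotient_imp_proper:
  fixes M :: "('a::{linordered_field, linorder_topology}, 'f, 'r) expansion"
  assumes M: "definably_complete M" and ch: "definable_choice M" and pf: "good_pseudo_filter M \<DD>"
    and dX: "definable M n X" and lc: "locally_closed_in (Fn_top n) X"
    and E: "equiv X E" "definable M (n + n) (flat n n E)" "closed_rel n n X X E"
    and Q: "definable_quotient M n m X E Y f"
  shows "\<exists>K. definable M n K \<and> K \<subseteq> X \<and> closedin (top_on n X) K \<and>
      definably_proper M (n + n) n {z \<in> flat n n E. proj2 n z \<in> K} X (proj1 n) \<and>
      proj1 n ` {z \<in> flat n n E. proj2 n z \<in> K} = X"
proof -
  have XF: "X \<subseteq> Fn n" using definable_subset[OF dX] .
  have EX: "E \<subseteq> X \<times> X" using E(1) equiv_type by blast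
  have EF: "E \<subseteq> Fn n \<times> Fn n" using EX XF by blast
  have Etr: "(x, z) \<in> E" if "(x, y) \<in> E" "(y, z) \<in> E" for x y z using E(1) that by (meson equiv_def transE)
  have Erefl: "(x, x) \<in> E" if "x \<in> X" for x using E(1) that by (meson equiv_def refl_onD)
  obtain h where dh: "dsfun M n h" and ch': "scont_on n X h" and h1: "\<forall>x\<in>X. 1 \<le> h x"
    and hc: "\<forall>r. definably_compact M n {x \<in> X. h x \<le> r}"
    using exhaustion[OF M dX lc] by (elim exE conjE) blast
  \<comment> \<open>Near-minimality is expressed by comparison with all related points, which avoids
    naming the infimum in a formula.\<close>
  define K0 where "K0 = {k \<in> X. \<forall>x\<in>X. (k, x) \<in> E \<longrightarrow> h k \<le> h x + 1}"
  define K where "K = {x \<in> X. \<forall>s>0. \<exists>y\<in>K0. dn n x y < s}"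
  have dK0: "definable M n K0"
    unfolding K0_def
    by (intro definable_Collect[OF dX] dpred_ball[OF dX] dpred_imp dpred_pair[OF E(2) EF]
        dpred_le dscal_add dscal_const dsfun_dscal[OF dh] dvect_var)
  have dK: "definable M n K"
    unfolding K_def
    by (intro definable_Collect[OF dX] dpred_all dpred_imp dpred_bex[OF dK0] dpred_less
        dscal_dn dvect_var dscal_var dscal_const)
  have K0X: "K0 \<subseteq> X" and KX: "K \<subseteq> X" unfolding K0_def K_def by auto
  have K0K: "K0 \<subseteq> K" using K0X unfolding K_def by (auto intro!: exI bexI[of _ _ K0])
  have Kcl: "x \<in> K" if x: "x \<in> X" "\<And>s. s > 0 \<Longrightarrow> \<exists>y\<in>K. dn n x y < s" for x
  proof -
    have Kc: "K = X \<inter> clos n K0" using XF unfolding K_def clos_def by blast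
    have "x \<in> clos n K0" by (rule clos_closed) (use x XF Kc in blast)+
    with x(1) Kc show ?thesis by blast
  qed
  have cK: "closedin (top_on n X) K" unfolding closedin_top_on[OF XF] using KX Kcl by blast
  have surj: "\<exists>k\<in>K. (x, k) \<in> E" if x: "x \<in> X" for x
  proof -
    define A where "A = {a. \<exists>y\<in>X. (x, y) \<in> E \<and> a = h y}"
    have dA: "dpred M (\<lambda>e. e 0 \<in> A)"
      unfolding A_def mem_Collect_eq using x XF
      by (intro dpred_bex[OF dX] dpred_conj dpred_pair[OF E(2) EF] dpred_eq dscal_var dsfun_dscal[OF dh]
          dvect_var dvect_const) auto
    have "h x \<in> A" using x Erefl unfolding A_def by blast
    moreover have "1 \<le> a" if "a \<in> A" for a using that h1 unfolding A_def by blast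
    ultimately obtain s where s: "\<forall>a. a \<in> A \<longrightarrow> s \<le> a"
      "\<forall>u. (\<forall>a. a \<in> A \<longrightarrow> u \<le> a) \<longrightarrow> u \<le> s" using definable_glb[OF M dA] by metis
    \<comment> \<open>The unit of slack yields a nearly minimal \<open>k\<close> without showing
      that the infimum is attained.\<close>
    have "\<not> s + 1 \<le> s" by simp
    then obtain a where "a \<in> A" "a < s + 1" using s(2) by (meson not_le)
    then obtain k where k: "k \<in> X" "(x, k) \<in> E" "h k < s + 1" unfolding A_def by blast
    have "h k \<le> h y + 1" if "y \<in> X" "(k, y) \<in> E" for y
    proof -
      have "h y \<in> A" using that Etr[OF k(2)] unfolding A_def by blast
      then have "s \<le> h y" using s(1) by blast
      then show ?thesis using k(3) by linarith
    qed
    then have "k \<in> K0" using k(1) unfolding K0_def by blast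
    then show ?thesis using k(2) K0K by blast
  qed
  have "definably_compact M (n + n) (flat n n {(x, k) \<in> E. k \<in> K \<and> x \<in> C})"
    if C: "definably_compact M n C" "C \<subseteq> X" for C
  proof -
    have "\<exists>r. \<forall>(x, k)\<in>E. x \<in> C \<and> k \<in> K \<longrightarrow> h k \<le> r"
      by (rule identifying_bounded[OF M ch pf dX E(2) EX Q dh ch' _ dK0 K0X _ K_def C])
        (use h1 EX in \<open>auto simp: K0_def\<close>)
    then obtain r where r: "\<And>x k. (x, k) \<in> E \<Longrightarrow> x \<in> C \<Longrightarrow> k \<in> K \<Longrightarrow> h k \<le> r" by blast
    \<comment> \<open>The bound \<open>r\<close> replaces \<open>K\<close> by a definably compact
      part, so that over \<open>C\<close> the relation is a closed part of
      \<open>C \<times> A\<close>.\<close>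
    define A where "A = {k \<in> K. h k \<le> r}"
    have A: "definably_compact M n A" "A \<subseteq> X"
      unfolding A_def using exhaustion_closed_subset[OF dh spec[OF hc] XF dK KX cK] KX by auto
    have dCA: "definable M n C" "definable M n A" using C(1) A(1) unfolding definably_compact_iff by auto
    have "definably_compact M (n + n) (flat n n (E \<inter> C \<times> A))"
      by (rule compact_flatI[OF C(1) A(1) Int_lower2 definable_flat_restrict[OF E(2) EF dCA]
            closed_rel_restrict[OF E(3) C(2) A(2)]])
    moreover have "E \<inter> C \<times> A = {(x, k) \<in> E. k \<in> K \<and> x \<in> C}" using r unfolding A_def by auto
    ultimately show ?thesis by simp
  qed
  then have "definably_proper M (n + n) n {z \<in> flat n n E. proj2 n z \<in> K} X (proj1 n)"
    using definably_proper_proj1_iff[OF dX EX E(2) dK] by blast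
  moreover have "proj1 n ` {z \<in> flat n n E. proj2 n z \<in> K} = X"
    using surj_proj1_iff[OF dX EX E(2) dK] surj by blast
  ultimately show ?thesis using dK KX cK by blast
qed

section \<open>From proper projections to quotients\<close>

text \<open>
  With \<open>u = 1 / h\<close>, the map \<open>x \<mapsto> (u\<^sup>2 x, u)\<close> embeds \<open>K\<close> into a bounded set so that the point at infinity
  becomes the origin; properness says that \<open>E\<close> stays closed after adding that point.
\<close>

lemma proper_imp_quotient:
  fixes M :: "('a::{linordered_field, linorder_topology}, 'f, 'r) expansion"
    and \<E> :: "nat \<Rightarrow> 'e::linorder set"
  assumes M: "definably_complete M" and ch: "definable_choice M" and rk: "good_extended_rank M \<E> eRank"
    and dX: "definable M n X" and lc: "locally_closed_in (Fn_top n) X"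
    and E: "equiv X E" "definable M (n + n) (flat n n E)" "closed_rel n n X X E"
    and K: "definable M n K" "K \<subseteq> X" "closedin (top_on n X) K"
    and proper: "\<And>C. definably_compact M n C \<Longrightarrow> C \<subseteq> X \<Longrightarrow>
      definably_compact M (n + n) (flat n n {(x, k) \<in> E. k \<in> K \<and> x \<in> C})"
    and surj: "\<And>x. x \<in> X \<Longrightarrow> \<exists>k\<in>K. (x, k) \<in> E"
  shows "\<exists>m Y f. definable_quotient M n m X E Y f"
proof -
  have XF: "X \<subseteq> Fn n" using definable_subset[OF dX] .
  have KF: "K \<subseteq> Fn n" using K(2) XF by blast
  have EX: "E \<subseteq> X \<times> X" using E(1) equiv_type by blast
  have EF: "E \<subseteq> Fn n \<times> Fn n" using EX XF by blast
  have Esym: "(y, x) \<in> E" if "(x, y) \<in> E" for x y using E(1) that by (meson equiv_def symE)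
  have Etr: "(x, z) \<in> E" if "(x, y) \<in> E" "(y, z) \<in> E" for x y z using E(1) that by (meson equiv_def transE)
  have Erefl: "(x, x) \<in> E" if "x \<in> X" for x using E(1) that by (meson equiv_def refl_onD)
  obtain h where dh: "dsfun M n h" and ch': "scont_on n X h" and h1: "\<forall>x\<in>X. 1 \<le> h x"
    and hi: "\<forall>x\<in>X. \<forall>i<n. \<bar>x i\<bar> \<le> h x" and hc: "\<forall>r. definably_compact M n {x \<in> X. h x \<le> r}"
    using exhaustion[OF M dX lc] by (elim exE conjE) blast
  define u where "u x = inverse (h x)" for x
  have u: "0 < u x" "u x \<le> 1" "u x * h x = 1" if "x \<in> X" for x
  proof -
    have "1 \<le> h x" using h1 that by blast
    then show "0 < u x" "u x \<le> 1" "u x * h x = 1" unfolding u_def by (auto simp: inverse_le_1_iff)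
  qed
  have du: "dsfun M n u" unfolding u_def by (rule dsfun_inverse[OF dh])
  have cu: "scont_on n X u" unfolding u_def by (rule scont_inverse[OF ch']) (use h1 in force)
  \<comment> \<open>Because \<open>|x i| \<le> h x = 1 / u x\<close>, the coordinates scaled by
    \<open>u x * u x\<close> are at most \<open>u x\<close> and vanish at infinity; a single factor
    would only bound them by 1. The last coordinate \<open>u x\<close> allows \<open>x\<close> to be
    recovered.\<close>
  define t where "t i = (if i < n then (\<lambda>x. u x * u x * x i) else u)" for i
  define c where "c x = (\<lambda>i\<in>{..<Suc n}. t i x)" for x
  have dc: "dfun M n (Suc n) c"
    unfolding c_def
  proof (rule dfun_coordI)
    show "dsfun M n (t i)" for i unfolding t_def using du by (auto intro!: dsfun_ops(3) dsfun_coord)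
  qed
  have cc: "cont_on n (Suc n) X c"
  proof (rule cont_coordI)
    fix i assume i: "i < Suc n"
    have "scont_on n X (t i)" unfolding t_def using cu by (auto intro!: scont_mult scont_coord)
    then show "scont_on n X (\<lambda>x. c x i)" using i by (simp add: c_def)
  qed
  have cn: "c x n = u x" for x by (simp add: c_def t_def)
  have ci: "\<bar>c x i\<bar> \<le> u x" if x: "x \<in> X" and i: "i < Suc n" for x i
  proof (cases "i < n")
    case True
    then have "\<bar>c x i\<bar> = u x * u x * \<bar>x i\<bar>" using i u(1)[OF x] by (simp add: c_def t_def abs_mult)
    also have "\<dots> \<le> u x * u x * h x" using hi x True u(1)[OF x] by (intro mult_left_mono) auto
    also have "\<dots> = u x" using u(3)[OF x] by (simp add: mult.assoc)
    finally show ?thesis .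
  next
    case False
    then show ?thesis using i u(1)[OF x] by (simp add: c_def t_def)
  qed
  have cF: "c x \<in> Fn (Suc n)" for x unfolding c_def by (rule Fn_restrict)
  have cinj: "x = y" if x: "x \<in> X" and y: "y \<in> X" and eq: "c x = c y" for x y
  proof (rule Fn_eqI[of _ n])
    show "x \<in> Fn n" "y \<in> Fn n" using x y XF by auto
    have uu: "u x = u y" using cn eq by metis
    fix i assume "i < n"
    then show "x i = y i" using fun_cong[OF eq, of i] u(1)[OF y] uu by (simp add: c_def t_def)
  qed
  define o' :: "nat \<Rightarrow> 'a" where "o' = (\<lambda>i\<in>{..<Suc n}. 0)"
  have o'F: "o' \<in> Fn (Suc n)" unfolding o'_def by (rule Fn_restrict)
  have o'i: "i < Suc n \<Longrightarrow> o' i = 0" for i unfolding o'_def by simp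
  have c_o': "c x \<noteq> o'" if "x \<in> X" for x
    using cn[of x] u(1)[OF that] o'i[of n] by auto

  \<comment> \<open>Over \<open>w n > 0\<close> the map \<open>c\<close> is proper on
    \<open>K\<close>: \<open>h\<close> is bounded at points \<open>k\<close> with \<open>c k\<close>
    near \<open>w\<close>, so these points accumulate in \<open>K\<close>. The predicate
    \<open>P\<close> carries further conditions through the limit.\<close>
  have limit: "\<exists>k0\<in>K. c k0 = w \<and> (\<forall>s>0. \<exists>k\<in>K. P s k \<and> dn n k k0 < s)"
    if w: "w \<in> Fn (Suc n)" "w n > 0" and P: "dpred M (\<lambda>e. P (e 0) (\<lambda>i\<in>{..<n}. e (Suc i)))"
      and mono: "\<And>s t x. P s x \<Longrightarrow> s \<le> t \<Longrightarrow> P t x"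
      and ne: "\<And>s. s > 0 \<Longrightarrow> \<exists>k\<in>K. P s k \<and> dn (Suc n) (c k) w < s"
    for w P
  proof -
    \<comment> \<open>A distance of \<open>c k\<close> from \<open>w\<close> below
      \<open>w n / 2\<close> gives \<open>u k > w n / 2\<close>, that is
      \<open>h k < 2 / w n\<close>.\<close>
    define C where "C = {x \<in> K. h x \<le> 2 / w n}"
    have C: "definably_compact M n C"
      unfolding C_def by (rule exhaustion_closed_subset[OF dh spec[OF hc] XF K])
    have "\<exists>p\<in>C. \<forall>s>0. \<exists>k\<in>C. (P s k \<and> dn (Suc n) (c k) w < s) \<and> dn n k p < s"
    proof (rule definably_compact_limit_point[OF M C])
      show "dpred M (\<lambda>e. P (e 0) (\<lambda>i\<in>{..<n}. e (Suc i)) \<and> dn (Suc n) (c (\<lambda>i\<in>{..<n}. e (Suc i))) w < e 0)"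
        by (intro dpred_conj P dpred_less dscal_dn dfun_dvect[OF dc] dvect_var dvect_const w(1) dscal_var)
      show "\<exists>k\<in>C. P s k \<and> dn (Suc n) (c k) w < s" if s: "s > 0" for s
      proof -
        have "min s (w n / 2) > 0" using s w(2) by simp
        then obtain k where k: "k \<in> K" "P (min s (w n / 2)) k" "dn (Suc n) (c k) w < min s (w n / 2)"
          using ne by blast
        have kX: "k \<in> X" using k(1) K(2) by blast
        have "\<bar>u k - w n\<bar> < w n / 2" using dn_coord[of n "Suc n" "c k" w] k(3) by (simp add: cn)
        then have "w n / 2 < u k" by linarith
        then have "w n / 2 * h k \<le> u k * h k" using h1 kX by (intro mult_right_mono) (auto intro: order_trans)
        then have "h k \<le> 2 / w n" using u(3)[OF kX] w(2) by (simp add: field_simps)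
        then have "k \<in> C" using k(1) unfolding C_def by blast
        moreover have "P s k" using mono[OF k(2), of s] by simp
        ultimately show ?thesis using k(3) by auto
      qed
      show "P t k \<and> dn (Suc n) (c k) w < t" if "P s k \<and> dn (Suc n) (c k) w < s" "s \<le> t" for s t k
        using that mono by auto
    qed
    then obtain p where p: "p \<in> C" "\<And>s. s > 0 \<Longrightarrow> \<exists>k\<in>C. (P s k \<and> dn (Suc n) (c k) w < s) \<and> dn n k p < s" by blast
    have pX: "p \<in> X" using p(1) K(2) unfolding C_def by blast
    have "c p = w"
    proof (rule dn_eqI[OF cF w(1)])
      fix s :: 'a assume s: "s > 0"
      obtain r where r: "r > 0" "\<And>y. y \<in> X \<Longrightarrow> dn n p y < r \<Longrightarrow> dn (Suc n) (c p) (c y) < s"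
        using cont_onD[OF cc pX s] by blast
      have "min r s > 0" using r(1) s by simp
      then obtain k where k: "k \<in> C" "dn (Suc n) (c k) w < min r s" "dn n k p < min r s" using p(2) by blast
      have "k \<in> X" using k(1) K(2) unfolding C_def by blast
      with r(2)[of k] k show "\<exists>z. dn (Suc n) (c p) z < s \<and> dn (Suc n) z w < s"
        by (intro exI[of _ "c k"]) (simp add: dn_sym)
    qed
    moreover have "\<exists>k\<in>K. P s k \<and> dn n k p < s" if "s > 0" for s using p(2)[OF that] unfolding C_def by blast
    ultimately show ?thesis using p(1) unfolding C_def by blast
  qed

  define KP where "KP = {w \<in> Fn (Suc n). w \<in> c ` K \<or> w = o'}"
  have KP: "c ` K \<subseteq> KP" "o' \<in> KP" using cF o'F unfolding KP_def by auto
  have cKP: "definably_compact M (Suc n) KP"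
    unfolding definably_compact_iff
  proof (intro conjI ballI impI)
    show "definable M (Suc n) KP"
      unfolding KP_def
      by (intro definableI dpred_disj dpred_mem[OF definable_image[OF K(1) dc]]
          dpred_vect_eq[where n = "Suc n"] dvect_var dvect_const o'F)
    have "\<bar>w i\<bar> \<le> 1" if "w \<in> KP" "i < Suc n" for w i
    proof (cases "w = o'")
      case False
      then obtain k where k: "k \<in> X" "w = c k" using \<open>w \<in> KP\<close> K(2) unfolding KP_def by blast
      with ci[OF k(1) that(2)] u(2)[OF k(1)] show ?thesis by simp
    qed (use o'i that in simp)
    then show "\<exists>B. \<forall>w\<in>KP. \<forall>i<Suc n. \<bar>w i\<bar> \<le> B" by blast
    fix w assume w: "w \<in> Fn (Suc n)" and lim: "\<forall>s>0. \<exists>z\<in>KP. dn (Suc n) w z < s"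
    show "w \<in> KP"
    proof (cases "w = o'")
      case False
      define d where "d = dn (Suc n) w o'"
      have d: "d > 0" using False dn_eq_0[OF w o'F] unfolding d_def by (meson not_le)
      have near: "\<exists>k\<in>K. dn (Suc n) w (c k) < s" if "s > 0" for s
      proof -
        have "min s d > 0" using d that by simp
        then obtain z where z: "z \<in> KP" "dn (Suc n) w z < min s d" using lim by blast
        then have "z \<noteq> o'" unfolding d_def by auto
        with z show ?thesis unfolding KP_def by auto
      qed
      \<comment> \<open>If \<open>w n \<le> 0\<close>, then \<open>u k\<close> is small whenever
        \<open>c k\<close> is near \<open>w\<close>, and \<open>|c k i| \<le> u k\<close> forces
        every coordinate of \<open>w\<close> to be 0.\<close>
      have "w n > 0"
      proof (rule ccontr)
        assume neg: "\<not> w n > 0"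
        have "w i = o' i" if i: "i < Suc n" for i
        proof (rule ccontr)
          assume "w i \<noteq> o' i"
          then have "\<bar>w i\<bar> / 2 > 0" using o'i[OF i] by simp
          then obtain k where k: "k \<in> K" "dn (Suc n) w (c k) < \<bar>w i\<bar> / 2" using near by blast
          have "\<bar>w n - u k\<bar> < \<bar>w i\<bar> / 2" using dn_coord[of n "Suc n" w "c k"] k(2) by (simp add: cn)
          moreover have "\<bar>w i - c k i\<bar> < \<bar>w i\<bar> / 2" using dn_coord[OF i, of w "c k"] k(2) by simp
          moreover have "\<bar>c k i\<bar> \<le> u k" using ci[OF _ i] k(1) K(2) by blast
          ultimately show False using neg by linarith
        qed
        then show False using False Fn_eqI[OF w o'F] by blast
      qed
      have "\<exists>k0\<in>K. c k0 = w \<and> (\<forall>s>0. \<exists>k\<in>K. True \<and> dn n k k0 < s)"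
        by (rule limit[OF w \<open>w n > 0\<close>]) (use near in \<open>auto intro: dpred_const simp: dn_sym\<close>)
      then show ?thesis using KP(1) by blast
    qed (use KP in simp)
  qed

  \<comment> \<open>The point \<open>o'\<close> forms a class of its own. This relation is closed
    only because properness keeps points related to a region of bounded \<open>h\<close> from
    approaching \<open>o'\<close>.\<close>
  define EP where "EP = {(w, w'). w \<in> Fn (Suc n) \<and> w' \<in> Fn (Suc n) \<and>
    ((\<exists>k\<in>K. \<exists>k'\<in>K. (k, k') \<in> E \<and> w = c k \<and> w' = c k') \<or> (w = o' \<and> w' = o'))}"
  have EP_iff: "(w, w') \<in> EP \<longleftrightarrow>
    (\<exists>k\<in>K. \<exists>k'\<in>K. (k, k') \<in> E \<and> w = c k \<and> w' = c k') \<or> (w = o' \<and> w' = o')" for w w'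
    unfolding EP_def using cF o'F by auto
  have c_o'K: "c k \<noteq> o'" if "k \<in> K" for k using c_o' K(2) that by blast
  have EP_c: "(c k, c k') \<in> EP \<longleftrightarrow> (k, k') \<in> E" if "k \<in> K" "k' \<in> K" for k k'
  proof
    assume "(c k, c k') \<in> EP"
    moreover have "c k \<noteq> o'" using c_o'K that(1) .
    ultimately obtain a b where ab: "a \<in> K" "b \<in> K" "(a, b) \<in> E" "c k = c a" "c k' = c b"
      unfolding EP_iff by blast
    then have "k = a" "k' = b" using cinj that K(2) by blast+
    with ab show "(k, k') \<in> E" by simp
  next
    assume "(k, k') \<in> E"
    with that show "(c k, c k') \<in> EP" unfolding EP_iff by blast
  qed
  have EP_o: "(o', w) \<in> EP \<longleftrightarrow> w = o'" "(w, o') \<in> EP \<longleftrightarrow> w = o'" for w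
    unfolding EP_iff using c_o'K by metis+
  have EP_KP: "EP \<subseteq> KP \<times> KP" using KP unfolding EP_def by auto
  have KP_cases: "w = o' \<or> (\<exists>k\<in>K. w = c k)" if "w \<in> KP" for w using that unfolding KP_def by blast
  have EP_equiv: "equiv KP EP"
  proof (rule equivI)
    show "EP \<subseteq> KP \<times> KP" by (rule EP_KP)
    show "refl_on KP EP"
      unfolding refl_on_def using KP_cases EP_c EP_o Erefl K(2) by blast
    show "sym EP"
      unfolding sym_def EP_iff using Esym by blast
    show "trans EP"
    proof (rule transI)
      fix x y z assume xy: "(x, y) \<in> EP" and yz: "(y, z) \<in> EP"
      show "(x, z) \<in> EP"
      proof (cases "y = o'")
        case True
        then show ?thesis using xy yz EP_o by auto
      next
        case False
        then have "x \<noteq> o'" "z \<noteq> o'" using xy yz EP_o by auto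
        moreover have "x \<in> KP" "y \<in> KP" "z \<in> KP" using EP_KP xy yz by auto
        ultimately obtain a b d where abd: "a \<in> K" "x = c a" "b \<in> K" "y = c b" "d \<in> K" "z = c d"
          using KP_cases[of x] KP_cases[of y] KP_cases[of z] False by blast
        then have "(a, b) \<in> E" "(b, d) \<in> E" using xy yz EP_c by auto
        from Etr[OF this] show ?thesis using abd EP_c by simp
      qed
    qed
  qed
  have dEP: "definable M (Suc n + Suc n) (flat (Suc n) (Suc n) EP)"
  proof (rule definable_flatI)
    have "dpred M (\<lambda>e. (\<exists>k\<in>K. \<exists>k'\<in>K. (k, k') \<in> E \<and> (\<lambda>i\<in>{..<Suc n}. e i) = c k \<and>
        (\<lambda>i\<in>{..<Suc n}. e (Suc n + i)) = c k') \<or>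
      ((\<lambda>i\<in>{..<Suc n}. e i) = o' \<and> (\<lambda>i\<in>{..<Suc n}. e (Suc n + i)) = o'))"
      by (intro dpred_disj dpred_conj dpred_bex[OF K(1)] dpred_pair[OF E(2) EF]
          dpred_vect_eq[where n = "Suc n"] dfun_dvect[OF dc] dvect_var dvect_const o'F)
    then show "dpred M (\<lambda>e. ((\<lambda>i\<in>{..<Suc n}. e i), (\<lambda>i\<in>{..<Suc n}. e (Suc n + i))) \<in> EP)"
      unfolding EP_def by (simp only: mem_Collect_eq case_prod_conv Fn_restrict simp_thms)
    show "EP \<subseteq> Fn (Suc n) \<times> Fn (Suc n)" unfolding EP_def by blast
  qed
  \<comment> \<open>Closedness at a finite first entry. The first entries converge in
    \<open>K\<close>, so they stay where \<open>h\<close> is bounded. Over that definably compact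
    region properness makes the set of pairs definably compact, and the second entries converge in
    \<open>K\<close> as well; in particular \<open>w'\<close> is not \<open>o'\<close>.\<close>
  have EP_lim: "(c k1, w') \<in> EP" if k1: "k1 \<in> K" and w': "w' \<in> KP"
    and lim: "\<And>s. s > 0 \<Longrightarrow> \<exists>(a, b)\<in>EP. dn (Suc n) (c k1) a < s \<and> dn (Suc n) w' b < s" for k1 w'
  proof -
    have k1X: "k1 \<in> X" using k1 K(2) by blast
    have w'F: "w' \<in> Fn (Suc n)" using w' unfolding KP_def by blast
    have pos: "c k1 n > 0" using u(1)[OF k1X] by (simp add: cn)
    define P where "P s k \<longleftrightarrow> (\<exists>k'\<in>K. (k, k') \<in> E \<and> dn (Suc n) w' (c k') < s)" for s k
    have "\<exists>k0\<in>K. c k0 = c k1 \<and> (\<forall>s>0. \<exists>k\<in>K. P s k \<and> dn n k k0 < s)"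
    proof (rule limit[OF cF pos])
      show "dpred M (\<lambda>e. P (e 0) (\<lambda>i\<in>{..<n}. e (Suc i)))"
        unfolding P_def
        by (intro dpred_bex[OF K(1)] dpred_conj dpred_pair[OF E(2) EF] dpred_less dscal_dn
            dfun_dvect[OF dc] dvect_var dvect_const w'F dscal_var)
      show "\<And>s t x. P s x \<Longrightarrow> s \<le> t \<Longrightarrow> P t x" unfolding P_def by (meson less_le_trans)
      fix s :: 'a assume s: "s > 0"
      have "min s (c k1 n) > 0" using s pos by simp
      then obtain a b where ab: "(a, b) \<in> EP" "dn (Suc n) (c k1) a < min s (c k1 n)"
        "dn (Suc n) w' b < min s (c k1 n)" using lim by blast
      have "a \<noteq> o'"
      proof
        assume "a = o'"
        then have "\<bar>c k1 n - 0\<bar> < c k1 n"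
          using dn_coord[of n "Suc n" "c k1" a] ab(2) o'i[of n] by simp
        then show False by simp
      qed
      then obtain k k' where k: "k \<in> K" "k' \<in> K" "(k, k') \<in> E" "a = c k" "b = c k'"
        using ab(1) unfolding EP_iff by blast
      then have "P s k" unfolding P_def using ab(3) by auto
      moreover have "dn (Suc n) (c k) (c k1) < s" using ab(2) k(4) by (simp add: dn_sym)
      ultimately show "\<exists>k\<in>K. P s k \<and> dn (Suc n) (c k) (c k1) < s" using k(1) by blast
    qed
    then obtain k0 where "k0 \<in> K" "c k0 = c k1" and lim1: "\<forall>s>0. \<exists>k\<in>K. P s k \<and> dn n k k0 < s" by blast
    then have "k0 = k1" using cinj K(2) k1X by blast
    with lim1 have lim1: "\<And>s. s > 0 \<Longrightarrow> \<exists>k\<in>K. P s k \<and> dn n k k1 < s" by blast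
    define C where "C = {x \<in> X. h x \<le> h k1 + 1}"
    define R where "R = {(x, k) \<in> E. k \<in> K \<and> x \<in> C}"
    have cR: "definably_compact M (n + n) (flat n n R)"
      unfolding R_def by (rule proper) (use hc in \<open>auto simp: C_def\<close>)
    have RF: "R \<subseteq> Fn n \<times> Fn n" using EF unfolding R_def by blast
    have "\<exists>(p, q)\<in>R. \<forall>s>0. \<exists>(x, y)\<in>R. (dn n x k1 < s \<and> dn (Suc n) w' (c y) < s) \<and> dn n x p < s \<and> dn n y q < s"
    proof (rule definably_compact_limit_pair[OF M cR RF])
      have k1F: "k1 \<in> Fn n" using k1 KF by blast
      show "dpred M (\<lambda>e. dn n (\<lambda>i\<in>{..<n}. e (Suc i)) k1 < e 0 \<and> dn (Suc n) w' (c (\<lambda>i\<in>{..<n}. e (Suc (n + i)))) < e 0)"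
        by (intro dpred_conj dpred_less dscal_dn dfun_dvect[OF dc] dvect_var dvect_const w'F k1F dscal_var)
      show "\<exists>(x, y)\<in>R. dn n x k1 < s \<and> dn (Suc n) w' (c y) < s" if s: "s > 0" for s
      proof -
        obtain r where r: "r > 0" "\<And>y. y \<in> X \<Longrightarrow> dn n k1 y < r \<Longrightarrow> \<bar>h k1 - h y\<bar> < 1"
          using scont_onD[OF ch' k1X, of 1] by auto
        have "min r s > 0" using r(1) s by simp
        then obtain k where k: "k \<in> K" "P (min r s) k" "dn n k k1 < min r s" using lim1 by blast
        then obtain k' where k': "k' \<in> K" "(k, k') \<in> E" "dn (Suc n) w' (c k') < min r s" unfolding P_def by blast
        have "k \<in> X" using k(1) K(2) by blast
        then have "\<bar>h k1 - h k\<bar> < 1" using r(2)[of k] k(3) by (simp add: dn_sym)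
        then have "h k \<le> h k1 + 1" by linarith
        then have "(k, k') \<in> R" using k' \<open>k \<in> X\<close> unfolding R_def C_def by blast
        moreover have "dn n k k1 < s" "dn (Suc n) w' (c k') < s" using k(3) k'(3) by auto
        ultimately show ?thesis by blast
      qed
      show "dn n x k1 < t \<and> dn (Suc n) w' (c y) < t" if "dn n x k1 < s \<and> dn (Suc n) w' (c y) < s" "s \<le> t" for s t x y
        using that by auto
    qed
    then obtain p q where pq: "(p, q) \<in> R"
      "\<And>s. s > 0 \<Longrightarrow> \<exists>(x, y)\<in>R. (dn n x k1 < s \<and> dn (Suc n) w' (c y) < s) \<and> dn n x p < s \<and> dn n y q < s" by blast
    have "k1 = p"
    proof (rule dn_eqI)
      show "k1 \<in> Fn n" "p \<in> Fn n" using k1 KF pq(1) RF by auto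
      fix s :: 'a assume "s > 0"
      then obtain x y where "dn n x k1 < s" "dn n x p < s" using pq(2) by blast
      then show "\<exists>z. dn n k1 z < s \<and> dn n z p < s" by (intro exI[of _ x]) (simp add: dn_sym)
    qed
    have q: "q \<in> K" "q \<in> X" using pq(1) K(2) unfolding R_def by auto
    have "w' = c q"
    proof (rule dn_eqI[OF w'F cF])
      fix s :: 'a assume s: "s > 0"
      obtain r where r: "r > 0" "\<And>y. y \<in> X \<Longrightarrow> dn n q y < r \<Longrightarrow> dn (Suc n) (c q) (c y) < s"
        using cont_onD[OF cc q(2) s] by blast
      have "min r s > 0" using r(1) s by simp
      then obtain x y where xy: "(x, y) \<in> R" "dn (Suc n) w' (c y) < min r s" "dn n y q < min r s" using pq(2) by blast
      have "y \<in> X" using xy(1) K(2) unfolding R_def by blast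
      with r(2)[of y] xy show "\<exists>z. dn (Suc n) w' z < s \<and> dn (Suc n) z (c q) < s"
        by (intro exI[of _ "c y"]) (simp add: dn_sym)
    qed
    then show ?thesis using EP_c[OF k1 q(1)] pq(1) \<open>k1 = p\<close> unfolding R_def by auto
  qed
  have cEP: "closed_rel (Suc n) (Suc n) KP KP EP"
    unfolding closed_rel_def
  proof (intro ballI impI)
    fix w w' assume w: "w \<in> KP" and w': "w' \<in> KP"
      and lim: "\<forall>s>0. \<exists>(a, b)\<in>EP. dn (Suc n) w a < s \<and> dn (Suc n) w' b < s"
    have EPsym: "(y, x) \<in> EP" if "(x, y) \<in> EP" for x y using EP_equiv that by (meson equiv_def symE)
    \<comment> \<open>Up to symmetry a limit pair with a finite entry is covered by
      \<open>EP_lim\<close>, which leaves only \<open>(o', o')\<close>.\<close>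
    consider "w = o'" "w' = o'" | k where "k \<in> K" "w = c k" | k where "k \<in> K" "w' = c k"
      using KP_cases[OF w] KP_cases[OF w'] by blast
    then show "(w, w') \<in> EP"
    proof cases
      case 1
      then show ?thesis using EP_o by simp
    next
      case 2
      show ?thesis unfolding 2(2)
        by (rule EP_lim[OF 2(1) w']) (use lim in \<open>unfold 2(2), blast\<close>)
    next
      case 3
      have "(c k, w) \<in> EP"
      proof (rule EP_lim[OF 3(1) w])
        fix s :: 'a assume "s > 0"
        then obtain a b where "(a, b) \<in> EP" "dn (Suc n) w a < s" "dn (Suc n) w' b < s" using lim by blast
        then show "\<exists>(a, b)\<in>EP. dn (Suc n) (c k) a < s \<and> dn (Suc n) w b < s"
          unfolding 3(2) using EPsym by blast
      qed
      then show ?thesis unfolding 3(2) by (rule EPsym)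
    qed
  qed

  obtain m f where df: "dfun M (Suc n) m f" and cf: "cont_on (Suc n) m KP f"
    and fE: "\<forall>x\<in>KP. \<forall>y\<in>KP. f x = f y \<longleftrightarrow> (x, y) \<in> EP"
    using compact_quotient[OF M ch rk cKP EP_equiv dEP cEP] by (elim exE conjE) blast
  define g where "g x = f (c x)" for x
  have dg: "dfun M n m g" using df dc unfolding g_def dfun_def by blast
  have cg: "cont_on n m K g"
    unfolding g_def by (rule cont_comp[OF cont_subset[OF cc K(2)] cf KP(1)])
  have gE: "g k = g k' \<longleftrightarrow> (k, k') \<in> E" if "k \<in> K" "k' \<in> K" for k k'
  proof -
    have "c k \<in> KP" "c k' \<in> KP" using KP(1) that by auto
    then show ?thesis using fE EP_c[OF that] unfolding g_def by simp
  qed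
  define R where "R = {(x, k) \<in> E. k \<in> K}"
  have RF: "R \<subseteq> Fn n \<times> Fn n" using EF unfolding R_def by blast
  have dR: "definable M (n + n) (flat n n R)" unfolding R_def by (rule definable_fibre[OF dX EX E(2) K(1)])
  have RK: "Range R \<subseteq> K" unfolding R_def by blast
  have DR: "Domain R = X" using surj EX unfolding R_def by blast
  \<comment> \<open>Near each point of \<open>X\<close> the function \<open>h\<close> is bounded, so
    properness supplies the definably compact part of \<open>R\<close> that the extension
    requires.\<close>
  have "\<exists>G. dfun M n m G \<and> cont_on n m (Domain R) G \<and> (\<forall>x a. (x, a) \<in> R \<longrightarrow> G x = g a)"
  proof (rule extend_along_relation[OF M RF dR dg cont_subset[OF cg RK]])
    show "g a = g b" if "(x, a) \<in> R" "(x, b) \<in> R" for x a b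
      using that gE Esym Etr unfolding R_def by blast
    fix x assume "x \<in> Domain R"
    then have x: "x \<in> X" using DR by simp
    obtain r where r: "r > 0" "\<And>y. y \<in> X \<Longrightarrow> dn n x y < r \<Longrightarrow> \<bar>h x - h y\<bar> < 1"
      using scont_onD[OF ch' x, of 1] by auto
    define C where "C = {y \<in> X. h y \<le> h x + 1}"
    have "definably_compact M (n + n) (flat n n {(x, k) \<in> E. k \<in> K \<and> x \<in> C})"
      by (rule proper) (use hc in \<open>auto simp: C_def\<close>)
    moreover have "(y, a) \<in> {(x, k) \<in> E. k \<in> K \<and> x \<in> C}" if ya: "(y, a) \<in> R" "dn n x y < r" for y a
    proof -
      have "y \<in> X" using ya(1) EX unfolding R_def by blast
      then have "\<bar>h x - h y\<bar> < 1" using r(2) ya(2) by blast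
      then have "h y \<le> h x + 1" by linarith
      then show ?thesis using ya(1) \<open>y \<in> X\<close> unfolding R_def C_def by blast
    qed
    moreover have "{(x, k) \<in> E. k \<in> K \<and> x \<in> C} \<subseteq> R" unfolding R_def by blast
    ultimately show "\<exists>r>0. \<exists>C\<subseteq>R. definably_compact M (n + n) (flat n n C) \<and>
        (\<forall>y a. (y, a) \<in> R \<and> dn n x y < r \<longrightarrow> (y, a) \<in> C)" using r(1) by blast
  qed blast
  then obtain G where dG: "dfun M n m G" and cG: "cont_on n m X G" and GR: "\<forall>x a. (x, a) \<in> R \<longrightarrow> G x = g a"
    unfolding DR by (elim exE conjE) blast
  have GK: "G k = g k" if "k \<in> K" for k
    using GR Erefl that K(2) unfolding R_def by blast
  have GE: "G x = G y \<longleftrightarrow> (x, y) \<in> E" if x: "x \<in> X" and y: "y \<in> X" for x y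
  proof -
    obtain a b where a: "a \<in> K" "(x, a) \<in> E" and b: "b \<in> K" "(y, b) \<in> E" using surj x y by blast
    then have "G x = g a" "G y = g b" using GR unfolding R_def by auto
    moreover have "(a, b) \<in> E \<longleftrightarrow> (x, y) \<in> E" using a b Esym Etr by blast
    ultimately show ?thesis using gE a b by simp
  qed
  define Y where "Y = G ` X"
  have dY: "definable M m Y" unfolding Y_def by (rule definable_image[OF dX dG])
  have YF: "Y \<subseteq> Fn m" using definable_subset[OF dY] .
  have "definable_map M n m X Y G" by (rule definable_mapI[OF dX dY _ dG]) (auto simp: Y_def)
  moreover have "continuous_map (top_on n X) (top_on m Y) G"
    unfolding continuous_map_iff_cont_on[OF XF YF] using cG Y_def by blast
  moreover have "closedin (top_on m Y) Q"
    if Q: "definable M m Q" "Q \<subseteq> Y" "closedin (top_on n X) {x \<in> X. G x \<in> Q}" for Q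
    unfolding closedin_top_on[OF YF]
  proof (intro conjI ballI impI)
    fix y assume y: "y \<in> Y" and lim: "\<forall>s>0. \<exists>q\<in>Q. dn m y q < s"
    have yF: "y \<in> Fn m" using y YF by blast
    obtain x k where k: "x \<in> X" "y = G x" "k \<in> K" "(x, k) \<in> E" using y surj unfolding Y_def by blast
    then have yk: "y = f (c k)" using GR unfolding R_def g_def by auto
    define P where "P s w \<longleftrightarrow> (\<exists>k\<in>K. w = c k \<and> G k \<in> Q) \<and> dn m y (f w) < s" for s w
    \<comment> \<open>The values of \<open>Q\<close> near \<open>y\<close> are attained at points of
      \<open>K\<close>, whose images under \<open>c\<close> accumulate in the definably compact
      \<open>KP\<close>.\<close>
    have "\<exists>p\<in>KP. \<forall>s>0. \<exists>w\<in>KP. P s w \<and> dn (Suc n) w p < s"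
    proof (rule definably_compact_limit_point[OF M cKP])
      show "dpred M (\<lambda>e. P (e 0) (\<lambda>i\<in>{..<Suc n}. e (Suc i)))"
        unfolding P_def
        by (intro dpred_conj dpred_bex[OF K(1)] dpred_vect_eq[where n = "Suc n"] dpred_mem[OF Q(1)]
            dfun_dvect[OF dc] dfun_dvect[OF dG] dfun_dvect[OF df] dpred_less dscal_dn dvect_var
            dvect_const yF dscal_var)
      show "\<exists>w\<in>KP. P s w" if s: "s > 0" for s
      proof -
        obtain q where q: "q \<in> Q" "dn m y q < s" using lim s by blast
        then obtain x' where x': "x' \<in> X" "q = G x'" using Q(2) unfolding Y_def by blast
        obtain k' where k': "k' \<in> K" "(x', k') \<in> E" using surj[OF x'(1)] by blast
        then have "q = g k'" using GR x'(2) unfolding R_def by auto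
        then have "P s (c k')" unfolding P_def using q k'(1) GK[OF k'(1)] by (auto simp: g_def)
        then show ?thesis using KP(1) k'(1) by blast
      qed
    qed (auto simp: P_def)
    then obtain w where w: "w \<in> KP" "\<And>s. s > 0 \<Longrightarrow> \<exists>w'\<in>KP. P s w' \<and> dn (Suc n) w' w < s" by blast
    have wF: "w \<in> Fn (Suc n)" using w(1) unfolding KP_def by blast
    have "y = f w"
    proof (rule dn_eqI[OF yF dfun_Fn[OF df wF]])
      fix s :: 'a assume s: "s > 0"
      obtain r where r: "r > 0" "\<And>v. v \<in> KP \<Longrightarrow> dn (Suc n) w v < r \<Longrightarrow> dn m (f w) (f v) < s"
        using cont_onD[OF cf w(1) s] by blast
      have "min r s > 0" using r(1) s by simp
      then obtain v where v: "v \<in> KP" "P (min r s) v" "dn (Suc n) v w < min r s" using w(2) by blast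
      have "dn m (f w) (f v) < s" using r(2)[OF v(1)] v(3) dn_sym[of "Suc n" v w] by simp
      moreover have "dn m y (f v) < s" using v(2) unfolding P_def by simp
      ultimately show "\<exists>z. dn m y z < s \<and> dn m z (f w) < s"
        by (intro exI[of _ "f v"]) (simp add: dn_sym)
    qed
    have "c k \<in> KP" using KP(1) k(3) by blast
    then have "(w, c k) \<in> EP" using fE w(1) yk \<open>y = f w\<close> by auto
    \<comment> \<open>\<open>f\<close> separates \<open>o'\<close> from \<open>c k\<close>, so the
      limit is finite; \<open>limit\<close> brings it back to \<open>K\<close>, where the closedness
      of the preimage of \<open>Q\<close> applies.\<close>
    then have "w \<noteq> o'" using EP_o c_o'[of k] k(3) K(2) by auto
    then obtain k1 where k1: "k1 \<in> K" "w = c k1" using KP_cases[OF w(1)] by blast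
    have pos: "w n > 0" using u(1)[of k1] k1 K(2) by (auto simp: cn)
    have "\<exists>k0\<in>K. c k0 = w \<and> (\<forall>s>0. \<exists>k\<in>K. G k \<in> Q \<and> dn n k k0 < s)"
    proof (rule limit[OF wF pos])
      show "dpred M (\<lambda>e. G (\<lambda>i\<in>{..<n}. e (Suc i)) \<in> Q)"
        by (intro dpred_mem[OF Q(1)] dfun_dvect[OF dG] dvect_var)
      show "\<exists>k\<in>K. G k \<in> Q \<and> dn (Suc n) (c k) w < s" if "s > 0" for s using w(2)[OF that] unfolding P_def by blast
    qed
    then obtain k0 where k0: "k0 \<in> K" "c k0 = w" "\<And>s. s > 0 \<Longrightarrow> \<exists>k\<in>K. G k \<in> Q \<and> dn n k k0 < s" by blast
    have "k0 \<in> {x \<in> X. G x \<in> Q}"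
    proof -
      have "\<exists>k\<in>{x \<in> X. G x \<in> Q}. dn n k0 k < s" if "s > 0" for s
        using k0(3)[OF that] K(2) by (metis (mono_tags, lifting) dn_sym mem_Collect_eq subsetD)
      then show ?thesis using Q(3) k0(1) K(2) unfolding closedin_top_on[OF XF] by blast
    qed
    moreover have "G k0 = y" using GK[OF k0(1)] k0(2) \<open>y = f w\<close> by (simp add: g_def)
    ultimately show "y \<in> Q" by simp
  qed (rule Q(2))
  ultimately have "definable_quotient M n m X E Y G"
    unfolding definable_quotient_def definably_identifying_def definable_continuous_map_def
    using GE Y_def by blast
  then show ?thesis by blast
qed

theorem theorem5p4:
  fixes M :: "('a::{linordered_field, linorder_topology}, 'f, 'r) expansion"
    and \<DD> :: "'a set set"
    and \<E> :: "nat \<Rightarrow> 'e::linorder set"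
    and eRank :: "nat \<Rightarrow> (nat \<Rightarrow> 'a) set \<Rightarrow> 'e option"
    and n :: nat
    and X :: "(nat \<Rightarrow> 'a) set"
    and E :: "((nat \<Rightarrow> 'a) \<times> (nat \<Rightarrow> 'a)) set"
  assumes "definably_complete M"
    and "definable_choice M"
    and "good_pseudo_filter M \<DD>"
    and "good_extended_rank M \<E> eRank"
    and "definable M n X"
    and "locally_closed_in (Fn_top n) X"
    and "definable_equiv M n X E"
    and "closedin (top_on (n + n) (flat n n (X \<times> X))) (flat n n E)"
  shows "(\<exists>m Y f. definable_quotient M n m X E Y f) \<longleftrightarrow>
    (\<exists>K. definable M n K \<and> K \<subseteq> X \<and> closedin (top_on n X) K \<and>
      definably_proper M (n + n) n {z \<in> flat n n E. proj2 n z \<in> K} X (proj1 n) \<and>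
      proj1 n ` {z \<in> flat n n E. proj2 n z \<in> K} = X)"
proof -
  have E: "equiv X E" "definable M (n + n) (flat n n E)"
    using assms(7) by (auto simp: definable_equiv_def)
  have EX: "E \<subseteq> X \<times> X" using E(1) equiv_type by blast
  have XF: "X \<subseteq> Fn n" using definable_subset[OF assms(5)] .
  have cE: "closed_rel n n X X E" using assms(8) unfolding closed_rel_flat[OF XF XF EX] .
  show ?thesis
  proof
    assume "\<exists>m Y f. definable_quotient M n m X E Y f"
    then obtain m Y f where "definable_quotient M n m X E Y f" by blast
    then show "\<exists>K. definable M n K \<and> K \<subseteq> X \<and> closedin (top_on n X) K \<and>
      definably_proper M (n + n) n {z \<in> flat n n E. proj2 n z \<in> K} X (proj1 n) \<and>
      proj1 n ` {z \<in> flat n n E. proj2 n z \<in> K} = X"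
      by (rule quotient_imp_proper[OF assms(1-3,5,6) E cE])
  next
    assume "\<exists>K. definable M n K \<and> K \<subseteq> X \<and> closedin (top_on n X) K \<and>
      definably_proper M (n + n) n {z \<in> flat n n E. proj2 n z \<in> K} X (proj1 n) \<and>
      proj1 n ` {z \<in> flat n n E. proj2 n z \<in> K} = X"
    then obtain K where K: "definable M n K" "K \<subseteq> X" "closedin (top_on n X) K"
      and p: "definably_proper M (n + n) n {z \<in> flat n n E. proj2 n z \<in> K} X (proj1 n)"
      and s: "proj1 n ` {z \<in> flat n n E. proj2 n z \<in> K} = X" by (elim exE conjE)
    show "\<exists>m Y f. definable_quotient M n m X E Y f"
    proof (rule proper_imp_quotient[OF assms(1,2,4-6) E cE K])
      show "definably_compact M (n + n) (flat n n {(x, k) \<in> E. k \<in> K \<and> x \<in> C})"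
        if "definably_compact M n C" "C \<subseteq> X" for C
        using p that unfolding definably_proper_proj1_iff[OF assms(5) EX E(2) K(1)] by simp
      show "\<exists>k\<in>K. (x, k) \<in> E" if "x \<in> X" for x
        using s that unfolding surj_proj1_iff[OF assms(5) EX E(2) K(1)] by blast
    qed
  qed
qed

end
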